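(* Let $\Bbbk$ be a field of characteristic zero, let $k\ge 1$ be an integer, and let $M$ be a conformal bimodule over the associative conformal algebra $\mathrm{Cend}_k$. Then the conformal Hochschild cohomology groups satisfy $\mathrm H^n(\mathrm{Cend}_k, M)=0$ for all $n\ge 2$.
   Context: Let $H=\Bbbk[\partial]$ be the polynomial algebra in one variable. Associative conformal algebra: an $H$-module $C$ with a $\Bbbk$-bilinear operation $(a,b)\mapsto a_{(\lambda)}b\in C[\lambda]$ such that $(\partial a)_{(\lambda)}b=-\lambda (a_{(\lambda)}b)$, $a_{(\lambda)}(\partial b)=(\partial+\lambda)(a_{(\lambda)}b)$, and $a_{(\lambda)}(b_{(\mu)}c)=(a_{(\lambda)}b)_{(\lambda+\mu)}c$ for all $a,b,c\in C$. The conformal algebra $\mathrm{Cend}_k$: the conformal algebra of all conformal endomorphisms of a free $H$-module of rank $k$; up to isomorphism, it is the space of $k\times k$ matrices over $\Bbbk[\partial,x]$ (with $\partial$ acting by multiplication) with operation given on polynomials by $f(\partial,x)_{(\lambda)}g(\partial,x)=f(-\lambda,x)\,g(\partial+\lambda,x+\lambda)$ and extended to matrices by the row-column rule. Conformal bimodule over $C$: an $H$-module $M$ with $\Bbbk$-bilinear operations $(a,u)\mapsto a_{(\lambda)}u\in M[\lambda]$ and $(u,a)\mapsto u_{(\lambda)}a\in M[\lambda]$ ($a\in C$, $u\in M$), each satisfying the two sesquilinearity identities above (with $\partial$ in the first argument acting as $-\lambda$ and in the second argument as $\partial+\lambda$), and such that $a_{(\lambda)}(b_{(\mu)}u)=(a_{(\lambda)}b)_{(\lambda+\mu)}u$,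 $a_{(\lambda)}(u_{(\mu)}b)=(a_{(\lambda)}u)_{(\lambda+\mu)}b$, $u_{(\lambda)}(a_{(\mu)}b)=(u_{(\lambda)}a)_{(\lambda+\mu)}b$. Conformal Hochschild cohomology $\mathrm H^\bullet(C,M)$: this is the cohomology of the reduced Hochschild complex, defined as follows. For $n\ge 1$, a basic $n$-cochain is a $\Bbbk$-multilinear map $\varphi_{\lambda_1,\dots,\lambda_n}: C^{n}\to M[\lambda_1,\dots,\lambda_n]$ with $\varphi_{\lambda_1,\dots,\lambda_n}(a_1,\dots,\partial a_i,\dots,a_n)=-\lambda_i\,\varphi_{\lambda_1,\dots,\lambda_n}(a_1,\dots,a_n)$ for all $i$; basic $0$-cochains are elements of $M$. The differential is $$(d\varphi)_{\lambda_1,\dots,\lambda_{n+1}}(a_1,\dots,a_{n+1})=a_{1\,(\lambda_1)}\varphi_{\lambda_2,\dots,\lambda_{n+1}}(a_2,\dots,a_{n+1})+\sum_{i=1}^n(-1)^i\varphi_{\lambda_1,\dots,\lambda_i+\lambda_{i+1},\dots,\lambda_{n+1}}(a_1,\dots,a_{i\,(\lambda_i)}a_{i+1},\dots,a_{n+1})+(-1)^{n+1}\varphi_{\lambda_1,\dots,\lambda_n}(a_1,\dots,a_n)_{(-\partial-\lambda_{n+1})}a_{n+1},$$ where all operations are extended linearly over the polynomial variables $\lambda_i$, and $u_{(-\partial-\lambda)}a$ means $\sum_{m}(-\partial-\lambda)^m u_m$ when $u_{(\lambda)}a=\sum_m \lambda^m u_m$. The maps $\varphi\mapsto(\partial+\lambda_1+\dots+\lambda_n)\varphi$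 (and $u\mapsto\partial u$ for $n=0$) commute with $d$; the reduced complex is the quotient of the complex of basic cochains by the image of these maps. *)

theory Defs
  imports
    "HOL-Analysis.Finite_Cartesian_Product"
    "HOL-Computational_Algebra.Polynomial"
    "HOL-Library.Poly_Mapping"
    "HOL-Algebra.Elementary_Groups"
begin

text \<open>
  Conventions. \<open>H = k[\<partial>]\<close> is the type \<open>'k poly\<close>; an \<open>H\<close>-module is an abelian group type with an
  action \<open>act :: 'k poly \<Rightarrow> 'm \<Rightarrow> 'm\<close> satisfying the library predicate \<open>Modules.module\<close>, so that
  \<open>\<partial>\<close> acts as \<open>act [:0, 1:]\<close> and a scalar \<open>r\<close> as \<open>act [:r:]\<close>. The space \<open>M[\<lambda>]\<close> is \<open>'m poly\<close>, and
  \<open>M[\<lambda>\<^sub>1, \<lambda>\<^sub>2, \<dots>]\<close> is \<open>'m mpol\<close>. Variables are numbered from \<open>0\<close>, as are the entries of the list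
  of arguments of a cochain: \<open>\<lambda>\<^sub>i\<close> of the usual notation is \<open>lam (i - 1)\<close>, \<open>a\<^sub>i\<close> is \<open>as ! (i - 1)\<close>.
\<close>

type_synonym 'm mpol = "(nat \<Rightarrow>\<^sub>0 nat) \<Rightarrow>\<^sub>0 'm"


section \<open>Polynomials with coefficients in an \<open>H\<close>-module\<close>

definition lam :: "nat \<Rightarrow> 'k::field poly mpol" where
  "lam i = Poly_Mapping.single (Poly_Mapping.single i 1) 1"

definition del :: "'k::field poly mpol" where
  "del = Poly_Mapping.single 0 [:0, 1:]"

text \<open>The action of \<open>H[\<lambda>\<^sub>1, \<lambda>\<^sub>2, \<dots>]\<close> on \<open>M[\<lambda>\<^sub>1, \<lambda>\<^sub>2, \<dots>]\<close>.\<close>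

definition mact ::
    "('k::field poly \<Rightarrow> 'm::ab_group_add \<Rightarrow> 'm) \<Rightarrow> 'k poly mpol \<Rightarrow> 'm mpol \<Rightarrow> 'm mpol" where
  "mact act p u = (\<Sum>s\<in>Poly_Mapping.keys p. \<Sum>t\<in>Poly_Mapping.keys u.
     Poly_Mapping.single (s + t) (act (Poly_Mapping.lookup p s) (Poly_Mapping.lookup u t)))"

text \<open>\<open>eval_at act q p\<close> is \<open>\<Sum>\<^sub>j q\<^sup>j p\<^sub>j\<close> for \<open>p = \<Sum>\<^sub>j \<lambda>\<^sup>j p\<^sub>j \<in> M[\<lambda>]\<close>; here \<open>q\<close> may involve \<open>\<partial>\<close>, which then
  acts on the coefficients \<open>p\<^sub>j\<close>.\<close>

definition eval_at ::
    "('k::field poly \<Rightarrow> 'm::ab_group_add \<Rightarrow> 'm) \<Rightarrow> 'k poly mpol \<Rightarrow> 'm poly \<Rightarrow> 'm mpol" where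
  "eval_at act q p = (\<Sum>j\<le>Polynomial.degree p.
     mact act (q ^ j) (Poly_Mapping.single 0 (Polynomial.coeff p j)))"

text \<open>For \<open>f :: 'a \<Rightarrow> 'm poly\<close>, say \<open>f v = a \<^bsub>(\<lambda>)\<^esub> v\<close> or \<open>f v = v \<^bsub>(\<lambda>)\<^esub> a\<close>, the value of \<open>f\<close> at \<open>\<lambda> = q\<close>
  extended linearly over the variables occurring in \<open>u\<close>.\<close>

definition lin_ext ::
    "('k::field poly \<Rightarrow> 'm::ab_group_add \<Rightarrow> 'm) \<Rightarrow> ('a::zero \<Rightarrow> 'm poly) \<Rightarrow> 'k poly mpol \<Rightarrow> 'a mpol \<Rightarrow> 'm mpol"
  where
  "lin_ext act f q u = (\<Sum>t\<in>Poly_Mapping.keys u.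
     mact act (Poly_Mapping.single t 1) (eval_at act q (f (Poly_Mapping.lookup u t))))"

text \<open>Simultaneous substitution of \<open>\<sigma> i\<close> for the variable number \<open>i\<close>.\<close>

definition msubst ::
    "('k::field poly \<Rightarrow> 'm::ab_group_add \<Rightarrow> 'm) \<Rightarrow> (nat \<Rightarrow> 'k poly mpol) \<Rightarrow> 'm mpol \<Rightarrow> 'm mpol" where
  "msubst act \<sigma> u = (\<Sum>t\<in>Poly_Mapping.keys u.
     mact act (\<Prod>i\<in>Poly_Mapping.keys t. \<sigma> i ^ Poly_Mapping.lookup t i)
       (Poly_Mapping.single 0 (Poly_Mapping.lookup u t)))"


section \<open>Associative conformal algebras and bimodules\<close>

text \<open>\<open>k\<close>-bilinear operations \<open>A \<times> B \<rightarrow> D[\<lambda>]\<close> satisfying the two sesquilinearity identities;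
  \<open>pCons 0\<close> is multiplication by \<open>\<lambda>\<close>.\<close>

locale sesquilinear =
  fixes actA :: "'k::field poly \<Rightarrow> 'a::ab_group_add \<Rightarrow> 'a"
    and actB :: "'k poly \<Rightarrow> 'b::ab_group_add \<Rightarrow> 'b"
    and actD :: "'k poly \<Rightarrow> 'd::ab_group_add \<Rightarrow> 'd"
    and prd :: "'a \<Rightarrow> 'b \<Rightarrow> 'd poly"
  assumes add_left: "prd (a + a') b = prd a b + prd a' b"
    and add_right: "prd a (b + b') = prd a b + prd a b'"
    and scale_left: "prd (actA [:r:] a) b = map_poly (actD [:r:]) (prd a b)"
    and scale_right: "prd a (actB [:r:] b) = map_poly (actD [:r:]) (prd a b)"
    and del_left: "prd (actA [:0, 1:] a) b = - pCons 0 (prd a b)"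
    and del_right: "prd a (actB [:0, 1:] b) = map_poly (actD [:0, 1:]) (prd a b) + pCons 0 (prd a b)"

text \<open>In the identities below \<open>\<lambda>\<close> is \<open>lam 0\<close> and \<open>\<mu>\<close> is \<open>lam 1\<close>.\<close>

locale assoc_conformal_algebra =
  Modules.module actC + sesquilinear actC actC actC cprd
  for actC :: "'k::field poly \<Rightarrow> 'c::ab_group_add \<Rightarrow> 'c"
    and cprd :: "'c \<Rightarrow> 'c \<Rightarrow> 'c poly" +
  assumes assoc:
    "lin_ext actC (cprd a) (lam 0) (eval_at actC (lam 1) (cprd b c))
     = lin_ext actC (\<lambda>v. cprd v c) (lam 0 + lam 1) (eval_at actC (lam 0) (cprd a b))"

locale conformal_bimodule =
  assoc_conformal_algebra actC cprd +
  M: Modules.module actM +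
  left: sesquilinear actC actM actM lprd +
  right: sesquilinear actM actC actM rprd
  for actC :: "'k::field poly \<Rightarrow> 'c::ab_group_add \<Rightarrow> 'c"
    and cprd :: "'c \<Rightarrow> 'c \<Rightarrow> 'c poly"
    and actM :: "'k poly \<Rightarrow> 'm::ab_group_add \<Rightarrow> 'm"
    and lprd :: "'c \<Rightarrow> 'm \<Rightarrow> 'm poly"
    and rprd :: "'m \<Rightarrow> 'c \<Rightarrow> 'm poly" +
  assumes left_assoc:
    "lin_ext actM (lprd a) (lam 0) (eval_at actM (lam 1) (lprd b u))
     = lin_ext actM (\<lambda>v. lprd v u) (lam 0 + lam 1) (eval_at actC (lam 0) (cprd a b))"
    and middle_assoc:
    "lin_ext actM (lprd a) (lam 0) (eval_at actM (lam 1) (rprd u b))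
     = lin_ext actM (\<lambda>v. rprd v b) (lam 0 + lam 1) (eval_at actM (lam 0) (lprd a u))"
    and right_assoc:
    "lin_ext actM (rprd u) (lam 0) (eval_at actC (lam 1) (cprd a b))
     = lin_ext actM (\<lambda>v. rprd v b) (lam 0 + lam 1) (eval_at actM (lam 0) (rprd u a))"


section \<open>Conformal Hochschild cohomology\<close>

context conformal_bimodule
begin

text \<open>A map \<open>C\<^sup>n \<rightarrow> M[\<lambda>\<^sub>1, \<dots>, \<lambda>\<^sub>n]\<close> is represented by a function on lists that vanishes on the
  lists of length different from \<open>n\<close>; for \<open>n = 0\<close> only the value at \<open>[]\<close>, a constant, remains.\<close>

definition basic_cochains :: "nat \<Rightarrow> ('c list \<Rightarrow> 'm mpol) set" where
  "basic_cochains n = {\<phi>.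
     (\<forall>as. length as \<noteq> n \<longrightarrow> \<phi> as = 0) \<and>
     (\<forall>as. \<forall>t\<in>Poly_Mapping.keys (\<phi> as). Poly_Mapping.keys t \<subseteq> {..<n}) \<and>
     (\<forall>as i a b. length as = n \<and> i < n \<longrightarrow>
        \<phi> (as[i := a + b]) = \<phi> (as[i := a]) + \<phi> (as[i := b])) \<and>
     (\<forall>as i r a. length as = n \<and> i < n \<longrightarrow>
        \<phi> (as[i := actC [:r:] a]) = mact actM (Poly_Mapping.single 0 [:r:]) (\<phi> (as[i := a]))) \<and>
     (\<forall>as i a. length as = n \<and> i < n \<longrightarrow>
        \<phi> (as[i := actC [:0, 1:] a]) = mact actM (- lam i) (\<phi> (as[i := a])))}"

definition cochain_group :: "nat \<Rightarrow> ('c list \<Rightarrow> 'm mpol) monoid" where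
  "cochain_group n =
     \<lparr>carrier = basic_cochains n, monoid.mult = (\<lambda>\<phi> \<psi> as. \<phi> as + \<psi> as), one = (\<lambda>as. 0)\<rparr>"

definition differential :: "nat \<Rightarrow> ('c list \<Rightarrow> 'm mpol) \<Rightarrow> 'c list \<Rightarrow> 'm mpol" where
  "differential n \<phi> as = (if length as \<noteq> n + 1 then 0 else
     lin_ext actM (lprd (as ! 0)) (lam 0) (msubst actM (\<lambda>j. lam (j + 1)) (\<phi> (tl as)))
     + (\<Sum>i<n. mact actM ((- 1) ^ (i + 1))
         (\<Sum>m\<le>Polynomial.degree (cprd (as ! i) (as ! (i + 1))).
            mact actM (lam i ^ m)
              (msubst actM (\<lambda>j. if j < i then lam j else if j = i then lam i + lam (i + 1) else lam (j + 1))
                (\<phi> (take i as @ [Polynomial.coeff (cprd (as ! i) (as ! (i + 1))) m] @ drop (i + 2) as)))))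
     + mact actM ((- 1) ^ (n + 1))
         (lin_ext actM (\<lambda>v. rprd v (as ! n)) (- del - lam n) (\<phi> (butlast as))))"

definition del_shift :: "nat \<Rightarrow> ('c list \<Rightarrow> 'm mpol) \<Rightarrow> 'c list \<Rightarrow> 'm mpol" where
  "del_shift n \<phi> as = mact actM (del + (\<Sum>i<n. lam i)) (\<phi> as)"

definition reduced_group :: "nat \<Rightarrow> ('c list \<Rightarrow> 'm mpol) set monoid" where
  "reduced_group n = cochain_group n Mod (del_shift n ` basic_cochains n)"

text \<open>The map induced by the differential on the quotients: a coset \<open>X\<close> goes to the coset containing
  the image of \<open>X\<close>.\<close>

definition reduced_differential ::
    "nat \<Rightarrow> ('c list \<Rightarrow> 'm mpol) set \<Rightarrow> ('c list \<Rightarrow> 'm mpol) set" where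
  "reduced_differential n X =
     (del_shift (n + 1) ` basic_cochains (n + 1)) <#>\<^bsub>cochain_group (n + 1)\<^esub> (differential n ` X)"

definition cocycles :: "nat \<Rightarrow> ('c list \<Rightarrow> 'm mpol) set set" where
  "cocycles n = kernel (reduced_group n) (reduced_group (n + 1)) (reduced_differential n)"

definition coboundaries :: "nat \<Rightarrow> ('c list \<Rightarrow> 'm mpol) set set" where
  "coboundaries n = (if n = 0 then {\<one>\<^bsub>reduced_group 0\<^esub>}
     else reduced_differential (n - 1) ` carrier (reduced_group (n - 1)))"

definition cohomology_group :: "nat \<Rightarrow> ('c list \<Rightarrow> 'm mpol) set set monoid" where
  "cohomology_group n = (reduced_group n)\<lparr>carrier := cocycles n\<rparr> Mod coboundaries n"

end


section \<open>The conformal algebra \<open>Cend\<^sub>k\<close>\<close>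

text \<open>Elements are \<open>k \<times> k\<close> matrices over \<open>k[\<partial>, x]\<close>, with \<open>k = CARD('n)\<close>. Here \<open>k[\<partial>, x]\<close> is the type
  \<open>'k poly poly\<close> with \<open>x\<close> as the outer variable, so that the coefficients are in \<open>H\<close>.\<close>

type_synonym ('k, 'n) cend = "'k poly poly ^ 'n ^ 'n"

definition cend_act :: "'k::field poly \<Rightarrow> ('k, 'n::finite) cend \<Rightarrow> ('k, 'n) cend" where
  "cend_act h A = (\<chi> i j. smult h (A $ i $ j))"

text \<open>\<open>k[\<partial>, x][\<lambda>]\<close> is \<open>'k poly poly poly\<close>. The polynomial \<open>f(a, b)\<close> for \<open>a, b \<in> k[\<partial>, x][\<lambda>]\<close>:\<close>

definition eval2 ::
    "'k::field poly poly \<Rightarrow> 'k poly poly poly \<Rightarrow> 'k poly poly poly \<Rightarrow> 'k poly poly poly" where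
  "eval2 f a b = poly (map_poly (\<lambda>h. poly (map_poly (\<lambda>r. [:[:[:r:]:]:]) h) a) f) b"

definition poly_prd :: "'k::field poly poly \<Rightarrow> 'k poly poly \<Rightarrow> 'k poly poly poly" where
  "poly_prd f g =
     (let D = [:[:[:0, 1:]:]:]; X = [:[:0, 1:]:]; L = [:0, 1:]
      in eval2 f (- L) X * eval2 g (D + L) (X + L))"

text \<open>The entry with index \<open>(i, j)\<close> of the product lies in \<open>k[\<partial>, x][\<lambda>]\<close>; the outer sums collect the
  matrix with these entries into one polynomial in \<open>\<lambda>\<close> with matrix coefficients.\<close>

definition cend_prd ::
    "('k::field, 'n::finite) cend \<Rightarrow> ('k, 'n) cend \<Rightarrow> ('k, 'n) cend poly" where
  "cend_prd A B = (\<Sum>i\<in>UNIV. \<Sum>j\<in>UNIV.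
     map_poly (\<lambda>c. \<chi> i' j'. if i' = i \<and> j' = j then c else 0)
       (\<Sum>l\<in>UNIV. poly_prd (A $ i $ l) (B $ l $ j)))"

lemma coeff_cend_prd:
  "Polynomial.coeff (cend_prd A B) m $ i $ j
     = Polynomial.coeff (\<Sum>l\<in>UNIV. poly_prd (A $ i $ l) (B $ l $ j)) m"
proof -
  have z: "(\<chi> i' j'. if i' = a \<and> j' = b then c else 0) $ i $ j = (if i = a \<and> j = b then c else 0)"
    for a b :: 'b and c :: "'a poly poly" by simp
  have "Polynomial.coeff (cend_prd A B) m $ i $ j = (\<Sum>a\<in>UNIV. \<Sum>b\<in>UNIV.
      if i = a \<and> j = b then Polynomial.coeff (\<Sum>l\<in>UNIV. poly_prd (A $ a $ l) (B $ l $ b)) m else 0)"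
    unfolding cend_prd_def by (simp add: Polynomial.coeff_sum coeff_map_poly vec_eq_iff)
  also have "\<dots> = (\<Sum>a\<in>UNIV. if i = a then (\<Sum>b\<in>UNIV.
      if j = b then Polynomial.coeff (\<Sum>l\<in>UNIV. poly_prd (A $ a $ l) (B $ l $ b)) m else 0) else 0)"
    by (intro sum.cong refl) auto
  finally show ?thesis by simp
qed

section \<open>\<open>Cend\<^sub>k\<close> is an associative conformal algebra\<close>

text \<open>This shows that the axioms on the algebra contained in \<^const>\<open>conformal_bimodule\<close> hold for \<open>Cend\<^sub>k\<close>, and
  that \<open>Cend\<^sub>k\<close> is a bimodule over itself. The identities in \<open>C[\<lambda>, \<mu>]\<close> are compared entrywise in the
  commutative ring \<open>k[\<partial>, x][\<lambda>, \<mu>]\<close>, where they follow from uniqueness of evaluation homomorphisms.\<close>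

definition is_ring_hom :: "('a::comm_ring_1 \<Rightarrow> 'b::comm_ring_1) \<Rightarrow> bool" where
  "is_ring_hom f \<longleftrightarrow> f 0 = 0 \<and> f 1 = 1 \<and> (\<forall>x y. f (x + y) = f x + f y) \<and> (\<forall>x y. f (x * y) = f x * f y)"

lemma is_ring_homD:
  assumes "is_ring_hom f"
  shows "f 0 = 0" "f 1 = 1" "f (x + y) = f x + f y" "f (x * y) = f x * f y"
  using assms by (auto simp: is_ring_hom_def)

lemma is_ring_hom_minus: assumes "is_ring_hom f" shows "f (- x) = - f x"
proof -
  have "f (- x) + f x = 0" using is_ring_homD(3)[OF assms, of "- x" x] is_ring_homD(1)[OF assms] by simp
  then show ?thesis by (simp add: eq_neg_iff_add_eq_0)
qed

lemma is_ring_hom_sum: assumes "is_ring_hom f" shows "f (sum g A) = (\<Sum>x\<in>A. f (g x))"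
  by (induction A rule: infinite_finite_induct) (simp_all add: is_ring_homD[OF assms])

lemma is_ring_hom_power: assumes "is_ring_hom f" shows "f (x ^ n) = f x ^ n"
  by (induction n) (simp_all add: is_ring_homD[OF assms])

lemma is_ring_hom_comp: "is_ring_hom f \<Longrightarrow> is_ring_hom g \<Longrightarrow> is_ring_hom (\<lambda>x. f (g x))"
  by (simp add: is_ring_hom_def)

text \<open>Extending a ring homomorphism to polynomials.\<close>

definition ev :: "('a::comm_ring_1 \<Rightarrow> 'b::comm_ring_1) \<Rightarrow> 'b \<Rightarrow> 'a poly \<Rightarrow> 'b" where
  "ev K a p = poly (map_poly K p) a"

lemma ev_pCons: assumes "is_ring_hom K" shows "ev K a (pCons c p) = K c + a * ev K a p"
  by (cases "p = 0 \<and> c = 0") (auto simp: ev_def map_poly_pCons is_ring_homD[OF assms])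

lemma ev_0: "ev K a 0 = 0" by (simp add: ev_def)

lemma is_ring_hom_ev: assumes K: "is_ring_hom K" shows "is_ring_hom (ev K a)"
proof -
  note k = is_ring_homD[OF K]
  have add: "ev K a (p + q) = ev K a p + ev K a q" for p q
    unfolding ev_def
    by (subst poly_add[symmetric], rule arg_cong[where f="\<lambda>p. poly p a"])
       (simp add: poly_eq_iff coeff_map_poly k)
  have sm: "ev K a (smult c p) = K c * ev K a p" for c p
    by (induction p) (simp_all add: ev_pCons[OF K] ev_0 k algebra_simps)
  have mult: "ev K a (p * q) = ev K a p * ev K a q" for p q
    by (induction p) (simp_all add: ev_pCons[OF K] ev_0 add sm k algebra_simps)
  have "ev K a 1 = 1" using ev_pCons[OF K, of a 1 0] by (simp add: ev_0 k one_pCons)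
  then show ?thesis using add mult by (simp add: is_ring_hom_def ev_0)
qed

lemma ev_const: assumes "is_ring_hom K" shows "ev K a [:c:] = K c"
  using ev_pCons[OF assms, of a c 0] by (simp add: ev_0)

lemma ev_X: assumes "is_ring_hom K" shows "ev K a [:0, 1:] = a"
  using ev_pCons[OF assms, of a 0 "[:1:]"] by (simp add: ev_const[OF assms] is_ring_homD[OF assms])

lemma is_ring_hom_poly_eqI:
  assumes "is_ring_hom f" "is_ring_hom g" "\<And>c. f [:c:] = g [:c:]" "f [:0, 1:] = g [:0, 1:]"
  shows "f p = g p"
proof (induction p)
  case (pCons c p)
  have *: "pCons c p = [:c:] + [:0, 1:] * p" by simp
  show ?case unfolding * using pCons assms by (simp only: is_ring_homD(3,4))
qed (simp add: is_ring_homD assms(1,2))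

lemma is_ring_hom_ev_comp:
  assumes T: "is_ring_hom T" and K: "is_ring_hom K"
  shows "T (ev K a p) = ev (\<lambda>c. T (K c)) (T a) p"
proof -
  have TK: "is_ring_hom (\<lambda>c. T (K c))" by (rule is_ring_hom_comp[OF T K])
  have 1: "is_ring_hom (\<lambda>p. T (ev K a p))" by (rule is_ring_hom_comp[OF T is_ring_hom_ev[OF K]])
  show ?thesis
    by (rule is_ring_hom_poly_eqI[OF 1 is_ring_hom_ev[OF TK]]) (simp_all add: ev_const[OF K] ev_const[OF TK] ev_X[OF K] ev_X[OF TK])
qed

lemma ev_bound:
  assumes "K 0 = 0" "Polynomial.degree p \<le> n"
  shows "ev K a p = (\<Sum>m\<le>n. a ^ m * K (Polynomial.coeff p m))"
proof -
  have "Polynomial.degree (map_poly K p) \<le> n" 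
    using assms by (intro degree_le) (auto simp: coeff_map_poly coeff_eq_0)
  then have "ev K a p = (\<Sum>m\<le>n. Polynomial.coeff (map_poly K p) m * a ^ m)"
    unfolding ev_def poly_altdef by (intro sum.mono_neutral_left) (auto simp: coeff_eq_0)
  then show ?thesis by (simp add: coeff_map_poly assms(1) mult.commute)
qed

text \<open>Extending a ring homomorphism to multivariate polynomials.\<close>

definition mev :: "('a::comm_ring_1 \<Rightarrow> 'b::comm_ring_1 mpol) \<Rightarrow> 'a mpol \<Rightarrow> 'b mpol" where
  "mev K u = (\<Sum>t\<in>Poly_Mapping.keys u. Poly_Mapping.single t 1 * K (Poly_Mapping.lookup u t))"

lemma mev_bound:
  assumes "K 0 = 0" "finite S" "Poly_Mapping.keys u \<subseteq> S"
  shows "mev K u = (\<Sum>t\<in>S. Poly_Mapping.single t 1 * K (Poly_Mapping.lookup u t))"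
  unfolding mev_def by (rule sum.mono_neutral_left) (use assms in \<open>auto simp: in_keys_iff\<close>)

lemma mev_add:
  assumes "is_ring_hom K" shows "mev K (u + v) = mev K u + mev K v"
proof -
  let ?S = "Poly_Mapping.keys u \<union> Poly_Mapping.keys v"
  have "Poly_Mapping.keys (u + v) \<subseteq> ?S" by (rule keys_add)
  then show ?thesis
    by (simp add: mev_bound[where S = ?S] is_ring_homD[OF assms] lookup_add algebra_simps sum.distrib)
qed

lemma mev_0: "mev K 0 = 0" by (simp add: mev_def)

lemma mev_sum: assumes "is_ring_hom K" shows "mev K (sum f A) = (\<Sum>x\<in>A. mev K (f x))"
  by (induction A rule: infinite_finite_induct) (simp_all add: mev_add[OF assms] mev_0)

lemma mev_single: assumes "is_ring_hom K" shows "mev K (Poly_Mapping.single t c) = Poly_Mapping.single t 1 * K c"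
  by (cases "c = 0") (simp_all add: mev_def is_ring_homD[OF assms])

lemma mpol_sum: "(u :: 'a::comm_monoid_add mpol) = (\<Sum>t\<in>Poly_Mapping.keys u. Poly_Mapping.single t (Poly_Mapping.lookup u t))"
  by (rule poly_mapping_eqI) (auto simp: lookup_sum lookup_single when_def in_keys_iff)

lemma mpol_mult: "(u :: 'a::comm_ring_1 mpol) * v = (\<Sum>s\<in>Poly_Mapping.keys u. \<Sum>t\<in>Poly_Mapping.keys v.
    Poly_Mapping.single (s + t) (Poly_Mapping.lookup u s * Poly_Mapping.lookup v t))"
  by (subst mpol_sum[of u], subst mpol_sum[of v]) (simp only: sum_product mult_single)

lemma is_ring_hom_mev: assumes K: "is_ring_hom K" shows "is_ring_hom (mev K)"
proof -
  have e: "Poly_Mapping.single (s + t) 1 = Poly_Mapping.single s 1 * (Poly_Mapping.single t 1 :: 'b mpol)" for s t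
    by (simp add: mult_single)
  have "mev K (u * v) = mev K u * mev K v" for u v
  proof -
    have "mev K (u * v) = (\<Sum>s\<in>Poly_Mapping.keys u. \<Sum>t\<in>Poly_Mapping.keys v.
        (Poly_Mapping.single s 1 * K (Poly_Mapping.lookup u s)) * (Poly_Mapping.single t 1 * K (Poly_Mapping.lookup v t)))"
      unfolding mpol_mult[of u v] mev_sum[OF K] mev_single[OF K] is_ring_homD[OF K] e
      by (simp only: ac_simps)
    then show ?thesis by (simp add: mev_def sum_product)
  qed
  moreover have "mev K 1 = 1"
    using mev_single[OF K, of 0 1] by (simp add: is_ring_homD[OF K])
  ultimately show ?thesis by (simp add: is_ring_hom_def mev_0 mev_add[OF K])
qed

lemma is_ring_hom_const: "is_ring_hom (Poly_Mapping.single 0 :: 'a::comm_ring_1 \<Rightarrow> 'a mpol)"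
  by (simp add: is_ring_hom_def single_add mult_single)

lemma is_ring_hom_pconst: "is_ring_hom (\<lambda>c. [:c:])"
  by (simp add: is_ring_hom_def one_pCons)


text \<open>Matrix entries, as elements of \<open>k[\<partial>, x][\<lambda>\<^sub>1, \<lambda>\<^sub>2, \<dots>]\<close>.\<close>

definition ent :: "'n::finite \<Rightarrow> 'n \<Rightarrow> ('k::field, 'n) cend mpol \<Rightarrow> 'k poly poly mpol" where
  "ent i j u = (\<Sum>t\<in>Poly_Mapping.keys u. Poly_Mapping.single t (Poly_Mapping.lookup u t $ i $ j))"

lemma lookup_ent: "Poly_Mapping.lookup (ent i j u) t = Poly_Mapping.lookup u t $ i $ j"
  by (auto simp: ent_def lookup_sum lookup_single when_def in_keys_iff)

lemma ent_eqI: "(\<And>i j. ent i j u = ent i j v) \<Longrightarrow> u = v"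
  by (metis (no_types, lifting) lookup_ent poly_mapping_eqI vec_eq_iff)

lemma ent_add: "ent i j (u + v) = ent i j u + ent i j v"
  by (rule poly_mapping_eqI) (simp add: lookup_ent lookup_add)

lemma ent_0: "ent i j 0 = 0"
  by (simp add: ent_def)

lemma ent_sum: "ent i j (sum f A) = (\<Sum>x\<in>A. ent i j (f x))"
  by (induction A rule: infinite_finite_induct) (simp_all add: ent_add ent_0)

lemma ent_single: "ent i j (Poly_Mapping.single t c) = Poly_Mapping.single t (c $ i $ j)"
  by (rule poly_mapping_eqI) (simp add: lookup_ent lookup_single when_def)

definition emb :: "'k::field poly mpol \<Rightarrow> 'k poly poly mpol" where
  "emb = mev (\<lambda>h. Poly_Mapping.single 0 [:h:])"

lemma is_ring_hom_emb: "is_ring_hom emb"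
  unfolding emb_def by (intro is_ring_hom_mev is_ring_hom_comp[OF is_ring_hom_const is_ring_hom_pconst])

lemma emb_lam: "emb (lam i) = Poly_Mapping.single (Poly_Mapping.single i 1) 1"
  unfolding emb_def lam_def mev_single[OF is_ring_hom_comp[OF is_ring_hom_const is_ring_hom_pconst]] by (simp add: mult_single flip: one_pCons)

lemma emb_single: "emb (Poly_Mapping.single t 1) = Poly_Mapping.single t 1"
  unfolding emb_def mev_single[OF is_ring_hom_comp[OF is_ring_hom_const is_ring_hom_pconst]] by (simp add: mult_single flip: one_pCons)

lemma ent_mact: "ent i j (mact cend_act p u) = emb p * ent i j u"
  unfolding mact_def ent_sum ent_single emb_def mev_def
  by (simp add: cend_act_def ent_def sum_product mult_single)

abbreviation emb_const :: "'k::field \<Rightarrow> 'k poly poly mpol" where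
  "emb_const r \<equiv> Poly_Mapping.single 0 [:[:r:]:]"

lemma is_ring_hom_emb_const: "is_ring_hom emb_const"
  by (rule is_ring_hom_comp[OF is_ring_hom_const is_ring_hom_comp[OF is_ring_hom_pconst is_ring_hom_pconst]])

text \<open>The value of \<open>f\<close> at \<open>\<partial> = a\<close>, \<open>x = b\<close>.\<close>

definition emb_eval :: "'k::field poly poly mpol \<Rightarrow> 'k poly poly mpol \<Rightarrow> 'k poly poly \<Rightarrow> 'k poly poly mpol" where
  "emb_eval a b = ev (ev emb_const a) b"


lemma is_ring_hom_emb_eval: "is_ring_hom (emb_eval a b)"
  unfolding emb_eval_def by (intro is_ring_hom_ev is_ring_hom_emb_const)

lemma emb_eval_comp:
  assumes T: "is_ring_hom T" and "\<And>r. T (emb_const r) = emb_const r"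
  shows "T (emb_eval a b f) = emb_eval (T a) (T b) f"
  unfolding emb_eval_def is_ring_hom_ev_comp[OF T is_ring_hom_ev[OF is_ring_hom_emb_const]] is_ring_hom_ev_comp[OF T is_ring_hom_emb_const] assms(2) ..

abbreviation emb_del :: "'k::field poly poly mpol" where "emb_del \<equiv> Poly_Mapping.single 0 [:[:0, 1:]:]"
abbreviation emb_x :: "'k::field poly poly mpol" where "emb_x \<equiv> Poly_Mapping.single 0 [:0, 1:]"

lemma is_ring_hom_c3: "is_ring_hom (\<lambda>r. [:[:[:r:]:]:])"
  by (rule is_ring_hom_comp[OF is_ring_hom_pconst is_ring_hom_comp[OF is_ring_hom_pconst is_ring_hom_pconst]])

lemma eval2_ev: "eval2 f a b = ev (ev (\<lambda>r. [:[:[:r:]:]:]) a) b f"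
  by (simp add: eval2_def ev_def[abs_def])

lemma is_ring_hom_eval2: "is_ring_hom (\<lambda>f. eval2 f a b)"
  unfolding eval2_ev by (intro is_ring_hom_ev is_ring_hom_c3)

lemma ev_poly_prd:
  "ev (Poly_Mapping.single 0) w (poly_prd f g) = emb_eval (- w) emb_x f * emb_eval (emb_del + w) (emb_x + w) g"
proof -
  let ?T = "ev (Poly_Mapping.single 0) w"
  have T: "is_ring_hom ?T" by (rule is_ring_hom_ev[OF is_ring_hom_const])
  have e: "?T (eval2 h a b) = emb_eval (?T a) (?T b) h" for h a b
    unfolding eval2_ev emb_eval_def is_ring_hom_ev_comp[OF T is_ring_hom_ev[OF is_ring_hom_c3]] is_ring_hom_ev_comp[OF T is_ring_hom_c3] ev_const[OF is_ring_hom_const] ..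
  show ?thesis unfolding poly_prd_def Let_def
    by (simp only: is_ring_homD[OF T] e is_ring_hom_minus[OF T] ev_X[OF is_ring_hom_const] ev_const[OF is_ring_hom_const])
qed

lemma ent_eval_at:
  "ent i j (eval_at cend_act q (cend_prd A B))
   = (\<Sum>l\<in>UNIV. emb_eval (- emb q) emb_x (A $ i $ l) * emb_eval (emb_del + emb q) (emb_x + emb q) (B $ l $ j))"
proof -
  let ?P = "\<Sum>l\<in>UNIV. poly_prd (A $ i $ l) (B $ l $ j)"
  have "Polynomial.degree ?P \<le> Polynomial.degree (cend_prd A B)"
    by (rule degree_le) (simp add: coeff_eq_0 flip: coeff_cend_prd)
  then have "ent i j (eval_at cend_act q (cend_prd A B)) = ev (Poly_Mapping.single 0) (emb q) ?P"
    unfolding eval_at_def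
    by (subst ev_bound, simp, assumption) (simp add: ent_sum ent_mact ent_single coeff_cend_prd is_ring_hom_power[OF is_ring_hom_emb])
  then show ?thesis by (simp only: is_ring_hom_sum[OF is_ring_hom_ev[OF is_ring_hom_const]] ev_poly_prd)
qed

lemma ent_lin_ext_right:
  "ent i j (lin_ext cend_act (cend_prd A) q u)
   = (\<Sum>l\<in>UNIV. emb_eval (- emb q) emb_x (A $ i $ l) * mev (emb_eval (emb_del + emb q) (emb_x + emb q)) (ent l j u))"
proof -
  have k: "Poly_Mapping.keys (ent l j u) \<subseteq> Poly_Mapping.keys u" for l
    by (auto simp: in_keys_iff lookup_ent)
  show ?thesis
    unfolding lin_ext_def ent_sum ent_mact ent_eval_at emb_single
    by (simp add: mev_bound[OF _ _ k] is_ring_homD[OF is_ring_hom_emb_eval] lookup_ent sum_distrib_left)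
       (subst sum.swap, simp add: algebra_simps)
qed

lemma ent_lin_ext_left:
  "ent i j (lin_ext cend_act (\<lambda>v. cend_prd v B) q u)
   = (\<Sum>l\<in>UNIV. mev (emb_eval (- emb q) emb_x) (ent i l u) * emb_eval (emb_del + emb q) (emb_x + emb q) (B $ l $ j))"
proof -
  have k: "Poly_Mapping.keys (ent i l u) \<subseteq> Poly_Mapping.keys u" for l
    by (auto simp: in_keys_iff lookup_ent)
  show ?thesis
    unfolding lin_ext_def ent_sum ent_mact ent_eval_at emb_single
    by (simp add: mev_bound[OF _ _ k] is_ring_homD[OF is_ring_hom_emb_eval] lookup_ent sum_distrib_left sum_distrib_right)
       (subst sum.swap, simp add: algebra_simps)
qed

lemma emb_eval_simps: "emb_eval a b [:[:r:]:] = emb_const r" "emb_eval a b [:[:0, 1:]:] = a" "emb_eval a b [:0, 1:] = b"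
  unfolding emb_eval_def by (simp_all only: ev_const[OF is_ring_hom_ev[OF is_ring_hom_emb_const]] ev_const[OF is_ring_hom_emb_const] ev_X[OF is_ring_hom_emb_const] ev_X[OF is_ring_hom_ev[OF is_ring_hom_emb_const]])

lemma mev_emb_eval:
  "mev (emb_eval a b) (emb_const r) = emb_const r" "mev (emb_eval a b) emb_del = a" "mev (emb_eval a b) emb_x = b"
  "mev (emb_eval a b) (emb (lam i)) = emb (lam i)"
  by (simp_all add: mev_single[OF is_ring_hom_emb_eval] emb_eval_simps emb_lam is_ring_homD[OF is_ring_hom_emb_eval])

lemma cend_assoc:
  "lin_ext cend_act (cend_prd A) (lam 0) (eval_at cend_act (lam 1) (cend_prd B C))
     = lin_ext cend_act (\<lambda>V. cend_prd V C) (lam 0 + lam 1) (eval_at cend_act (lam 0) (cend_prd A B))"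
proof (rule ent_eqI)
  fix i j
  have S: "mev (emb_eval a b) (emb_eval c d f) = emb_eval (mev (emb_eval a b) c) (mev (emb_eval a b) d) f" for a b c d :: "'a poly poly mpol" and f
    by (rule emb_eval_comp[OF is_ring_hom_mev[OF is_ring_hom_emb_eval] mev_emb_eval(1)])
  have e: "- (a + b) + a = - b" for a b :: "'a poly poly mpol" by simp
  note r = is_ring_hom_mev[OF is_ring_hom_emb_eval]
  show "ent i j (lin_ext cend_act (cend_prd A) (lam 0) (eval_at cend_act (lam 1) (cend_prd B C)))
     = ent i j (lin_ext cend_act (\<lambda>V. cend_prd V C) (lam 0 + lam 1) (eval_at cend_act (lam 0) (cend_prd A B)))"
    unfolding ent_lin_ext_left ent_lin_ext_right ent_eval_at is_ring_hom_sum[OF r] is_ring_homD(4)[OF r] S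
      is_ring_homD(3)[OF r] is_ring_hom_minus[OF r] mev_emb_eval is_ring_homD(3)[OF is_ring_hom_emb] sum_distrib_left sum_distrib_right
      e add.assoc mult.assoc
    by (rule sum.swap)
qed

lemma cend_prd_eqI:
  assumes "\<And>i j m. Polynomial.coeff P m $ i $ j = Polynomial.coeff Q m $ i $ j"
  shows "P = Q"
  using assms by (simp add: poly_eq_iff vec_eq_iff)

lemma cend_module: "Modules.module (cend_act :: 'k::field poly \<Rightarrow> ('k, 'n::finite) cend \<Rightarrow> _)"
  by unfold_locales (simp_all add: cend_act_def vec_eq_iff smult_add_right smult_add_left)

lemma eval2_smult: "eval2 (smult h f) a b = ev (\<lambda>r. [:[:[:r:]:]:]) a h * eval2 f a b"
proof -
  have "smult h f = [:h:] * f" by simp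
  then show ?thesis by (simp only: eval2_ev is_ring_homD(4)[OF is_ring_hom_ev[OF is_ring_hom_ev[OF is_ring_hom_c3]]] ev_const[OF is_ring_hom_ev[OF is_ring_hom_c3]])
qed

lemma poly_prd_smult:
  "poly_prd (smult h f) g = ev (\<lambda>r. [:[:[:r:]:]:]) (- [:0, 1:]) h * poly_prd f g"
  "poly_prd f (smult h g) = ev (\<lambda>r. [:[:[:r:]:]:]) ([:[:[:0, 1:]:]:] + [:0, 1:]) h * poly_prd f g"
  by (simp_all only: poly_prd_def Let_def eval2_smult ac_simps)

lemma poly_prd_lin:
  "poly_prd (f + f') g = poly_prd f g + poly_prd f' g"
  "poly_prd f (g + g') = poly_prd f g + poly_prd f g'"
  "poly_prd (smult [:r:] f) g = smult [:[:r:]:] (poly_prd f g)"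
  "poly_prd f (smult [:r:] g) = smult [:[:r:]:] (poly_prd f g)"
  "poly_prd (smult [:0, 1:] f) g = - pCons 0 (poly_prd f g)"
  "poly_prd f (smult [:0, 1:] g) = smult [:[:0, 1:]:] (poly_prd f g) + pCons 0 (poly_prd f g)"
proof -
  show "poly_prd (f + f') g = poly_prd f g + poly_prd f' g"
    "poly_prd f (g + g') = poly_prd f g + poly_prd f g'"
    by (simp_all only: poly_prd_def Let_def is_ring_homD(3)[OF is_ring_hom_eval2] distrib_left distrib_right)
  show "poly_prd (smult [:r:] f) g = smult [:[:r:]:] (poly_prd f g)"
    "poly_prd f (smult [:r:] g) = smult [:[:r:]:] (poly_prd f g)"
    unfolding poly_prd_smult ev_const[OF is_ring_hom_c3] by simp_all
  show "poly_prd (smult [:0, 1:] f) g = - pCons 0 (poly_prd f g)"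
    unfolding poly_prd_smult ev_X[OF is_ring_hom_c3] by simp
  show "poly_prd f (smult [:0, 1:] g) = smult [:[:0, 1:]:] (poly_prd f g) + pCons 0 (poly_prd f g)"
    unfolding poly_prd_smult ev_X[OF is_ring_hom_c3] by (simp only: distrib_right) simp
qed

lemma coeff_map_act: "Polynomial.coeff (map_poly (cend_act h) P) m $ i $ j = smult h (Polynomial.coeff P m $ i $ j)"
  by (subst coeff_map_poly) (simp_all add: cend_act_def vec_eq_iff)

lemma smult_sum_right: "smult h (sum f A) = (\<Sum>x\<in>A. smult h (f x))"
  by (induction A rule: infinite_finite_induct) (simp_all add: smult_add_right)

lemma cend_sesquilinear:
  "sesquilinear (cend_act :: 'k::field poly \<Rightarrow> ('k, 'n::finite) cend \<Rightarrow> _) cend_act cend_act cend_prd"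
proof
  fix A A' B B' :: "('k, 'n) cend" and r :: 'k
  show "cend_prd (A + A') B = cend_prd A B + cend_prd A' B"
    "cend_prd A (B + B') = cend_prd A B + cend_prd A B'"
    by (rule cend_prd_eqI; simp add: coeff_cend_prd poly_prd_lin sum.distrib)+
  show "cend_prd (cend_act [:r:] A) B = map_poly (cend_act [:r:]) (cend_prd A B)"
    "cend_prd A (cend_act [:r:] B) = map_poly (cend_act [:r:]) (cend_prd A B)"
    by (rule cend_prd_eqI; simp add: coeff_cend_prd coeff_map_act poly_prd_lin Polynomial.coeff_sum smult_sum_right; simp add: cend_act_def poly_prd_lin)+
  show "cend_prd (cend_act [:0, 1:] A) B = - pCons 0 (cend_prd A B)"
    by (rule cend_prd_eqI; simp add: coeff_cend_prd Polynomial.coeff_pCons; simp add: cend_act_def poly_prd_lin coeff_cend_prd Polynomial.coeff_sum sum_negf Polynomial.coeff_pCons split: nat.split)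
  show "cend_prd A (cend_act [:0, 1:] B) = map_poly (cend_act [:0, 1:]) (cend_prd A B) + pCons 0 (cend_prd A B)"
    by (rule cend_prd_eqI; simp add: coeff_cend_prd coeff_map_act Polynomial.coeff_pCons; simp add: cend_act_def poly_prd_lin coeff_cend_prd Polynomial.coeff_sum sum.distrib smult_sum_right Polynomial.coeff_pCons split: nat.split)
qed

theorem cend_assoc_conformal_algebra:
  "assoc_conformal_algebra
     (cend_act :: 'k::field poly \<Rightarrow> ('k, 'n::finite) cend \<Rightarrow> ('k, 'n) cend) cend_prd"
  by (intro assoc_conformal_algebra.intro assoc_conformal_algebra_axioms.intro
      cend_module cend_sesquilinear cend_assoc)

theorem cend_regular_bimodule:
  "conformal_bimodule (cend_act :: 'k::field poly \<Rightarrow> ('k, 'n::finite) cend \<Rightarrow> _) cend_prd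
     cend_act cend_prd cend_prd"
  by (intro conformal_bimodule.intro conformal_bimodule_axioms.intro
      cend_module cend_sesquilinear cend_assoc cend_assoc_conformal_algebra)

end

theory Submission
  imports Defs
begin

text \<open>
  Evaluating \<open>\<lambda>\<^sub>1, \<dots>, \<lambda>\<^sub>n\<close> at scalars turns \<open>C \<times> k\<close> into a semigroup, with product
  \<open>(a, \<lambda>) (b, \<mu>) = (a \<^bsub>(\<lambda>)\<^esub> b, \<lambda> + \<mu>)\<close>, that acts on \<open>M\<close> from both sides by \<open>a \<^bsub>(\<lambda>)\<^esub> u\<close> and
  \<open>u \<^bsub>(-\<partial>-\<lambda>)\<^esub> a\<close>. Basic cochains become functions on this semigroup that are polynomial in the
  scalars, and the differential becomes the bar differential. Since \<open>\<partial> + \<Sum>\<^sub>i \<lambda>\<^sub>i\<close> is injective on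
  cochains of positive degree, it is enough to show that basic \<open>n\<close>-cocycles are coboundaries for \<open>n \<ge> 2\<close>.

  Let \<open>\<phi>\<close> be such a cocycle, regarded as a derivation in its first argument. One may assume that the
  unit \<open>(1, 0)\<close> acts identically on its values from the left. Over the elements \<open>(b, \<lambda>)\<close> with a constant matrix \<open>b\<close>,
  every derivation \<open>D\<close> is inner: it is given by the element obtained from
  \<open>\<Sum>\<^sub>i (e\<^sub>i\<^sub>1, -\<mu>) D(e\<^sub>1\<^sub>i, \<mu>)\<close>, a polynomial in \<open>\<mu>\<close>, by the substitution \<open>\<mu> = x\<close>, where \<open>x\<close> acts from the left.
  The point is that \<open>(b, \<lambda>) x = (x + \<lambda>) (b, \<lambda>)\<close>. Hence one may assume that \<open>\<phi>\<close> vanishes when its first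
  argument is \<open>(b, \<lambda>)\<close>. Then \<open>\<phi>(x, (b, \<lambda>), \<dots>)\<close> is again a derivation in \<open>(b, \<lambda>)\<close>, hence given by some \<open>W\<close>,
  and the cochain \<open>\<psi>\<close> with \<open>\<psi>(b, \<lambda>) = 0\<close> and \<open>\<psi>(x s) = x \<psi>(s) - W s - \<phi>(x, s)\<close> has a differential that agrees
  with \<open>\<phi>\<close> when the first argument is \<open>(b, \<lambda>)\<close> or \<open>x\<close>. As these elements generate, \<open>d\<psi> = \<phi>\<close>.
\<close>

section \<open>Evaluation of module-valued polynomials\<close>

lemma const_power: "[:c:] ^ n = [:c ^ n:]" for c :: "'a::comm_semiring_1"
  by (induction n) (simp_all add: one_pCons mult.commute)

lemma pconst_mult: "[:a::'a::comm_semiring_0:] * [:b:] = [:a * b:]"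
  by (simp add: mult.commute)

text \<open>The values \<open>\<rho> i\<close> lie in \<open>k[\<partial>]\<close> and not only in
  \<open>k\<close>, because the bimodule identities with a right action are evaluated at
  \<open>-\<partial> - \<lambda>\<close>.\<close>

definition monom_val :: "(nat \<Rightarrow> 'k::field poly) \<Rightarrow> (nat \<Rightarrow>\<^sub>0 nat) \<Rightarrow> 'k poly" where
  "monom_val \<rho> t = (\<Prod>i\<in>Poly_Mapping.keys t. \<rho> i ^ Poly_Mapping.lookup t i)"

lemma monom_val_bound:
  assumes "finite A" "Poly_Mapping.keys t \<subseteq> A"
  shows "monom_val \<rho> t = (\<Prod>i\<in>A. \<rho> i ^ Poly_Mapping.lookup t i)"
  unfolding monom_val_def by (rule prod.mono_neutral_left) (use assms in \<open>auto simp: in_keys_iff\<close>)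

lemma monom_val_0 [simp]: "monom_val \<rho> 0 = 1"
  by (simp add: monom_val_def)

lemma monom_val_add: "monom_val \<rho> (s + t) = monom_val \<rho> s * monom_val \<rho> t"
proof -
  let ?A = "Poly_Mapping.keys s \<union> Poly_Mapping.keys t"
  have "Poly_Mapping.keys (s + t) \<subseteq> ?A" by (rule keys_add)
  then show ?thesis
    by (simp add: monom_val_bound[of ?A] lookup_add power_add prod.distrib)
qed

lemma monom_val_single [simp]: "monom_val \<rho> (Poly_Mapping.single i j) = \<rho> i ^ j"
  by (subst monom_val_bound[of "{i}"]) auto

lemma monom_val_const: "monom_val (\<lambda>i. [:\<rho> i:]) t = [:\<Prod>i\<in>Poly_Mapping.keys t. \<rho> i ^ Poly_Mapping.lookup t i:]"
proof -
  have "(\<Prod>i\<in>A. [:f i:]) = [:\<Prod>i\<in>A. f i:]" for A and f :: "nat \<Rightarrow> 'a"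
    by (induction A rule: infinite_finite_induct) (simp_all add: one_pCons)
  then show ?thesis by (simp add: monom_val_def const_power)
qed

definition mval ::
    "('k::field poly \<Rightarrow> 'm::ab_group_add \<Rightarrow> 'm) \<Rightarrow> (nat \<Rightarrow> 'k poly) \<Rightarrow> 'm mpol \<Rightarrow> 'm" where
  "mval act \<rho> u = (\<Sum>t\<in>Poly_Mapping.keys u. act (monom_val \<rho> t) (Poly_Mapping.lookup u t))"

text \<open>With \<open>T\<close> the action of \<open>q\<close> this is the value at
  \<open>\<lambda> = q\<close>. Operators \<open>T\<close> outside \<open>H\<close> are allowed with
  a view to substituting left multiplication by \<open>x\<close>.\<close>

definition opval :: "('m::ab_group_add \<Rightarrow> 'm) \<Rightarrow> 'm poly \<Rightarrow> 'm" where
  "opval T p = (\<Sum>j\<le>Polynomial.degree p. (T ^^ j) (Polynomial.coeff p j))"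

locale endo =
  fixes T :: "'m::ab_group_add \<Rightarrow> 'm"
  assumes add: "T (x + y) = T x + T y"
begin

sublocale Modules.additive T
  by unfold_locales (rule add)

lemma funpow_0: "(T ^^ j) 0 = 0"
  by (induction j) (simp_all add: zero)

lemma opval_bound:
  assumes "Polynomial.degree p \<le> n"
  shows "opval T p = (\<Sum>j\<le>n. (T ^^ j) (Polynomial.coeff p j))"
  unfolding opval_def
  by (rule sum.mono_neutral_left) (use assms in \<open>auto simp: coeff_eq_0 funpow_0\<close>)

lemma opval_0 [simp]: "opval T 0 = 0"
  by (simp add: opval_def)

lemma opval_pCons [simp]: "opval T (pCons a p) = a + T (opval T p)"
proof -
  have "Polynomial.degree (pCons a p) \<le> Suc (Polynomial.degree p)" by (rule degree_pCons_le)
  then have "opval T (pCons a p) = (\<Sum>j\<le>Suc (Polynomial.degree p). (T ^^ j) (Polynomial.coeff (pCons a p) j))"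
    by (rule opval_bound)
  also have "\<dots> = a + (\<Sum>j\<le>Polynomial.degree p. (T ^^ Suc j) (Polynomial.coeff p j))"
    by (subst sum.atMost_Suc_shift) simp
  finally show ?thesis by (simp add: opval_def sum)
qed

lemma opval_add [simp]: "opval T (p + q) = opval T p + opval T q"
proof (induction p arbitrary: q)
  case (pCons a p)
  obtain b r where "q = pCons b r" by (cases q) blast
  then show ?case by (simp add: pCons.IH add add_ac)
qed simp

lemma opval_minus: "opval T (- p) = - opval T p"
  using opval_add[of p "- p"] by (simp add: eq_neg_iff_add_eq_0 add.commute)

lemma opval_commute:
  assumes "\<And>x y. S (x + y) = S x + S y" "\<And>x. S (T x) = U (S x)" "\<And>x y. U (x + y) = U x + U y"
  shows "S (opval T p) = opval U (map_poly S p)"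
proof -
  interpret S: Modules.additive S by unfold_locales (rule assms)
  interpret U: endo U by unfold_locales (rule assms)
  show ?thesis
    by (induction p) (simp_all add: map_poly_pCons S.zero assms)
qed

end

locale hmod = Modules.module act
  for act :: "'k::field_char_0 poly \<Rightarrow> 'm::ab_group_add \<Rightarrow> 'm"
begin

lemma endo_act: "endo (act h)"
  by unfold_locales (rule scale_right_distrib)

lemma funpow_act: "(act h ^^ j) u = act (h ^ j) u"
  by (induction j) simp_all

lemma opval_act: "opval (act h) p = (\<Sum>j\<le>Polynomial.degree p. act (h ^ j) (Polynomial.coeff p j))"
  by (simp add: opval_def funpow_act)

lemma mval_bound:
  assumes "finite S" "Poly_Mapping.keys u \<subseteq> S"
  shows "mval act \<rho> u = (\<Sum>t\<in>S. act (monom_val \<rho> t) (Poly_Mapping.lookup u t))"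
  unfolding mval_def by (rule sum.mono_neutral_left) (use assms in \<open>auto simp: in_keys_iff\<close>)

lemma mval_0 [simp]: "mval act \<rho> 0 = 0"
  by (simp add: mval_def)

lemma mval_add: "mval act \<rho> (u + v) = mval act \<rho> u + mval act \<rho> v"
proof -
  let ?S = "Poly_Mapping.keys u \<union> Poly_Mapping.keys v"
  have "Poly_Mapping.keys (u + v) \<subseteq> ?S" by (rule keys_add)
  then show ?thesis
    by (simp add: mval_bound[of ?S] lookup_add scale_right_distrib sum.distrib)
qed

lemma mval_minus: "mval act \<rho> (- u) = - mval act \<rho> u"
  using mval_add[of \<rho> u "- u"] by (simp add: eq_neg_iff_add_eq_0 add.commute)

lemma mval_diff: "mval act \<rho> (u - v) = mval act \<rho> u - mval act \<rho> v"
  using mval_add[of \<rho> "u - v" v] by simp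

lemma mval_sum: "mval act \<rho> (sum f A) = (\<Sum>x\<in>A. mval act \<rho> (f x))"
  by (induction A rule: infinite_finite_induct) (simp_all add: mval_add)

lemma mval_single [simp]: "mval act \<rho> (Poly_Mapping.single t c) = act (monom_val \<rho> t) c"
  by (subst mval_bound[of "{t}"]) auto

lemma mval_mact: "mval act \<rho> (mact act p u) = act (mval (*) \<rho> p) (mval act \<rho> u)"
proof -
  have "mval act \<rho> (mact act p u) = (\<Sum>s\<in>Poly_Mapping.keys p. \<Sum>t\<in>Poly_Mapping.keys u.
      act (monom_val \<rho> s * Poly_Mapping.lookup p s) (act (monom_val \<rho> t) (Poly_Mapping.lookup u t)))"
    by (simp add: mact_def mval_sum monom_val_add mult_ac)
  also have "\<dots> = (\<Sum>s\<in>Poly_Mapping.keys p. act (monom_val \<rho> s * Poly_Mapping.lookup p s) (mval act \<rho> u))"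
    by (simp only: mval_def scale_sum_right)
  finally show ?thesis by (simp only: mval_def[of "(*)"] scale_sum_left)
qed

end

lemma hmod_mult: "hmod ((*) :: 'k::field_char_0 poly \<Rightarrow> _)"
  by unfold_locales (simp_all add: algebra_simps)

interpretation self: hmod "(*) :: 'k::field_char_0 poly \<Rightarrow> _"
  by (rule hmod_mult)

lemma mact_mult: "mact (*) p q = p * q"
  by (simp add: mact_def mpol_mult)

abbreviation hval :: "(nat \<Rightarrow> 'k::field_char_0 poly) \<Rightarrow> 'k poly mpol \<Rightarrow> 'k poly" where
  "hval \<equiv> mval (*)"

lemma hval_mult: "hval \<rho> (p * q) = hval \<rho> p * hval \<rho> q"
  using self.mval_mact[of \<rho> p q] by (simp add: mact_mult)

lemma hval_1 [simp]: "hval \<rho> 1 = 1"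
  by (subst single_one [symmetric], subst self.mval_single) simp

lemma hval_power: "hval \<rho> (p ^ j) = hval \<rho> p ^ j"
  by (induction j) (simp_all add: hval_mult)

lemma hval_prod: "hval \<rho> (prod f A) = (\<Prod>x\<in>A. hval \<rho> (f x))"
  by (induction A rule: infinite_finite_induct) (simp_all add: hval_mult)

lemma hval_lam [simp]: "hval \<rho> (lam i) = \<rho> i"
  by (simp add: lam_def)

lemma hval_del [simp]: "hval \<rho> del = [:0, 1:]"
  by (simp add: del_def)

section \<open>Polynomials over a module are determined by their values at scalars\<close>

context hmod
begin

lemma mval_eval_at: "mval act \<rho> (eval_at act q p) = opval (act (hval \<rho> q)) p"
  by (simp add: eval_at_def mval_sum mval_mact hval_power opval_act)

lemma mval_lin_ext:
  "mval act \<rho> (lin_ext act f q u)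
   = (\<Sum>t\<in>Poly_Mapping.keys u. act (monom_val \<rho> t) (opval (act (hval \<rho> q)) (f (Poly_Mapping.lookup u t))))"
  by (simp add: lin_ext_def mval_sum mval_mact mval_eval_at)

lemma mval_msubst: "mval act \<rho> (msubst act \<sigma> u) = mval act (\<lambda>i. hval \<rho> (\<sigma> i)) u"
proof -
  have "hval \<rho> (\<Prod>i\<in>Poly_Mapping.keys t. \<sigma> i ^ Poly_Mapping.lookup t i) = monom_val (\<lambda>i. hval \<rho> (\<sigma> i)) t" for t
    by (simp only: hval_prod hval_power monom_val_def)
  then show ?thesis
    by (simp only: msubst_def mval_sum mval_mact mval_single monom_val_0 scale_one mval_def[of act "\<lambda>i. hval \<rho> (\<sigma> i)"])
qed

text \<open>Vandermonde by elimination: the relation at \<open>2 * c\<close> minus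
  \<open>2 ^ n\<close> times the relation at \<open>c\<close> has no term of index \<open>n\<close>,
  so the induction hypothesis applies to the multiples by \<open>2 ^ j - 2 ^ n\<close> of the
  remaining vectors.\<close>

lemma power_sum_eq_0:
  assumes "\<And>c. (\<Sum>j<n. act [:c ^ j:] (v j)) = 0" and "i < n"
  shows "v i = 0"
  using assms
proof (induction n arbitrary: v i)
  case (Suc n)
  define v' where "v' j = act [:2 ^ j - 2 ^ n:] (v j)" for j
  have "(\<Sum>j<n. act [:c ^ j:] (v' j)) = 0" for c
  proof -
    have "(\<Sum>j<n. act [:c ^ j:] (v' j)) = (\<Sum>j<Suc n. act [:c ^ j:] (v' j))"
      by (simp add: v'_def)
    also have "\<dots> = (\<Sum>j<Suc n. act [:(2 * c) ^ j:] (v j)) - act [:2 ^ n:] (\<Sum>j<Suc n. act [:c ^ j:] (v j))"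
      unfolding v'_def scale_sum_right sum_subtractf[symmetric] scale_scale scale_left_diff_distrib[symmetric]
      by (rule sum.cong[OF refl], rule arg_cong[where f = "\<lambda>p. act p _"]) (simp add: power_mult_distrib algebra_simps)
    finally show ?thesis by (simp only: Suc.prems scale_zero_right) simp
  qed
  then have z: "v' j = 0" if "j < n" for j using Suc.IH that by blast
  have v: "v j = 0" if "j < n" for j
  proof -
    \<comment> \<open>Characteristic zero enters here: distinct powers of 2 stay distinct in the
      field, so the factors can be inverted.\<close>
    have "(2::'k) ^ j \<noteq> 2 ^ n"
    proof -
      have "(of_nat (2 ^ j) :: 'k) \<noteq> of_nat (2 ^ n)"
        unfolding of_nat_eq_iff using that power_strict_increasing[of j n "2::nat"] by simp
      then show ?thesis by simp
    qed
    then have "v j = act [:1 / (2 ^ j - 2 ^ n):] (v' j)"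
      by (simp add: v'_def flip: one_pCons)
    then show ?thesis by (simp add: z that)
  qed
  have "(\<Sum>j<Suc n. act [:1 ^ j:] (v j)) = 0" by (rule Suc.prems)
  then have "v n = 0" using v by (simp flip: one_pCons)
  then show ?case using v Suc.prems(2) by (cases "i = n") auto
qed simp

lemma power_sum_group_eq_0:
  assumes "finite K" and "\<And>c. (\<Sum>t\<in>K. act [:c ^ e t:] (v t)) = 0"
  shows "(\<Sum>t | t \<in> K \<and> e t = j. v t) = 0"
proof -
  define n where "n = Suc (Max (insert 0 (e ` K)))"
  have n: "e t < n" if "t \<in> K" for t
    using that assms(1) by (simp add: n_def less_Suc_eq_le)
  have "(\<Sum>j<n. act [:c ^ j:] (\<Sum>t | t \<in> K \<and> e t = j. v t)) = 0" for c
  proof -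
    have "(\<Sum>j<n. act [:c ^ j:] (\<Sum>t | t \<in> K \<and> e t = j. v t))
        = (\<Sum>j<n. \<Sum>t | t \<in> K \<and> e t = j. act [:c ^ e t:] (v t))"
      by (simp add: scale_sum_right)
    also have "\<dots> = (\<Sum>t\<in>K. act [:c ^ e t:] (v t))"
      by (rule sum.group) (use assms(1) n in auto)
    finally show ?thesis using assms(2) by simp
  qed
  then have "(\<Sum>t | t \<in> K \<and> e t = j. v t) = 0" if "j < n"
    by (rule power_sum_eq_0) (rule that)
  moreover have "(\<Sum>t | t \<in> K \<and> e t = j. v t) = 0" if "\<not> j < n"
    by (rule sum.neutral) (use n that in auto)
  ultimately show ?thesis by blast
qed

text \<open>Induction on the number of monomials. Two distinct monomials differ in the exponent of
  some variable. Scaling that variable by all scalars \<open>c\<close> separates the exponents, so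
  each group of monomials with a fixed exponent vanishes by itself, and each such group is
  smaller.\<close>

lemma mval_const_eq_0:
  assumes "\<And>\<rho>. mval act (\<lambda>i. [:\<rho> i:]) u = 0"
  shows "u = 0"
proof -
  have "\<forall>t\<in>K. v t = 0"
    if "finite K" "\<And>\<rho>. (\<Sum>t\<in>K. act (monom_val (\<lambda>i. [:\<rho> i:]) t) (v t)) = 0" for K and v :: "(nat \<Rightarrow>\<^sub>0 nat) \<Rightarrow> 'm"
    using that
  proof (induction "card K" arbitrary: K rule: less_induct)
    case less
    show ?case
    proof (cases "\<exists>s\<in>K. \<exists>t\<in>K. s \<noteq> t")
      case True
      then obtain s t where st: "s \<in> K" "t \<in> K" "s \<noteq> t" by blast
      then obtain i where i: "Poly_Mapping.lookup s i \<noteq> Poly_Mapping.lookup t i"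
        by (metis poly_mapping_eqI)
      define e where "e t = Poly_Mapping.lookup t i" for t :: "nat \<Rightarrow>\<^sub>0 nat"
      \<comment> \<open>Scaling the value of variable \<open>i\<close> by \<open>c\<close>
        multiplies a monomial by \<open>c\<close> to the power of its exponent at
        \<open>i\<close>.\<close>
      have sc: "monom_val (\<lambda>j. [:(\<rho>(i := c * \<rho> i)) j:]) t = [:c ^ e t:] * monom_val (\<lambda>j. [:\<rho> j:]) t" for \<rho> :: "nat \<Rightarrow> 'k" and c t
      proof -
        let ?A = "insert i (Poly_Mapping.keys t)"
        have split: "monom_val f t = f i ^ e t * (\<Prod>j\<in>?A - {i}. f j ^ Poly_Mapping.lookup t j)" for f :: "nat \<Rightarrow> 'k poly"
          using monom_val_bound[of ?A t f] prod.remove[of ?A i "\<lambda>j. f j ^ Poly_Mapping.lookup t j"]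
          by (simp add: e_def subset_insertI del: Diff_insert0 insert_Diff_single)
        have "monom_val (\<lambda>j. [:(\<rho>(i := c * \<rho> i)) j:]) t
            = [:(c * \<rho> i) ^ e t:] * (\<Prod>j\<in>?A - {i}. [:\<rho> j:] ^ Poly_Mapping.lookup t j)"
        proof -
          have "(\<Prod>j\<in>?A - {i}. [:(\<rho>(i := c * \<rho> i)) j:] ^ Poly_Mapping.lookup t j)
              = (\<Prod>j\<in>?A - {i}. [:\<rho> j:] ^ Poly_Mapping.lookup t j)"
            by (rule prod.cong) auto
          then show ?thesis unfolding split by (simp only: const_power fun_upd_same)
        qed
        moreover have "monom_val (\<lambda>j. [:\<rho> j:]) t
            = [:\<rho> i ^ e t:] * (\<Prod>j\<in>?A - {i}. [:\<rho> j:] ^ Poly_Mapping.lookup t j)"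
          unfolding split by (simp only: const_power)
        ultimately show ?thesis
          by (simp only: mult.assoc[symmetric] pconst_mult power_mult_distrib)
      qed
      have group: "\<forall>t\<in>{t \<in> K. e t = j}. v t = 0" if "{t \<in> K. e t = j} \<noteq> K" for j
      proof (rule less.hyps)
        show "card {t \<in> K. e t = j} < card K"
          using that less.prems(1) by (intro psubset_card_mono) auto
        show "finite {t \<in> K. e t = j}" using less.prems(1) by simp
        fix \<rho>
        show "(\<Sum>t | t \<in> K \<and> e t = j. act (monom_val (\<lambda>i. [:\<rho> i:]) t) (v t)) = 0"
        proof (rule power_sum_group_eq_0[OF less.prems(1)])
          fix c
          show "(\<Sum>t\<in>K. act [:c ^ e t:] (act (monom_val (\<lambda>i. [:\<rho> i:]) t) (v t))) = 0"
            using less.prems(2)[of "\<rho>(i := c * \<rho> i)"] by (simp only: sc scale_scale)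
        qed
      qed
      have "{t \<in> K. e t = j} \<noteq> K" for j
      proof
        assume "{t \<in> K. e t = j} = K"
        then have "e s = j" "e t = j" using st by blast+
        then show False using i by (simp add: e_def)
      qed
      then show ?thesis using group by blast
    next
      case False
      show ?thesis
      proof
        fix t assume t: "t \<in> K"
        then have "K = {t}" using False by auto
        then show "v t = 0" using less.prems(2)[of "\<lambda>_. 1"] by (simp add: monom_val_def flip: one_pCons)
      qed
    qed
  qed
  from this[of "Poly_Mapping.keys u" "Poly_Mapping.lookup u"] show ?thesis
    using assms by (auto simp: mval_def intro!: poly_mapping_eqI) (metis in_keys_iff)
qed

lemma mval_const_eqI:
  assumes "\<And>\<rho>. mval act (\<lambda>i. [:\<rho> i:]) u = mval act (\<lambda>i. [:\<rho> i:]) v"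
  shows "u = v"
  using mval_const_eq_0[of "u - v"] assms by (simp add: mval_diff)

text \<open>Setting the variables from \<open>n\<close> on to zero does not change the values, and
  it removes every monomial that contains such a variable. Hence \<open>u\<close> equals its part in
  the first \<open>n\<close> variables.\<close>

lemma keys_subset_if_mval_local:
  assumes "\<And>\<rho> \<rho>'. (\<And>i. i < n \<Longrightarrow> \<rho> i = \<rho>' i) \<Longrightarrow> mval act (\<lambda>i. [:\<rho> i:]) u = mval act (\<lambda>i. [:\<rho>' i:]) u"
    and "t \<in> Poly_Mapping.keys u"
  shows "Poly_Mapping.keys t \<subseteq> {..<n}"
proof -
  define S where "S = {t \<in> Poly_Mapping.keys u. Poly_Mapping.keys t \<subseteq> {..<n}}"
  define u' where "u' = (\<Sum>t\<in>S. Poly_Mapping.single t (Poly_Mapping.lookup u t))"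
  have fin: "finite S" by (simp add: S_def)
  have "u = u'"
  proof (rule mval_const_eqI)
    fix \<rho> :: "nat \<Rightarrow> 'k"
    define \<rho>' where "\<rho>' i = (if i < n then \<rho> i else 0)" for i
    have "mval act (\<lambda>i. [:\<rho> i:]) u = mval act (\<lambda>i. [:\<rho>' i:]) u"
      by (rule assms(1)) (simp add: \<rho>'_def)
    also have "\<dots> = (\<Sum>t\<in>S. act (monom_val (\<lambda>i. [:\<rho>' i:]) t) (Poly_Mapping.lookup u t))"
      unfolding mval_def
    proof (rule sum.mono_neutral_right)
      show "\<forall>t\<in>Poly_Mapping.keys u - S. act (monom_val (\<lambda>i. [:\<rho>' i:]) t) (Poly_Mapping.lookup u t) = 0"
      proof
        fix t assume "t \<in> Poly_Mapping.keys u - S"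
        then obtain i where "i \<in> Poly_Mapping.keys t" "i \<ge> n" by (auto simp: S_def subset_eq not_less)
        then have "monom_val (\<lambda>i. [:\<rho>' i:]) t = 0"
          by (auto simp: monom_val_def \<rho>'_def in_keys_iff intro!: bexI[of _ i])
        then show "act (monom_val (\<lambda>i. [:\<rho>' i:]) t) (Poly_Mapping.lookup u t) = 0" by simp
      qed
    qed (auto simp: S_def)
    also have "\<dots> = (\<Sum>t\<in>S. act (monom_val (\<lambda>i. [:\<rho> i:]) t) (Poly_Mapping.lookup u t))"
      by (rule sum.cong[OF refl], rule arg_cong[where f = "\<lambda>p. act p _"])
         (auto simp: monom_val_def S_def \<rho>'_def intro!: prod.cong)
    also have "\<dots> = mval act (\<lambda>i. [:\<rho> i:]) u'"
      by (simp add: u'_def mval_sum)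
    finally show "mval act (\<lambda>i. [:\<rho> i:]) u = mval act (\<lambda>i. [:\<rho> i:]) u'" .
  qed
  moreover have "Poly_Mapping.lookup u' t = (if t \<in> S then Poly_Mapping.lookup u t else 0)"
    using fin by (simp add: u'_def lookup_sum lookup_single when_def)
  ultimately have "t \<in> S" using assms(2) by (metis in_keys_iff)
  then show ?thesis by (simp add: S_def)
qed

section \<open>Polynomial functions of scalars with values in a module\<close>

inductive polyf :: "((nat \<Rightarrow> 'k) \<Rightarrow> 'm) \<Rightarrow> bool" where
  polyf_const: "polyf (\<lambda>\<rho>. u)"
| polyf_add: "polyf f \<Longrightarrow> polyf g \<Longrightarrow> polyf (\<lambda>\<rho>. f \<rho> + g \<rho>)"
| polyf_var: "polyf f \<Longrightarrow> polyf (\<lambda>\<rho>. act [:\<rho> i:] (f \<rho>))"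

text \<open>Linearity over \<open>k\<close> only: the left and right actions of elements of the
  algebra commute with scalars, but not with \<open>\<partial>\<close>.\<close>

definition klinear :: "('m \<Rightarrow> 'm) \<Rightarrow> bool" where
  "klinear T \<longleftrightarrow> (\<forall>u v. T (u + v) = T u + T v) \<and> (\<forall>c u. T (act [:c:] u) = act [:c:] (T u))"

lemma klinearD:
  assumes "klinear T"
  shows "T (u + v) = T u + T v" "T (act [:c:] u) = act [:c:] (T u)" "T 0 = 0" "T (- u) = - T u"
    "T (u - v) = T u - T v" "T (sum f A) = (\<Sum>x\<in>A. T (f x))"
proof -
  interpret Modules.additive T by unfold_locales (use assms in \<open>simp add: klinear_def\<close>)
  show "T 0 = 0" "T (- u) = - T u" "T (u - v) = T u - T v" "T (sum f A) = (\<Sum>x\<in>A. T (f x))"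
    by (rule zero minus diff sum)+
qed (use assms in \<open>auto simp: klinear_def\<close>)

lemma klinear_act: "klinear (act h)"
  by (simp add: klinear_def scale_right_distrib mult.commute)

lemma polyf_comp: "polyf f \<Longrightarrow> klinear T \<Longrightarrow> polyf (\<lambda>\<rho>. T (f \<rho>))"
  by (induction rule: polyf.induct) (auto simp: klinearD intro: polyf.intros)

lemma polyf_minus: "polyf f \<Longrightarrow> polyf (\<lambda>\<rho>. - f \<rho>)"
  by (rule polyf_comp) (simp_all add: klinear_def)

lemma polyf_diff: "polyf f \<Longrightarrow> polyf g \<Longrightarrow> polyf (\<lambda>\<rho>. f \<rho> - g \<rho>)"
  using polyf_add[OF _ polyf_minus] by fastforce

lemma polyf_sum: "(\<And>x. x \<in> A \<Longrightarrow> polyf (f x)) \<Longrightarrow> polyf (\<lambda>\<rho>. \<Sum>x\<in>A. f x \<rho>)"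
  by (induction A rule: infinite_finite_induct) (auto intro: polyf.intros)

lemma polyf_subst:
  assumes "polyf f" "\<And>i. (\<exists>j. \<forall>\<rho>. \<sigma> \<rho> i = \<rho> j) \<or> (\<exists>c. \<forall>\<rho>. \<sigma> \<rho> i = c)"
  shows "polyf (\<lambda>\<rho>. f (\<sigma> \<rho>))"
  using assms(1)
proof induction
  case (polyf_var f i)
  consider j where "\<And>\<rho>. \<sigma> \<rho> i = \<rho> j" | c where "\<And>\<rho>. \<sigma> \<rho> i = c" using assms(2) by blast
  then show ?case
    by cases (auto intro: polyf.intros polyf_var polyf_comp[OF polyf_var.IH klinear_act])
qed (auto intro: polyf.intros)

lemma polyf_monom: "polyf f \<Longrightarrow> polyf (\<lambda>\<rho>. act (monom_val (\<lambda>i. [:\<rho> i:]) t) (f \<rho>))"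
proof -
  assume f: "polyf f"
  have "polyf (\<lambda>\<rho>. act ([:\<rho> i:] ^ m) (f \<rho>))" if "polyf f" for f i m
  proof (induction m)
    case (Suc m)
    show ?case using polyf_var[OF Suc] by (simp only: power_Suc scale_scale)
  qed (simp add: that)
  then have "polyf (\<lambda>\<rho>. act (\<Prod>i\<in>A. [:\<rho> i:] ^ e i) (f \<rho>))" for A :: "nat set" and e :: "nat \<Rightarrow> nat"
    by (induction A rule: infinite_finite_induct) (auto intro: f simp flip: scale_scale)
  then show ?thesis by (simp add: monom_val_def)
qed

lemma polyf_mval: "polyf (\<lambda>\<rho>. mval act (\<lambda>i. [:\<rho> i:]) u)"
  unfolding mval_def by (intro polyf_sum polyf_monom polyf_const)

text \<open>Together with \<open>polyf_mval\<close> this identifies \<open>polyf\<close> with the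
  functions given by multivariate polynomials, so that closure properties can be proved by rule
  induction without handling coefficients.\<close>

lemma polyf_imp_mval:
  assumes "polyf f"
  obtains u where "\<And>\<rho>. f \<rho> = mval act (\<lambda>i. [:\<rho> i:]) u"
proof -
  have "\<exists>u. \<forall>\<rho>. f \<rho> = mval act (\<lambda>i. [:\<rho> i:]) u"
    using assms
  proof induction
    case (polyf_const u)
    show ?case by (rule exI[of _ "Poly_Mapping.single 0 u"]) simp
  next
    case (polyf_add f g)
    then show ?case by (metis mval_add)
  next
    case (polyf_var f i)
    then obtain u where "\<And>\<rho>. f \<rho> = mval act (\<lambda>i. [:\<rho> i:]) u" by blast
    then show ?case by (intro exI[of _ "mact act (lam i) u"]) (simp add: mval_mact)
  qed
  then show ?thesis using that by blast
qed

section \<open>Polynomial functions of one scalar and the substitution of an operator\<close>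

definition poly1 :: "('k \<Rightarrow> 'm) \<Rightarrow> 'm poly \<Rightarrow> bool" where
  "poly1 w p \<longleftrightarrow> (\<forall>c. w c = opval (act [:c:]) p)"

lemma poly1_unique: assumes "poly1 w p" "poly1 w q" shows "p = q"
proof -
  have z: "opval (act [:c:]) (p - q) = 0" for c
  proof -
    interpret endo "act [:c:]" by (rule endo_act)
    show ?thesis using assms opval_add[of "p - q" q] by (simp add: poly1_def)
  qed
  have "Polynomial.coeff (p - q) i = 0" if "i < Suc (Polynomial.degree (p - q))" for i
    by (rule power_sum_eq_0[OF _ that]) (use z in \<open>simp add: opval_act const_power lessThan_Suc_atMost\<close>)
  then have "p - q = 0" by (metis leading_coeff_0_iff lessI)
  then show ?thesis by simp
qed

lemma poly1_const: "poly1 (\<lambda>c. u) [:u:]"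
  by (simp add: poly1_def opval_def)

lemma poly1_add: "poly1 w p \<Longrightarrow> poly1 w' p' \<Longrightarrow> poly1 (\<lambda>c. w c + w' c) (p + p')"
  by (simp add: poly1_def endo.opval_add[OF endo_act])

lemma poly1_var: "poly1 w p \<Longrightarrow> poly1 (\<lambda>c. act [:c:] (w c)) (pCons 0 p)"
  by (simp add: poly1_def endo.opval_pCons[OF endo_act])

lemma poly1_comp:
  assumes "poly1 w p" "klinear T" shows "poly1 (\<lambda>c. T (w c)) (map_poly T p)"
  using assms by (auto simp: poly1_def klinearD(1,2) scale_right_distrib intro!: endo.opval_commute[OF endo_act])

text \<open>\<open>case_nat c \<rho>\<close> puts \<open>c\<close> in front of the sequence
  \<open>\<rho>\<close>; only variable 0 varies, and the other variables act as fixed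
  scalars.\<close>

lemma polyf_slice:
  assumes "polyf f"
  shows "\<exists>p. poly1 (\<lambda>c. f (case_nat c \<rho>)) p"
  using assms
proof induction
  case (polyf_var f i)
  then obtain p where p: "poly1 (\<lambda>c. f (case_nat c \<rho>)) p" by blast
  show ?case
  proof (cases i)
    case 0
    then show ?thesis using poly1_var[OF p] by auto
  next
    case (Suc j)
    then show ?thesis using poly1_comp[OF p klinear_act[of "[:\<rho> j:]"]] by auto
  qed
qed (auto intro: poly1_const poly1_add)

text \<open>For a polynomial function \<open>w(\<mu>) = \<Sum>\<^sub>j \<mu>\<^sup>j w\<^sub>j\<close> this is \<open>\<Sum>\<^sub>j T\<^sup>j w\<^sub>j\<close>.\<close>

definition subst_op :: "('m \<Rightarrow> 'm) \<Rightarrow> ('k \<Rightarrow> 'm) \<Rightarrow> 'm" where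
  "subst_op T w = opval T (THE p. poly1 w p)"

lemma subst_op_eq: "poly1 w p \<Longrightarrow> subst_op T w = opval T p"
  unfolding subst_op_def using poly1_unique by (metis the_equality)

lemma subst_op_const [simp]: "subst_op T (\<lambda>c. u) = u"
  by (simp add: subst_op_eq[OF poly1_const] opval_def)

lemma subst_op_add:
  assumes "klinear T" "\<exists>p. poly1 w p" "\<exists>p. poly1 w' p"
  shows "subst_op T (\<lambda>c. w c + w' c) = subst_op T w + subst_op T w'"
proof -
  interpret endo T by unfold_locales (rule klinearD(1)[OF assms(1)])
  show ?thesis using assms(2,3) by (auto simp: subst_op_eq subst_op_eq[OF poly1_add])
qed

lemma subst_op_var:
  assumes "klinear T" "\<exists>p. poly1 w p"
  shows "subst_op T (\<lambda>c. act [:c:] (w c)) = T (subst_op T w)"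
proof -
  interpret endo T by unfold_locales (rule klinearD(1)[OF assms(1)])
  show ?thesis using assms(2) by (auto simp: subst_op_eq subst_op_eq[OF poly1_var])
qed

text \<open>Here \<open>S\<close> has to commute with \<open>T\<close>. A constant matrix commutes
  with \<open>x\<close> only up to a shift of the scalar, so its action is treated separately in
  \<open>subst_xop_const\<close>.\<close>

lemma subst_op_comp:
  assumes "klinear T" "klinear S" "\<And>u. S (T u) = T (S u)" "\<exists>p. poly1 w p"
  shows "subst_op T (\<lambda>c. S (w c)) = S (subst_op T w)"
proof -
  interpret endo T by unfold_locales (rule klinearD(1)[OF assms(1)])
  obtain p where p: "poly1 w p" using assms(4) by blast
  show ?thesis
    using opval_commute[of S T p] assms(1-3)
    by (simp add: subst_op_eq[OF p] subst_op_eq[OF poly1_comp[OF p assms(2)]] klinearD(1))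
qed

lemma subst_op_diff:
  assumes T: "klinear T" and w: "\<exists>p. poly1 w p" "\<exists>p. poly1 w' p"
  shows "subst_op T (\<lambda>c. w c - w' c) = subst_op T w - subst_op T w'"
proof -
  have m: "klinear uminus" by (simp add: klinear_def)
  have "\<exists>p. poly1 (\<lambda>c. - w' c) p" using w(2) poly1_comp[OF _ m] by blast
  from subst_op_add[OF T w(1) this] show ?thesis
    using subst_op_comp[OF T m _ w(2)] by (simp add: klinearD(4)[OF T])
qed

text \<open>Variable 0 turns into an application of \<open>T\<close>, and the other variables move
  down by one place.\<close>

lemma polyf_subst_op:
  assumes "klinear T" "polyf f"
  shows "polyf (\<lambda>\<rho>. subst_op T (\<lambda>y. f (case_nat y \<rho>)))"
  using assms(2)
proof induction
  case (polyf_add f g)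
  then show ?case
    by (simp add: subst_op_add[OF assms(1) polyf_slice polyf_slice] polyf.polyf_add)
next
  case (polyf_var f i)
  show ?case
  proof (cases i)
    case 0
    then show ?thesis
      using polyf_comp[OF polyf_var.IH assms(1)] by (simp add: subst_op_var[OF assms(1) polyf_slice[OF polyf_var.hyps]])
  next
    case (Suc j)
    then show ?thesis
      using polyf.polyf_var[OF polyf_var.IH, of j]
      by (simp add: subst_op_comp[OF assms(1) klinear_act _ polyf_slice[OF polyf_var.hyps]] klinearD(2)[OF assms(1)])
  qed
qed (simp add: polyf_const)

lemma klinear_funpow: "klinear T \<Longrightarrow> klinear (T ^^ i)"
  by (induction i) (simp_all add: klinear_def)

end

section \<open>The bar differential\<close>

text \<open>The sign \<open>(-1)^i\<close> without scalars, since the bar complex is formed over an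
  arbitrary abelian group.\<close>

definition alt :: "nat \<Rightarrow> 'm::ab_group_add \<Rightarrow> 'm" where
  "alt i u = (if even i then u else - u)"

lemma alt_0 [simp]: "alt 0 u = u"
  and alt_Suc: "alt (Suc i) u = - alt i u"
  by (simp_all add: alt_def)

text \<open>\<open>ra\<close> is the right action on cochains for which an \<open>n\<close>-cocycle, as a function of its first argument, is a
  derivation into the bimodule of \<open>(n - 1)\<close>-cochains.\<close>

locale bar =
  fixes mul :: "'s \<Rightarrow> 's \<Rightarrow> 's"
    and L :: "'s \<Rightarrow> 'm::ab_group_add \<Rightarrow> 'm"
    and R :: "'m \<Rightarrow> 's \<Rightarrow> 'm"
  assumes mul_assoc: "mul (mul s t) r = mul s (mul t r)"
    and L_add: "L s (u + v) = L s u + L s v"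
    and R_add: "R (u + v) s = R u s + R v s"
    and L_mul: "L (mul s t) u = L s (L t u)"
    and R_mul: "R u (mul s t) = R (R u s) t"
    and L_R: "L s (R u t) = R (L s u) t"
begin

sublocale L: endo "L s" for s
  by unfold_locales (rule L_add)

sublocale R: endo "\<lambda>u. R u s" for s
  by unfold_locales (rule R_add)

fun ra :: "('s list \<Rightarrow> 'm) \<Rightarrow> 's \<Rightarrow> 's list \<Rightarrow> 'm" where
  "ra f s [] = R (f []) s"
| "ra f s (t # ts) = f (mul s t # ts) - ra (\<lambda>r. f (s # r)) t ts"

fun bd :: "('s list \<Rightarrow> 'm) \<Rightarrow> 's list \<Rightarrow> 'm" where
  "bd f [] = 0"
| "bd f (s # ss) = L s (f ss) - ra f s ss"

lemma ra_comp:
  assumes "\<And>u v. T (u - v) = T u - T v" "\<And>u s. T (R u s) = R (T u) s"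
  shows "ra (\<lambda>r. T (f r)) s ss = T (ra f s ss)"
  by (induction ss arbitrary: f s) (simp_all add: assms)

lemma ra_L: "ra (\<lambda>r. L t (f r)) s ss = L t (ra f s ss)"
  by (rule ra_comp) (simp_all add: L.diff L_R)

lemma ra_add: "ra (\<lambda>r. f r + g r) s ss = ra f s ss + ra g s ss"
  by (induction ss arbitrary: f g s) (simp_all add: R_add algebra_simps)

lemma ra_zero: "ra (\<lambda>r. 0) s ss = 0"
  by (induction ss arbitrary: s) (simp_all add: R.zero)

lemma ra_minus: "ra (\<lambda>r. - f r) s ss = - ra f s ss"
  using ra_comp[of "\<lambda>u. - u"] by (simp add: R.minus)

lemma ra_diff: "ra (\<lambda>r. f r - g r) s ss = ra f s ss - ra g s ss"
  using ra_add[of f "\<lambda>r. - g r"] by (simp add: ra_minus)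

lemma ra_sum: "ra (\<lambda>r. \<Sum>x\<in>A. f x r) s ss = (\<Sum>x\<in>A. ra (f x) s ss)"
  by (induction A rule: infinite_finite_induct) (simp_all add: ra_zero ra_add)

text \<open>After unfolding once, the two terms that keep \<open>s\<close> as the first argument and
  multiply \<open>t\<close> into the next one cancel by the induction hypothesis. What remains is
  associativity of \<open>mul\<close>.\<close>

lemma ra_ra: "ra (ra f s) t ss = ra f (mul s t) ss"
proof (induction ss arbitrary: f s t)
  case (Cons u us)
  have "ra (\<lambda>r. ra f s (t # r)) u us = ra (\<lambda>r. f (mul s t # r)) u us - ra (\<lambda>r. f (s # r)) (mul t u) us"
    by (simp add: ra_diff Cons.IH)
  then show ?case by (simp add: mul_assoc)
qed (simp add: R_mul)

text \<open>Written with \<open>L\<close> and \<open>ra\<close>, the cancellation only needs that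
  these are commuting left and right actions on cochains, so no alternating sums have to be
  rearranged.\<close>

lemma bd_bd: "bd (bd f) ss = 0"
proof -
  consider "ss = []" | s where "ss = [s]" | s t r where "ss = s # t # r"
    by (metis list.exhaust)
  then show ?thesis
  proof cases
    case 3
    show ?thesis by (simp add: 3 L.diff L_mul ra_diff ra_L ra_ra)
  qed (simp_all add: L.diff L_R L.zero R.zero)
qed

lemma bd_diff: "bd (\<lambda>r. f r - g r) ss = bd f ss - bd g ss"
  by (cases ss) (simp_all add: L.diff ra_diff)

lemma bd_add: "bd (\<lambda>r. f r + g r) ss = bd f ss + bd g ss"
  by (cases ss) (simp_all add: L.add ra_add)

lemma bd_minus: "bd (\<lambda>r. - f r) ss = - bd f ss"
  by (cases ss) (simp_all add: L.minus ra_minus)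

lemma ra_length:
  assumes "\<And>ss. length ss \<noteq> n \<Longrightarrow> f ss = 0" "length ss \<noteq> n"
  shows "ra f s ss = 0"
  using assms
proof (induction ss arbitrary: f s n)
  case (Cons t ts)
  have "ra (\<lambda>r. f (s # r)) t ts = 0"
  proof (cases n)
    case 0
    then show ?thesis using Cons.prems ra_zero by simp
  next
    case (Suc k)
    then show ?thesis using Cons.prems by (intro Cons.IH[of k]) auto
  qed
  then show ?case using Cons.prems by simp
qed (simp add: R.zero)

lemma bd_length:
  assumes "\<And>ss. length ss \<noteq> n \<Longrightarrow> f ss = 0" "length ss \<noteq> n + 1"
  shows "bd f ss = 0"
  using assms ra_length[of n f] by (cases ss) (simp_all add: L.zero)

definition contract :: "nat \<Rightarrow> 's list \<Rightarrow> 's list" where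
  "contract i ss = take i ss @ [mul (ss ! i) (ss ! (i + 1))] @ drop (i + 2) ss"

text \<open>The recursion unrolled to an alternating sum, for the comparison with the formula for
  the conformal differential.\<close>

lemma ra_explicit:
  assumes "length ss = n"
  shows "ra f s ss = (\<Sum>i<n. alt i (f (contract i (s # ss)))) + alt n (R (f (butlast (s # ss))) ((s # ss) ! n))"
  using assms
proof (induction ss arbitrary: f s n)
  case (Cons t ts)
  then obtain k where n: "n = Suc k" "length ts = k" by auto
  have c: "contract (Suc i) (s # t # ts) = s # contract i (t # ts)" for i
    by (simp add: contract_def)
  have "(\<Sum>i<n. alt i (f (contract i (s # t # ts))))
      = f (mul s t # ts) - (\<Sum>i<k. alt i (f (s # contract i (t # ts))))"
    unfolding n(1) by (subst sum.lessThan_Suc_shift) (simp add: c alt_Suc sum_negf, simp add: contract_def)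
  then show ?case
    using n by (simp add: Cons.IH[of k] alt_Suc)
qed simp

lemma bd_explicit:
  assumes "length ss = n + 1"
  shows "bd f ss = L (ss ! 0) (f (tl ss)) + (\<Sum>i<n. alt (i + 1) (f (contract i ss)))
    + alt (n + 1) (R (f (butlast ss)) (ss ! n))"
proof -
  obtain s ts where ss: "ss = s # ts" "length ts = n" using assms by (cases ss) auto
  show ?thesis
    unfolding ss(1) bd.simps ra_explicit[OF ss(2)] by (simp add: alt_Suc sum_negf)
qed

end


section \<open>Cochains as functions on a semigroup\<close>

lemma pcompose_const: "pcompose h [:c:] = [:poly h c:]" for h :: "'k::comm_semiring_1 poly"
  by (induction h) (simp_all add: pcompose_pCons algebra_simps)

lemma pcompose_power: "pcompose (p ^ j) q = pcompose p q ^ j" for p :: "'k::comm_ring_1 poly"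
  by (induction j) (simp_all add: pcompose_mult pcompose_1)

section \<open>Values of a sesquilinear product at elements of \<open>k[\<partial>]\<close>\<close>

locale sesquilinear_0 = sesquilinear actA actB actD prd + A: hmod actA + B: hmod actB + D: hmod actD
  for actA :: "'k::field_char_0 poly \<Rightarrow> 'a::ab_group_add \<Rightarrow> 'a"
    and actB :: "'k poly \<Rightarrow> 'b::ab_group_add \<Rightarrow> 'b"
    and actD :: "'k poly \<Rightarrow> 'd::ab_group_add \<Rightarrow> 'd"
    and prd :: "'a \<Rightarrow> 'b \<Rightarrow> 'd poly"
begin

definition val :: "'k poly \<Rightarrow> 'a \<Rightarrow> 'b \<Rightarrow> 'd" where
  "val q a b = opval (actD q) (prd a b)"

lemma val_add_left: "val q (a + a') b = val q a b + val q a' b"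
  and val_add_right: "val q a (b + b') = val q a b + val q a b'"
  by (simp_all add: val_def add_left add_right endo.opval_add[OF D.endo_act])

sublocale vl: Modules.additive "\<lambda>a. val q a b" for q b
  by unfold_locales (rule val_add_left)

sublocale vr: Modules.additive "val q a" for q a
  by unfold_locales (rule val_add_right)

lemma opval_map_act: "opval (actD q) (map_poly (actD h) p) = actD h (opval (actD q) p)"
  by (rule endo.opval_commute[OF D.endo_act, symmetric]) (simp_all add: D.scale_right_distrib mult.commute)

lemma act_pCons: "actA (pCons c h) a = actA [:c:] a + actA [:0, 1:] (actA h a)"
    "actB (pCons c h) b = actB [:c:] b + actB [:0, 1:] (actB h b)"
    "actD (pCons c h) d = actD [:c:] d + actD [:0, 1:] (actD h d)"
  by (simp_all flip: A.scale_left_distrib B.scale_left_distrib D.scale_left_distrib)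

text \<open>Sesquilinearity extends from \<open>\<partial>\<close> to all of \<open>H\<close>: on
  the left \<open>h(\<partial>)\<close> becomes \<open>h(-q)\<close>, and in
  \<open>val_right\<close> it becomes \<open>h(\<partial> + q)\<close>. For
  \<open>q = -\<partial> - \<lambda>\<close> these are \<open>h(\<partial> + \<lambda>)\<close> and
  \<open>h(-\<lambda>)\<close>.\<close>

lemma val_left: "val q (actA h a) b = actD (pcompose h (- q)) (val q a b)"
proof (induction h)
  case (pCons c h)
  have "val q (actA [:0, 1:] a') b = actD (- q) (val q a' b)" for a'
    by (simp add: val_def del_left endo.opval_minus[OF D.endo_act] endo.opval_pCons[OF D.endo_act])
  moreover have "val q (actA [:c:] a) b = actD [:c:] (val q a b)"
    by (simp add: val_def scale_left opval_map_act)
  ultimately show ?case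
    unfolding act_pCons(1)[of c h a] val_add_left pCons.IH pcompose_pCons
    by (simp only: D.scale_left_distrib D.scale_scale pCons.IH)
qed (simp add: vl.zero)

lemma val_right: "val q a (actB h b) = actD (pcompose h ([:0, 1:] + q)) (val q a b)"
proof (induction h)
  case (pCons c h)
  have "val q a (actB [:0, 1:] b') = actD ([:0, 1:] + q) (val q a b')" for b'
    by (simp add: val_def del_right endo.opval_add[OF D.endo_act] endo.opval_pCons[OF D.endo_act]
        opval_map_act D.scale_left_distrib[of "[:0, 1:]" q])
  moreover have "val q a (actB [:c:] b) = actD [:c:] (val q a b)"
    by (simp add: val_def scale_right opval_map_act)
  ultimately show ?case
    unfolding act_pCons(2)[of c h b] val_add_right pCons.IH pcompose_pCons
    by (simp only: D.scale_left_distrib[of "[:c:]"] D.scale_scale pCons.IH)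
qed (simp add: vr.zero)

lemma val_opval_left:
  "val q (opval (actA h) p) b = (\<Sum>j\<le>Polynomial.degree p. actD (pcompose h (- q) ^ j) (val q (Polynomial.coeff p j) b))"
  by (simp add: A.opval_act vl.sum val_left pcompose_power)

lemma val_opval_right:
  "val q a (opval (actB h) p) = (\<Sum>j\<le>Polynomial.degree p. actD (pcompose h ([:0, 1:] + q) ^ j) (val q a (Polynomial.coeff p j)))"
  by (simp add: B.opval_act vr.sum val_right pcompose_power)

end

lemma lam_power: "lam i ^ j = Poly_Mapping.single (Poly_Mapping.single i j) 1"
proof (induction j)
  case (Suc j)
  have "Poly_Mapping.single i 1 + Poly_Mapping.single i j = Poly_Mapping.single i (Suc j)"
    by (simp flip: single_add)
  then show ?case unfolding power_Suc Suc unfolding lam_def mult_single by simp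
qed simp

context hmod
begin

lemma mact_single: "mact act (Poly_Mapping.single s p) (Poly_Mapping.single t u) = Poly_Mapping.single (s + t) (act p u)"
  by (cases "p = 0"; cases "u = 0") (simp_all add: mact_def)

lemma eval_at_lam: "eval_at act (lam i) p
    = (\<Sum>j\<le>Polynomial.degree p. Poly_Mapping.single (Poly_Mapping.single i j) (Polynomial.coeff p j))"
  by (simp add: eval_at_def lam_power mact_single)

lemma mval_lin_ext_bound:
  assumes "f 0 = 0" "finite S" "Poly_Mapping.keys u \<subseteq> S"
  shows "mval act \<rho> (lin_ext act f q u)
   = (\<Sum>t\<in>S. act (monom_val \<rho> t) (opval (act (hval \<rho> q)) (f (Poly_Mapping.lookup u t))))"
  unfolding mval_lin_ext
  by (rule sum.mono_neutral_left) (use assms in \<open>auto simp: in_keys_iff opval_def\<close>)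

lemma mval_lin_ext_add:
  assumes "\<And>a b :: 'a::ab_group_add. f (a + b) = f a + f b"
  shows "mval act \<rho> (lin_ext act f q (u + v)) = mval act \<rho> (lin_ext act f q u) + mval act \<rho> (lin_ext act f q v)"
proof -
  interpret f: Modules.additive f by unfold_locales (rule assms)
  let ?S = "Poly_Mapping.keys u \<union> Poly_Mapping.keys v"
  have "Poly_Mapping.keys (u + v) \<subseteq> ?S" by (rule keys_add)
  then show ?thesis
    by (simp add: mval_lin_ext_bound[of f ?S] f.zero lookup_add assms endo.opval_add[OF endo_act]
        scale_right_distrib sum.distrib)
qed

lemma mval_lin_ext_sum:
  assumes "\<And>a b :: 'a::ab_group_add. f (a + b) = f a + f b"
  shows "mval act \<rho> (lin_ext act f q (sum g A)) = (\<Sum>x\<in>A. mval act \<rho> (lin_ext act f q (g x)))"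
  by (induction A rule: infinite_finite_induct) (simp_all add: mval_lin_ext_add[OF assms], simp_all add: lin_ext_def)

lemma mval_lin_ext_single:
  assumes "\<And>a b :: 'a::ab_group_add. f (a + b) = f a + f b"
  shows "mval act \<rho> (lin_ext act f q (Poly_Mapping.single t a)) = act (monom_val \<rho> t) (opval (act (hval \<rho> q)) (f a))"
proof -
  interpret f: Modules.additive f by unfold_locales (rule assms)
  show ?thesis by (subst mval_lin_ext_bound[of f "{t}"]) (auto simp: f.zero)
qed

lemma mval_lin_ext_eval_at:
  assumes "\<And>a b :: 'a::ab_group_add. f (a + b) = f a + f b" "hmod act'"
  shows "mval act \<rho> (lin_ext act f q (eval_at act' (lam i) p))
    = (\<Sum>j\<le>Polynomial.degree p. act (\<rho> i ^ j) (opval (act (hval \<rho> q)) (f (Polynomial.coeff p j))))"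
  by (simp add: hmod.eval_at_lam[OF assms(2)] mval_lin_ext_sum[OF assms(1)] mval_lin_ext_single[OF assms(1)])

text \<open>At scalar values of the variables the monomials act as scalars, and these pass through
  the \<open>k\<close>-linear map \<open>T\<close>.\<close>

lemma mval_lin_ext_const:
  assumes f: "\<And>a b. f (a + b) = f a + f b"
    and T: "klinear T" and fT: "\<And>a. opval (act (hval (\<lambda>i. [:\<rho> i:]) q)) (f a) = T a"
  shows "mval act (\<lambda>i. [:\<rho> i:]) (lin_ext act f q u) = T (mval act (\<lambda>i. [:\<rho> i:]) u)"
  unfolding mval_lin_ext fT mval_def[of act _ u] by (simp add: monom_val_const klinearD[OF T])

end

context sesquilinear_0
begin

lemma mval_left:
  assumes "hmod act'"
  shows "mval actD \<rho> (lin_ext actD (\<lambda>v. prd v b) q (eval_at act' (lam i) p))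
    = (\<Sum>j\<le>Polynomial.degree p. actD (\<rho> i ^ j) (val (hval \<rho> q) (Polynomial.coeff p j) b))"
  by (simp add: D.mval_lin_ext_eval_at[OF add_left assms] val_def)

lemma mval_right:
  assumes "hmod act'"
  shows "mval actD \<rho> (lin_ext actD (prd a) q (eval_at act' (lam i) p))
    = (\<Sum>j\<le>Polynomial.degree p. actD (\<rho> i ^ j) (val (hval \<rho> q) a (Polynomial.coeff p j)))"
  by (simp add: D.mval_lin_ext_eval_at[OF add_right assms] val_def)

end

section \<open>Arguments paired with the scalars at which their variables are evaluated\<close>

definition zips :: "'c list \<Rightarrow> (nat \<Rightarrow> 'k) \<Rightarrow> ('c \<times> 'k) list" where
  "zips cs \<rho> = map (\<lambda>i. (cs ! i, \<rho> i)) [0..<length cs]"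

lemma length_zips [simp]: "length (zips cs \<rho>) = length cs"
  by (simp add: zips_def)

lemma nth_zips: "i < length cs \<Longrightarrow> zips cs \<rho> ! i = (cs ! i, \<rho> i)"
  by (simp add: zips_def)

lemma zips_Nil [simp]: "zips [] \<rho> = []"
  by (simp add: zips_def)

lemma zips_Cons: "zips (c # cs) \<rho> = (c, \<rho> 0) # zips cs (\<lambda>i. \<rho> (Suc i))"
  by (rule nth_equalityI) (auto simp: nth_zips nth_Cons split: nat.split)

lemma map_fst_zips [simp]: "map fst (zips cs \<rho>) = cs"
  by (rule nth_equalityI) (auto simp: nth_zips)

lemma zips_cong: "(\<And>i. i < length cs \<Longrightarrow> \<rho> i = \<rho>' i) \<Longrightarrow> zips cs \<rho> = zips cs \<rho>'"
  by (simp add: zips_def)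

lemma zips_snd: "zips (map fst ss) (\<lambda>i. if i < length ss then snd (ss ! i) else 0) = ss"
  by (rule nth_equalityI) (auto simp: nth_zips)

lemma tl_zips: "tl (zips cs \<rho>) = zips (tl cs) (\<lambda>i. \<rho> (Suc i))"
  by (cases cs) (simp_all add: zips_Cons)

lemma butlast_zips: "butlast (zips cs \<rho>) = zips (butlast cs) \<rho>"
  by (rule nth_equalityI) (auto simp: nth_zips nth_butlast)

section \<open>The semigroup of a conformal algebra and its two actions on a bimodule\<close>

locale conformal_bimodule_0 = conformal_bimodule actC cprd actM lprd rprd
  for actC :: "'k::field_char_0 poly \<Rightarrow> 'c::ab_group_add \<Rightarrow> 'c"
    and cprd :: "'c \<Rightarrow> 'c \<Rightarrow> 'c poly"
    and actM :: "'k poly \<Rightarrow> 'm::ab_group_add \<Rightarrow> 'm"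
    and lprd :: "'c \<Rightarrow> 'm \<Rightarrow> 'm poly"
    and rprd :: "'m \<Rightarrow> 'c \<Rightarrow> 'm poly"
begin

sublocale HC: hmod actC ..
sublocale HM: hmod actM ..
sublocale pc: sesquilinear_0 actC actC actC cprd ..
sublocale pl: sesquilinear_0 actC actM actM lprd ..
sublocale pr: sesquilinear_0 actM actC actM rprd ..

definition smul :: "'c \<times> 'k \<Rightarrow> 'c \<times> 'k \<Rightarrow> 'c \<times> 'k" where
  "smul s t = (pc.val [:snd s:] (fst s) (fst t), snd s + snd t)"

definition lact :: "'c \<times> 'k \<Rightarrow> 'm \<Rightarrow> 'm" where
  "lact s u = pl.val [:snd s:] (fst s) u"

text \<open>The polynomial is \<open>-\<partial> - \<lambda>\<close>, as in the last term of the
  Hochschild differential. With this choice the right action is associative and commutes with the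
  left one.\<close>

definition ract :: "'m \<Rightarrow> 'c \<times> 'k \<Rightarrow> 'm" where
  "ract u s = pr.val [:- snd s, - 1:] u (fst s)"

sublocale bar smul lact ract
proof
  fix s t r :: "'c \<times> 'k" and u v :: 'm
  show "lact s (u + v) = lact s u + lact s v" by (simp add: lact_def pl.val_add_right)
  show "ract (u + v) s = ract u s + ract v s" by (simp add: ract_def pr.val_add_left)
  obtain a x b y c z where s: "s = (a, x)" "t = (b, y)" "r = (c, z)" by (metis surj_pair)
  define \<rho> where "\<rho> i = (if i = 0 then [:x:] else [:y:])" for i :: nat
  have "pc.val [:x:] a (opval (actC [:y:]) (cprd b c)) = pc.val [:x + y:] (opval (actC [:x:]) (cprd a b)) c"
    using arg_cong[OF assoc[of a b c], of "mval actC \<rho>"]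
    by (simp add: pc.mval_left[OF HC.hmod_axioms] pc.mval_right[OF HC.hmod_axioms] pc.val_opval_left pc.val_opval_right self.mval_add \<rho>_def)
  then show "smul (smul s t) r = smul s (smul t r)" by (simp add: s smul_def pc.val_def)
  have "pl.val [:x:] a (opval (actM [:y:]) (lprd b u)) = pl.val [:x + y:] (opval (actC [:x:]) (cprd a b)) u"
    using arg_cong[OF left_assoc[of a b u], of "mval actM \<rho>"]
    by (simp add: pl.mval_left[OF HC.hmod_axioms] pl.mval_right[OF HM.hmod_axioms] pl.val_opval_left pl.val_opval_right self.mval_add \<rho>_def)
  then show "lact (smul s t) u = lact s (lact t u)" by (simp add: s smul_def lact_def pc.val_def pl.val_def)
  \<comment> \<open>Inside the outer right product by \<open>(b, y)\<close> the operator
    \<open>\<partial>\<close> acts as \<open>\<partial> + y\<close>. The inner value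
    \<open>-\<partial> - x\<close> therefore corresponds to \<open>-\<partial> - x - y\<close> for
    the first variable of the identity.\<close>
  define \<rho>1 where "\<rho>1 i = (if i = 0 then [:- x - y, - 1:] else [:x:])" for i :: nat
  have "pr.val [:- x - y, - 1:] u (opval (actC [:x:]) (cprd a b)) = pr.val [:- y, - 1:] (opval (actM [:- x, - 1:]) (rprd u a)) b"
    using arg_cong[OF right_assoc[of u a b], of "mval actM \<rho>1"]
    by (simp add: pr.mval_left[OF HM.hmod_axioms] pr.mval_right[OF HC.hmod_axioms] pr.val_opval_left pr.val_opval_right self.mval_add \<rho>1_def pcompose_pCons)
  then show "ract u (smul s t) = ract (ract u s) t" by (simp add: s smul_def ract_def pc.val_def pr.val_def)
  \<comment> \<open>Now the outer product is the left one at \<open>x\<close>, under which the inner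
    \<open>-\<partial> - y\<close> becomes \<open>-\<partial> - x - y\<close>; the sum of both
    variables is \<open>-\<partial> - y\<close>.\<close>
  define \<rho>2 where "\<rho>2 i = (if i = 0 then [:x:] else [:- y - x, - 1:])" for i :: nat
  have "pl.val [:x:] a (opval (actM [:- y, - 1:]) (rprd u b)) = pr.val [:- y, - 1:] (opval (actM [:x:]) (lprd a u)) b"
    using arg_cong[OF middle_assoc[of a u b], of "mval actM \<rho>2"]
    by (simp add: pl.mval_right[OF HM.hmod_axioms] pr.mval_left[OF HM.hmod_axioms] pl.val_opval_right pr.val_opval_left self.mval_add \<rho>2_def pcompose_pCons)
  then show "lact s (ract u t) = ract (lact s u) t" by (simp add: s lact_def ract_def pl.val_def pr.val_def)
qed

end

lemma (in hmod) alt_act: "alt i u = act ((- 1) ^ i) u"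
  by (cases "even i") (simp_all add: alt_def)

lemma (in hmod) mval_local:
  assumes "\<forall>t\<in>Poly_Mapping.keys u. Poly_Mapping.keys t \<subseteq> {..<n}" "\<And>i. i < n \<Longrightarrow> \<rho> i = \<rho>' i"
  shows "mval act \<rho> u = mval act \<rho>' u"
proof -
  have "monom_val \<rho> t = monom_val \<rho>' t" if "t \<in> Poly_Mapping.keys u" for t
    unfolding monom_val_def by (rule prod.cong) (use assms that in \<open>auto simp: subset_eq\<close>)
  then show ?thesis by (simp add: mval_def)
qed

lemma list_update_append_Cons: "length pre = i \<Longrightarrow> (pre @ c # post)[i := a] = pre @ a # post"
  by (metis list_update_length)

lemma list_split_nth:
  assumes "i < length as"
  obtains pre c post where "as = pre @ c # post" "length pre = i"
  using assms id_take_nth_drop[of i as] by (metis length_take min.absorb4)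

lemma zips_append_Cons:
  "zips (pre @ c # post) \<rho> = zips pre \<rho> @ (c, \<rho> (length pre)) # zips post (\<lambda>i. \<rho> (Suc (length pre + i)))"
  by (induction pre arbitrary: \<rho>) (simp_all add: zips_Cons)

section \<open>Multilinear functions on the semigroup\<close>

context conformal_bimodule_0
begin

lemma klinear_lact: "HM.klinear (lact s)"
  by (simp add: HM.klinear_def lact_def pl.val_add_right pl.val_right)

lemma klinear_ract: "HM.klinear (\<lambda>u. ract u s)"
  by (simp add: HM.klinear_def ract_def pr.val_add_left pr.val_left)

text \<open>The condition on one argument of a basic cochain once its variable has the value
  \<open>x\<close>: there \<open>\<partial>\<close> acts as the scalar \<open>-x\<close>.\<close>

definition flin :: "'k \<Rightarrow> ('c \<Rightarrow> 'm) \<Rightarrow> bool" where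
  "flin x f \<longleftrightarrow> (\<forall>c c'. f (c + c') = f c + f c') \<and> (\<forall>h c. f (actC h c) = actM [:poly h (- x):] (f c))"

lemma flinI:
  "(\<And>c c'. f (c + c') = f c + f c') \<Longrightarrow> (\<And>h c. f (actC h c) = actM [:poly h (- x):] (f c)) \<Longrightarrow> flin x f"
  by (simp add: flin_def)

lemma flinD:
  assumes "flin x f"
  shows "f (c + c') = f c + f c'" "f (actC h c) = actM [:poly h (- x):] (f c)"
    "f 0 = 0" "f (- c) = - f c" "f (c - c') = f c - f c'" "f (sum g A) = (\<Sum>i\<in>A. f (g i))"
proof -
  interpret Modules.additive f by unfold_locales (use assms in \<open>simp add: flin_def\<close>)
  show "f 0 = 0" "f (- c) = - f c" "f (c - c') = f c - f c'" "f (sum g A) = (\<Sum>i\<in>A. f (g i))"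
    by (rule zero minus diff sum)+
qed (use assms in \<open>auto simp: flin_def\<close>)

lemma flin_zero: "flin x (\<lambda>c. 0)"
  by (simp add: flin_def)

lemma flin_add: "flin x f \<Longrightarrow> flin x g \<Longrightarrow> flin x (\<lambda>c. f c + g c)"
  by (simp add: flin_def M.scale_right_distrib algebra_simps)

lemma flin_diff: "flin x f \<Longrightarrow> flin x g \<Longrightarrow> flin x (\<lambda>c. f c - g c)"
  by (simp add: flin_def M.scale_right_diff_distrib algebra_simps)

lemma flin_comp: "flin x f \<Longrightarrow> HM.klinear T \<Longrightarrow> flin x (\<lambda>c. T (f c))"
  by (simp add: flin_def HM.klinearD)

lemma flin_sum: "(\<And>i. i \<in> A \<Longrightarrow> flin x (f i)) \<Longrightarrow> flin x (\<lambda>c. \<Sum>i\<in>A. f i c)"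
  by (induction A rule: infinite_finite_induct) (simp_all add: flin_zero flin_add)

lemma flin_lact: "flin x (\<lambda>c. lact (c, x) u)"
  by (simp add: flin_def lact_def pl.val_add_left pl.val_left pcompose_const)

lemma flin_ract: "flin x (\<lambda>c. ract u (c, x))"
  by (simp add: flin_def ract_def pr.val_add_right pr.val_right pcompose_const)

lemma flin_smul_left: "flin (x + snd s) f \<Longrightarrow> flin x (\<lambda>c. f (fst (smul (c, x) s)))"
  by (simp add: flin_def smul_def pc.val_add_left pc.val_left pcompose_const)

text \<open>With \<open>\<lambda> = snd s\<close>, the operator \<open>\<partial>\<close> in the
  right factor becomes \<open>\<partial> + \<lambda>\<close> in the product. Then \<open>f\<close>
  turns \<open>\<partial>\<close> into \<open>-(\<lambda> + x)\<close>, and \<open>-x\<close> is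
  left.\<close>

lemma flin_smul_right: "flin (snd s + x) f \<Longrightarrow> flin x (\<lambda>c. f (fst (smul s (c, x))))"
  by (simp add: flin_def smul_def pc.val_add_right pc.val_right poly_pcompose)

lemma smul_pair: "smul s t = (fst (smul s t), snd s + snd t)"
  by (simp add: smul_def)

definition multilin :: "(('c \<times> 'k) list \<Rightarrow> 'm) \<Rightarrow> bool" where
  "multilin f \<longleftrightarrow> (\<forall>pre post x. flin x (\<lambda>c. f (pre @ (c, x) # post)))"

lemma multilinD: "multilin f \<Longrightarrow> flin x (\<lambda>c. f (pre @ (c, x) # post))"
  by (simp add: multilin_def)

lemma multilin_hd: "multilin f \<Longrightarrow> flin x (\<lambda>c. f ((c, x) # post))"
  using multilinD[of f x "[]"] by simp

lemma multilin_2: "multilin f \<Longrightarrow> flin x (\<lambda>c. f (s # (c, x) # post))"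
  using multilinD[of f x "[s]"] by simp

lemma multilin_Cons: "multilin f \<Longrightarrow> multilin (\<lambda>r. f (s # r))"
  unfolding multilin_def append_Cons[symmetric] by blast

lemma multilin_add: "multilin f \<Longrightarrow> multilin g \<Longrightarrow> multilin (\<lambda>r. f r + g r)"
  unfolding multilin_def using flin_add by blast

lemma multilin_diff: "multilin f \<Longrightarrow> multilin g \<Longrightarrow> multilin (\<lambda>r. f r - g r)"
  unfolding multilin_def using flin_diff by blast

lemma multilin_comp: "multilin f \<Longrightarrow> HM.klinear T \<Longrightarrow> multilin (\<lambda>r. T (f r))"
  unfolding multilin_def using flin_comp by blast

lemma ra_act: "ra (\<lambda>r. actM [:c:] (f r)) s ss = actM [:c:] (ra f s ss)"
  by (rule ra_comp) (simp_all add: M.scale_right_diff_distrib HM.klinearD(2)[OF klinear_ract])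

lemma flin_ra_fun:
  assumes "\<And>r. flin x (\<lambda>c. F c r)"
  shows "flin x (\<lambda>c. ra (F c) s ss)"
proof (rule flinI)
  fix c c' h
  have "F (c + c') = (\<lambda>r. F c r + F c' r)" "F (actC h c) = (\<lambda>r. actM [:poly h (- x):] (F c r))"
    using flinD(1,2)[OF assms] by blast+
  then show "ra (F (c + c')) s ss = ra (F c) s ss + ra (F c') s ss"
    "ra (F (actC h c)) s ss = actM [:poly h (- x):] (ra (F c) s ss)"
    by (simp_all only: ra_add ra_act)
qed

lemma flin_ra_hd:
  assumes "multilin f"
  shows "flin x (\<lambda>c. ra f (c, x) ss)"
proof (cases ss)
  case Nil
  then show ?thesis by (simp add: flin_ract)
next
  case (Cons t ts)
  have "flin x (\<lambda>c. f (smul (c, x) t # ts))"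
    by (subst smul_pair, simp, rule flin_smul_left, rule multilin_hd[OF assms])
  moreover have "flin x (\<lambda>c. ra (\<lambda>r. f ((c, x) # r)) t ts)"
    by (rule flin_ra_fun) (rule multilin_hd[OF assms])
  ultimately show ?thesis by (simp add: Cons flin_diff)
qed

lemma multilin_ra:
  assumes "multilin f"
  shows "multilin (ra f s)"
proof -
  have "flin x (\<lambda>c. ra f s (pre @ (c, x) # post))" for x pre post
    using assms
  proof (induction pre arbitrary: f s)
    case Nil
    have "flin x (\<lambda>c. f (smul s (c, x) # post))"
      by (subst smul_pair, simp, rule flin_smul_right, rule multilin_hd[OF Nil])
    moreover have "flin x (\<lambda>c. ra (\<lambda>r. f (s # r)) (c, x) post)"
      by (rule flin_ra_hd) (rule multilin_Cons[OF Nil])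
    ultimately show ?case by (simp add: flin_diff)
  next
    case (Cons t pre)
    have "flin x (\<lambda>c. f (smul s t # pre @ (c, x) # post))"
      using multilinD[OF Cons.prems, of x "smul s t # pre"] by simp
    moreover have "flin x (\<lambda>c. ra (\<lambda>r. f (s # r)) t (pre @ (c, x) # post))"
      by (rule Cons.IH) (rule multilin_Cons[OF Cons.prems])
    ultimately show ?case by (simp add: flin_diff)
  qed
  then show ?thesis by (simp add: multilin_def)
qed

lemma multilin_bd:
  assumes "multilin f"
  shows "multilin (bd f)"
proof -
  have "flin x (\<lambda>c. bd f (pre @ (c, x) # post))" for x pre post
  proof (cases pre)
    case Nil
    then show ?thesis by (simp add: flin_diff flin_lact flin_ra_hd assms)
  next
    case (Cons s pre')
    have "flin x (\<lambda>c. lact s (f (pre' @ (c, x) # post)))"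
      by (rule flin_comp[OF _ klinear_lact]) (rule multilinD[OF assms])
    then show ?thesis
      using multilinD[OF multilin_ra[OF assms]] by (simp add: Cons flin_diff)
  qed
  then show ?thesis by (simp add: multilin_def)
qed

text \<open>These are exactly the functions \<open>fn \<phi>\<close> of basic
  \<open>n\<close>-cochains, by \<open>regular_fn\<close> and \<open>regular_imp_fn\<close>.
  Polynomiality is required for each fixed list of algebra elements separately.\<close>

definition regular :: "nat \<Rightarrow> (('c \<times> 'k) list \<Rightarrow> 'm) \<Rightarrow> bool" where
  "regular n f \<longleftrightarrow> (\<forall>ss. length ss \<noteq> n \<longrightarrow> f ss = 0) \<and> multilin f
     \<and> (\<forall>cs. length cs = n \<longrightarrow> HM.polyf (\<lambda>\<rho>. f (zips cs \<rho>)))"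

text \<open>Variables beyond the arguments get the value 0; a basic cochain contains none of
  them.\<close>

definition fn :: "('c list \<Rightarrow> 'm mpol) \<Rightarrow> ('c \<times> 'k) list \<Rightarrow> 'm" where
  "fn \<phi> ss = mval actM (\<lambda>i. [:if i < length ss then snd (ss ! i) else 0:]) (\<phi> (map fst ss))"

lemma basicD:
  assumes "\<phi> \<in> basic_cochains n"
  shows "length as \<noteq> n \<Longrightarrow> \<phi> as = 0"
    and "\<forall>t\<in>Poly_Mapping.keys (\<phi> as). Poly_Mapping.keys t \<subseteq> {..<n}"
    and "length pre + length post + 1 = n \<Longrightarrow> \<phi> (pre @ (a + b) # post) = \<phi> (pre @ a # post) + \<phi> (pre @ b # post)"
    and "length pre + length post + 1 = n \<Longrightarrow>
      mval actM (\<lambda>i. [:\<rho> i:]) (\<phi> (pre @ actC h a # post))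
      = actM [:poly h (- \<rho> (length pre)):] (mval actM (\<lambda>i. [:\<rho> i:]) (\<phi> (pre @ a # post)))"
proof -
  show "length as \<noteq> n \<Longrightarrow> \<phi> as = 0" using assms by (simp add: basic_cochains_def)
  show "\<forall>t\<in>Poly_Mapping.keys (\<phi> as). Poly_Mapping.keys t \<subseteq> {..<n}"
    using assms by (simp add: basic_cochains_def)
  assume n: "length pre + length post + 1 = n"
  show add: "\<phi> (pre @ (a + b) # post) = \<phi> (pre @ a # post) + \<phi> (pre @ b # post)" for a b
  proof -
    have "length (pre @ a # post) = n \<and> length pre < n" using n by auto
    then have "\<phi> ((pre @ a # post)[length pre := a + b])
        = \<phi> ((pre @ a # post)[length pre := a]) + \<phi> ((pre @ a # post)[length pre := b])"
      using assms unfolding basic_cochains_def by blast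
    then show ?thesis by (simp only: list_update_length)
  qed
  have sc: "\<phi> (pre @ actC [:r:] a # post) = mact actM (Poly_Mapping.single 0 [:r:]) (\<phi> (pre @ a # post))" for r a
  proof -
    have "length (pre @ a # post) = n \<and> length pre < n" using n by auto
    then have "\<phi> ((pre @ a # post)[length pre := actC [:r:] a])
        = mact actM (Poly_Mapping.single 0 [:r:]) (\<phi> ((pre @ a # post)[length pre := a]))"
      using assms unfolding basic_cochains_def by blast
    then show ?thesis by (simp only: list_update_length)
  qed
  have dl: "\<phi> (pre @ actC [:0, 1:] a # post) = mact actM (- lam (length pre)) (\<phi> (pre @ a # post))" for a
  proof -
    have "length (pre @ a # post) = n \<and> length pre < n" using n by auto
    then have "\<phi> ((pre @ a # post)[length pre := actC [:0, 1:] a])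
        = mact actM (- lam (length pre)) (\<phi> ((pre @ a # post)[length pre := a]))"
      using assms unfolding basic_cochains_def by blast
    then show ?thesis by (simp only: list_update_length)
  qed
  show "mval actM (\<lambda>i. [:\<rho> i:]) (\<phi> (pre @ actC h a # post))
      = actM [:poly h (- \<rho> (length pre)):] (mval actM (\<lambda>i. [:\<rho> i:]) (\<phi> (pre @ a # post)))"
  proof (induction h arbitrary: a)
    case 0
    then show ?case using sc[of 0 a] by (simp add: HM.mval_mact)
  next
    case (pCons c h)
    have "[:poly (pCons c h) (- \<rho> (length pre)):] = [:c:] + (- [:\<rho> (length pre):]) * [:poly h (- \<rho> (length pre)):]"
      by simp
    then show ?case
      unfolding pc.act_pCons(1)[of c h a] add HM.mval_add sc dl
      by (simp only: HM.mval_mact self.mval_single self.mval_minus hval_lam monom_val_0 mult_1 pCons.IH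
          M.scale_left_distrib M.scale_scale)
  qed
qed

lemma fn_zips:
  assumes "\<phi> \<in> basic_cochains n" "length cs = n"
  shows "fn \<phi> (zips cs \<rho>) = mval actM (\<lambda>i. [:\<rho> i:]) (\<phi> cs)"
  unfolding fn_def map_fst_zips
  by (rule HM.mval_local[of _ n]) (use basicD(2)[OF assms(1)] assms(2) in \<open>auto simp: nth_zips\<close>)

lemma ex_zips: obtains \<rho> :: "nat \<Rightarrow> 'k" where "ss = zips (map fst ss) \<rho>"
  by (rule that[OF zips_snd[symmetric]])

lemma regular_fn:
  assumes "\<phi> \<in> basic_cochains n"
  shows "regular n (fn \<phi>)"
proof -
  have len: "fn \<phi> ss = 0" if "length ss \<noteq> n" for ss
    using that basicD(1)[OF assms, of "map fst ss"] by (simp add: fn_def)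
  have "flin x (\<lambda>c. fn \<phi> (pre @ (c, x) # post))" for x pre post
  proof (cases "length pre + length post + 1 = n")
    case True
    \<comment> \<open>The scalars do not depend on the algebra element in the open slot, so a
      valuation found with 0 in this slot serves for every \<open>c\<close>.\<close>
    obtain \<rho>0 where \<rho>0: "pre @ (0, x) # post = zips (map fst (pre @ (0, x) # post)) \<rho>0"
      by (rule ex_zips)
    have x: "\<rho>0 (length pre) = x"
    proof -
      have "(pre @ (0, x) # post) ! length pre = zips (map fst (pre @ (0, x) # post)) \<rho>0 ! length pre"
        using \<rho>0 by (rule arg_cong)
      also have "\<dots> = (map fst (pre @ (0, x) # post) ! length pre, \<rho>0 (length pre))"
        by (rule nth_zips) simp
      finally show ?thesis by simp
    qed
    have "pre @ (c, x) # post = zips (map fst pre @ c # map fst post) \<rho>0" for c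
    proof (rule nth_equalityI)
      fix i assume i: "i < length (pre @ (c, x) # post)"
      have "(pre @ (0, x) # post) ! i = zips (map fst (pre @ (0, x) # post)) \<rho>0 ! i"
        using \<rho>0 by (rule arg_cong)
      also have "\<dots> = (map fst (pre @ (0, x) # post) ! i, \<rho>0 i)"
        by (rule nth_zips) (use i in simp)
      finally show "(pre @ (c, x) # post) ! i = zips (map fst pre @ c # map fst post) \<rho>0 ! i"
        using i by (subst nth_zips) (auto simp: nth_append nth_Cons x split: nat.splits)
    qed simp
    then have "fn \<phi> (pre @ (c, x) # post) = mval actM (\<lambda>i. [:\<rho>0 i:]) (\<phi> (map fst pre @ c # map fst post))" for c
      using fn_zips[OF assms, of "map fst pre @ c # map fst post" \<rho>0] True by simp
    then show ?thesis
      using basicD(3,4)[OF assms, of "map fst pre" "map fst post"] True x by (simp add: flin_def HM.mval_add)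
  next
    case False
    then show ?thesis by (simp add: len flin_zero)
  qed
  then have "multilin (fn \<phi>)" by (simp add: multilin_def)
  then show ?thesis
    using len by (simp add: regular_def fn_zips[OF assms] HM.polyf_mval)
qed

text \<open>All conditions on a cochain are identities of polynomials or concern the variables that
  occur, so they can be tested at scalars, where they become properties of \<open>f\<close>.\<close>

lemma basicI:
  assumes len: "\<And>cs. length cs \<noteq> n \<Longrightarrow> \<phi> cs = 0"
    and ml: "multilin f"
    and val: "\<And>cs \<rho>. length cs = n \<Longrightarrow> mval actM (\<lambda>i. [:\<rho> i:]) (\<phi> cs) = f (zips cs \<rho>)"
  shows "\<phi> \<in> basic_cochains n"
proof -
  have keys: "Poly_Mapping.keys t \<subseteq> {..<n}" if "t \<in> Poly_Mapping.keys (\<phi> as)" for as t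
  proof (cases "length as = n")
    case True
    show ?thesis
    proof (rule HM.keys_subset_if_mval_local[OF _ that])
      fix \<rho> \<rho>' :: "nat \<Rightarrow> 'k" assume "\<And>i. i < n \<Longrightarrow> \<rho> i = \<rho>' i"
      then show "mval actM (\<lambda>i. [:\<rho> i:]) (\<phi> as) = mval actM (\<lambda>i. [:\<rho>' i:]) (\<phi> as)"
        using zips_cong[of as \<rho> \<rho>'] True by (simp add: val)
    qed
  qed (use that len in simp)
  have slot: "\<exists>F. (\<forall>c \<rho>. mval actM (\<lambda>i. [:\<rho> i:]) (\<phi> (as[i := c])) = F \<rho> c) \<and> (\<forall>\<rho>. flin (\<rho> i) (F \<rho>))"
    if as: "length as = n" "i < n" for as i
  proof -
    obtain pre c0 post where s: "as = pre @ c0 # post" "length pre = i"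
      using list_split_nth[of i as] as by metis
    show ?thesis
      unfolding s(1) list_update_append_Cons[OF s(2)]
      by (rule exI[of _ "\<lambda>\<rho> c. f (zips pre \<rho> @ (c, \<rho> i) # zips post (\<lambda>j. \<rho> (Suc (i + j))))"])
         (use as s in \<open>simp add: val zips_append_Cons multilinD[OF ml]\<close>)
  qed
  have "\<phi> (as[i := a + b]) = \<phi> (as[i := a]) + \<phi> (as[i := b])"
    "\<phi> (as[i := actC [:r:] a]) = mact actM (Poly_Mapping.single 0 [:r:]) (\<phi> (as[i := a]))"
    "\<phi> (as[i := actC [:0, 1:] a]) = mact actM (- lam i) (\<phi> (as[i := a]))"
    if as: "length as = n" "i < n" for as i a b r
  proof -
    obtain F where F: "\<And>c \<rho>. mval actM (\<lambda>i. [:\<rho> i:]) (\<phi> (as[i := c])) = F \<rho> c" "\<And>\<rho>. flin (\<rho> i) (F \<rho>)"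
      using slot[OF as] by blast
    show "\<phi> (as[i := a + b]) = \<phi> (as[i := a]) + \<phi> (as[i := b])"
      by (rule HM.mval_const_eqI) (simp add: F(1) HM.mval_add flinD(1)[OF F(2)])
    show "\<phi> (as[i := actC [:r:] a]) = mact actM (Poly_Mapping.single 0 [:r:]) (\<phi> (as[i := a]))"
      by (rule HM.mval_const_eqI) (simp add: F(1) HM.mval_mact flinD(2)[OF F(2)])
    show "\<phi> (as[i := actC [:0, 1:] a]) = mact actM (- lam i) (\<phi> (as[i := a]))"
      by (rule HM.mval_const_eqI) (simp add: F(1) HM.mval_mact self.mval_minus flinD(2)[OF F(2)] flip: M.scale_minus_left)
  qed
  then show ?thesis using len keys by (auto simp: basic_cochains_def)
qed

lemma fn_eqI:
  assumes "\<phi> \<in> basic_cochains n" "regular n f"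
    and "\<And>cs \<rho>. length cs = n \<Longrightarrow> mval actM (\<lambda>i. [:\<rho> i:]) (\<phi> cs) = f (zips cs \<rho>)"
  shows "fn \<phi> = f"
proof
  fix ss
  show "fn \<phi> ss = f ss"
  proof (cases "length ss = n")
    case True
    obtain \<rho> where "ss = zips (map fst ss) \<rho>" by (rule ex_zips)
    then show ?thesis using fn_zips[OF assms(1), of "map fst ss" \<rho>] assms(3)[of "map fst ss" \<rho>] True by simp
  next
    case False
    then show ?thesis using assms(2) regular_fn[OF assms(1)] by (simp add: regular_def)
  qed
qed

lemma regular_imp_fn:
  assumes "regular n f"
  obtains \<phi> where "\<phi> \<in> basic_cochains n" "fn \<phi> = f"
proof -
  have "\<exists>u. \<forall>\<rho>. f (zips cs \<rho>) = mval actM (\<lambda>i. [:\<rho> i:]) u" if "length cs = n" for cs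
    using assms that HM.polyf_imp_mval[of "\<lambda>\<rho>. f (zips cs \<rho>)"] by (metis regular_def)
  then obtain \<psi> where \<psi>: "\<And>cs \<rho>. length cs = n \<Longrightarrow> f (zips cs \<rho>) = mval actM (\<lambda>i. [:\<rho> i:]) (\<psi> cs)"
    by metis
  define \<phi> where "\<phi> cs = (if length cs = n then \<psi> cs else 0)" for cs
  have "\<phi> \<in> basic_cochains n"
    by (rule basicI[of _ _ f]) (use assms in \<open>simp_all add: \<phi>_def \<psi> regular_def\<close>)
  moreover from this have "fn \<phi> = f"
    by (rule fn_eqI[OF _ assms]) (simp add: \<phi>_def \<psi>)
  ultimately show ?thesis using that by blast
qed

lemma fn_inject:
  assumes "\<phi> \<in> basic_cochains n" "\<psi> \<in> basic_cochains n" "fn \<phi> = fn \<psi>"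
  shows "\<phi> = \<psi>"
proof
  fix cs
  show "\<phi> cs = \<psi> cs"
  proof (cases "length cs = n")
    case True
    show ?thesis
      by (rule HM.mval_const_eqI) (use fn_zips[OF assms(1) True] fn_zips[OF assms(2) True] assms(3) in simp)
  qed (use basicD(1)[OF assms(1)] basicD(1)[OF assms(2)] in simp)
qed

section \<open>Comparison of the conformal differential with the bar differential\<close>

lemma contract_zips:
  assumes "length cs = n + 1" "i < n"
  shows "contract i (zips cs \<rho>) = zips (take i cs @ [pc.val [:\<rho> i:] (cs ! i) (cs ! (i + 1))] @ drop (i + 2) cs)
    (\<lambda>j. if j < i then \<rho> j else if j = i then \<rho> i + \<rho> (i + 1) else \<rho> (j + 1))"
proof (rule nth_equalityI)
  fix j assume "j < length (contract i (zips cs \<rho>))"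
  then have j: "j < n" using assms by (simp add: contract_def)
  then consider "j < i" | "j = i" | "i < j" by linarith
  then show "contract i (zips cs \<rho>) ! j = zips (take i cs @ [pc.val [:\<rho> i:] (cs ! i) (cs ! (i + 1))] @ drop (i + 2) cs)
    (\<lambda>j. if j < i then \<rho> j else if j = i then \<rho> i + \<rho> (i + 1) else \<rho> (j + 1)) ! j"
  proof cases
    case 3
    then obtain k where k: "j = Suc (i + k)" using less_imp_Suc_add by blast
    then show ?thesis using assms j
      by (simp add: nth_zips contract_def nth_append smul_def)
  qed (use assms j in \<open>auto simp: nth_zips contract_def nth_append smul_def\<close>)
qed (use assms in \<open>simp add: contract_def\<close>)

text \<open>The left, inner and right terms of the differential are matched one by one with those of
  \<open>bd_explicit\<close>.\<close>

lemma mval_differential: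
  assumes \<phi>: "\<phi> \<in> basic_cochains n" and cs: "length cs = n + 1"
  shows "mval actM (\<lambda>i. [:\<rho> i:]) (differential n \<phi> cs) = bd (fn \<phi>) (zips cs \<rho>)"
proof -
  have 1: "mval actM (\<lambda>i. [:\<rho> i:]) (lin_ext actM (lprd (cs ! 0)) (lam 0) (msubst actM (\<lambda>j. lam (j + 1)) (\<phi> (tl cs))))
      = lact (zips cs \<rho> ! 0) (fn \<phi> (tl (zips cs \<rho>)))"
  proof -
    have "mval actM (\<lambda>i. [:\<rho> i:]) (lin_ext actM (lprd (cs ! 0)) (lam 0) (msubst actM (\<lambda>j. lam (j + 1)) (\<phi> (tl cs))))
        = lact (cs ! 0, \<rho> 0) (mval actM (\<lambda>i. [:\<rho> i:]) (msubst actM (\<lambda>j. lam (j + 1)) (\<phi> (tl cs))))"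
      by (rule HM.mval_lin_ext_const[OF left.add_right klinear_lact]) (simp add: lact_def pl.val_def)
    also have "mval actM (\<lambda>i. [:\<rho> i:]) (msubst actM (\<lambda>j. lam (j + 1)) (\<phi> (tl cs))) = fn \<phi> (tl (zips cs \<rho>))"
      using cs by (simp add: HM.mval_msubst tl_zips fn_zips[OF \<phi>])
    finally show ?thesis using cs by (simp add: nth_zips)
  qed
  have 2: "mval actM (\<lambda>i. [:\<rho> i:]) (mact actM ((- 1) ^ (i + 1))
         (\<Sum>m\<le>Polynomial.degree (cprd (cs ! i) (cs ! (i + 1))).
            mact actM (lam i ^ m)
              (msubst actM (\<lambda>j. if j < i then lam j else if j = i then lam i + lam (i + 1) else lam (j + 1))
                (\<phi> (take i cs @ [Polynomial.coeff (cprd (cs ! i) (cs ! (i + 1))) m] @ drop (i + 2) cs)))))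
      = alt (i + 1) (fn \<phi> (contract i (zips cs \<rho>)))" if i: "i < n" for i
  proof -
    let ?p = "cprd (cs ! i) (cs ! (i + 1))"
    define \<rho>' where "\<rho>' = (\<lambda>j. if j < i then \<rho> j else if j = i then \<rho> i + \<rho> (i + 1) else \<rho> (j + 1))"
    \<comment> \<open>Additivity of the cochain in the contracted slot moves the sum over the
      coefficients of the product inside the cochain, where it becomes the product in the
      semigroup.\<close>
    define g where "g c = mval actM (\<lambda>i. [:\<rho>' i:]) (\<phi> (take i cs @ c # drop (i + 2) cs))" for c
    have len: "length (take i cs) + length (drop (i + 2) cs) + 1 = n" using i cs by simp
    have g: "g (c + c') = g c + g c'" "g (actC [:r:] c) = actM [:r:] (g c)" for c c' r
      unfolding g_def basicD(3)[OF \<phi> len] basicD(4)[OF \<phi> len] by (simp_all add: HM.mval_add)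
    interpret g: Modules.additive g by unfold_locales (rule g)
    have \<rho>': "(\<lambda>j. hval (\<lambda>i. [:\<rho> i:]) (if j < i then lam j else if j = i then lam i + lam (i + 1) else lam (j + 1)))
        = (\<lambda>j. [:\<rho>' j:])"
      by (rule ext) (simp add: \<rho>'_def self.mval_add)
    have "fn \<phi> (contract i (zips cs \<rho>)) = g (opval (actC [:\<rho> i:]) ?p)"
      unfolding contract_zips[OF cs i] g_def \<rho>'_def[symmetric] pc.val_def[symmetric]
      using len by (subst fn_zips[OF \<phi>]) simp_all
    also have "\<dots> = (\<Sum>m\<le>Polynomial.degree ?p. actM ([:\<rho> i:] ^ m) (g (Polynomial.coeff ?p m)))"
      by (simp add: HC.opval_act g.sum const_power g(2))
    finally show ?thesis
      unfolding HM.mval_mact HM.mval_sum HM.mval_msubst \<rho>' HM.alt_act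
      by (simp add: hval_power self.mval_minus g_def)
  qed
  have 3: "mval actM (\<lambda>i. [:\<rho> i:]) (mact actM ((- 1) ^ (n + 1))
         (lin_ext actM (\<lambda>v. rprd v (cs ! n)) (- del - lam n) (\<phi> (butlast cs))))
      = alt (n + 1) (ract (fn \<phi> (butlast (zips cs \<rho>))) (zips cs \<rho> ! n))"
  proof -
    have "mval actM (\<lambda>i. [:\<rho> i:]) (lin_ext actM (\<lambda>v. rprd v (cs ! n)) (- del - lam n) (\<phi> (butlast cs)))
        = ract (mval actM (\<lambda>i. [:\<rho> i:]) (\<phi> (butlast cs))) (cs ! n, \<rho> n)"
      by (rule HM.mval_lin_ext_const[OF right.add_left klinear_ract])
         (simp add: ract_def pr.val_def self.mval_minus self.mval_diff)
    then show ?thesis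
      using cs by (simp add: HM.mval_mact HM.alt_act hval_power self.mval_minus nth_zips butlast_zips fn_zips[OF \<phi>])
  qed
  show ?thesis
    unfolding differential_def using cs 1 2 3
    by (simp add: bd_explicit[of _ n] HM.mval_add HM.mval_sum)
qed

lemma differential_basic:
  assumes "\<phi> \<in> basic_cochains n"
  shows "differential n \<phi> \<in> basic_cochains (n + 1)"
proof (rule basicI)
  show "multilin (bd (fn \<phi>))" using regular_fn[OF assms] by (simp add: regular_def multilin_bd)
qed (simp_all add: mval_differential[OF assms], simp add: differential_def)

lemma regular_bd:
  assumes "regular n f"
  shows "regular (n + 1) (bd f)"
proof -
  obtain \<phi> where \<phi>: "\<phi> \<in> basic_cochains n" "fn \<phi> = f" by (rule regular_imp_fn[OF assms])
  have "HM.polyf (\<lambda>\<rho>. bd f (zips cs \<rho>))" if "length cs = n + 1" for cs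
    using mval_differential[OF \<phi>(1) that] HM.polyf_mval[of "differential n \<phi> cs"] by (simp add: \<phi>(2))
  then show ?thesis
    using assms by (simp add: regular_def multilin_bd bd_length[of n f])
qed

lemma fn_differential:
  assumes "\<phi> \<in> basic_cochains n"
  shows "fn (differential n \<phi>) = bd (fn \<phi>)"
  by (rule fn_eqI[OF differential_basic[OF assms] regular_bd[OF regular_fn[OF assms]]])
     (rule mval_differential[OF assms])

end

section \<open>The reduced complex\<close>

text \<open>Applied to the group of cocycles once these are known to coincide with the
  coboundaries.\<close>

lemma (in group) trivial_group_factor_self: "trivial_group (G Mod carrier G)"
proof -
  have "carrier G \<lhd> G"
    by (rule normal_invI[OF subgroup_self]) simp
  then have "group (G Mod carrier G)"
    by (rule normal.factorgroup_is_group)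
  moreover have "carrier (G Mod carrier G) = {carrier G}"
    unfolding carrier_FactGroup using coset_join2[OF _ subgroup_self] one_closed by auto
  ultimately show ?thesis by (simp add: trivial_group_def)
qed

section \<open>The operator \<open>\<partial> + \<lambda>\<^sub>1 + ... + \<lambda>\<^sub>n\<close>
  on functions\<close>

context conformal_bimodule_0
begin

definition shift_fn :: "(('c \<times> 'k) list \<Rightarrow> 'm) \<Rightarrow> ('c \<times> 'k) list \<Rightarrow> 'm" where
  "shift_fn f ss = actM [:sum_list (map snd ss), 1:] (f ss)"

text \<open>The extra scalar \<open>x\<close> collects the scalars of arguments already split off,
  as the recursion of \<open>ra\<close> requires.\<close>

lemma ra_shift:
  "ra (\<lambda>r. actM [:x + sum_list (map snd r), 1:] (f r)) s ss = actM [:x + snd s + sum_list (map snd ss), 1:] (ra f s ss)"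
proof (induction ss arbitrary: f s x)
  case Nil
  have "ract (actM [:x, 1:] u) s = actM [:x + snd s, 1:] (ract u s)" for u
    by (simp add: ract_def pr.val_left pcompose_pCons)
  then show ?case by simp
next
  case (Cons t ts)
  show ?case
    using Cons.IH[of "x + snd s" "\<lambda>r. f (s # r)" t]
    by (simp add: add.assoc M.scale_right_diff_distrib) (simp add: smul_def add.assoc)
qed

lemma bd_shift: "bd (shift_fn f) = shift_fn (bd f)"
proof
  fix ss
  show "bd (shift_fn f) ss = shift_fn (bd f) ss"
  proof (cases ss)
    case (Cons s r)
    have "lact s (actM [:x, 1:] u) = actM [:snd s + x, 1:] (lact s u)" for x u
      by (simp add: lact_def pl.val_right pcompose_pCons add.commute)
    then show ?thesis
      using ra_shift[of 0 f s r] by (simp add: Cons shift_fn_def[abs_def] M.scale_right_diff_distrib)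
  qed (simp add: shift_fn_def)
qed

lemma multilin_shift: "multilin f \<Longrightarrow> multilin (shift_fn f)"
  unfolding multilin_def shift_fn_def
  by (auto intro!: flin_comp[OF _ HM.klinear_act])

lemma sum_list_zips: "sum_list (map snd (zips cs \<rho>)) = (\<Sum>i<length cs. \<rho> i)"
  by (simp add: zips_def comp_def interv_sum_list_conv_sum_set_nat atLeast0LessThan)

lemma mval_del_shift:
  assumes "\<phi> \<in> basic_cochains n" "length cs = n"
  shows "mval actM (\<lambda>i. [:\<rho> i:]) (del_shift n \<phi> cs) = shift_fn (fn \<phi>) (zips cs \<rho>)"
proof -
  have "(\<Sum>i<n. [:\<rho> i:]) = [:\<Sum>i<n. \<rho> i:]" by (induction n) simp_all
  then show ?thesis
    using assms(2) by (simp add: del_shift_def HM.mval_mact self.mval_add self.mval_sum shift_fn_def fn_zips[OF assms] sum_list_zips)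
qed

lemma del_shift_basic:
  assumes "\<phi> \<in> basic_cochains n"
  shows "del_shift n \<phi> \<in> basic_cochains n"
proof (rule basicI)
  show "multilin (shift_fn (fn \<phi>))" using regular_fn[OF assms] by (simp add: regular_def multilin_shift)
  show "del_shift n \<phi> cs = 0" if "length cs \<noteq> n" for cs
    using basicD(1)[OF assms that] by (simp add: del_shift_def mact_def)
qed (rule mval_del_shift[OF assms])

lemma fn_del_shift:
  assumes "\<phi> \<in> basic_cochains n"
  shows "fn (del_shift n \<phi>) = shift_fn (fn \<phi>)"
proof
  fix ss
  show "fn (del_shift n \<phi>) ss = shift_fn (fn \<phi>) ss"
  proof (cases "length ss = n")
    case True
    obtain \<rho> where \<rho>: "ss = zips (map fst ss) \<rho>" by (rule ex_zips)
    then show ?thesis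
      using fn_zips[OF del_shift_basic[OF assms], of "map fst ss" \<rho>] mval_del_shift[OF assms, of "map fst ss" \<rho>] True by simp
  next
    case False
    then show ?thesis
      using regular_fn[OF assms] regular_fn[OF del_shift_basic[OF assms]] by (simp add: regular_def shift_fn_def)
  qed
qed

lemma fn_add: "fn (\<lambda>as. \<phi> as + \<psi> as) = (\<lambda>ss. fn \<phi> ss + fn \<psi> ss)"
  by (simp add: fn_def HM.mval_add fun_eq_iff)

lemma fn_minus: "fn (\<lambda>as. - \<phi> as) = (\<lambda>ss. - fn \<phi> ss)"
  by (simp add: fn_def HM.mval_minus fun_eq_iff)

lemma fn_zero: "fn (\<lambda>as. 0) = (\<lambda>ss. 0)"
  by (simp add: fn_def fun_eq_iff)

lemma basic_zero: "(\<lambda>as. 0) \<in> basic_cochains n"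
  by (rule basicI[of _ _ "\<lambda>ss. 0"]) (simp_all add: multilin_def flin_zero)

lemma basic_add:
  assumes "\<phi> \<in> basic_cochains n" "\<psi> \<in> basic_cochains n"
  shows "(\<lambda>as. \<phi> as + \<psi> as) \<in> basic_cochains n"
  by (rule basicI[of _ _ "\<lambda>ss. fn \<phi> ss + fn \<psi> ss"])
     (use regular_fn[OF assms(1)] regular_fn[OF assms(2)] in
       \<open>simp_all add: HM.mval_add fn_zips[OF assms(1)] fn_zips[OF assms(2)] regular_def multilin_add
          basicD(1)[OF assms(1)] basicD(1)[OF assms(2)]\<close>)

lemma basic_minus:
  assumes "\<phi> \<in> basic_cochains n"
  shows "(\<lambda>as. - \<phi> as) \<in> basic_cochains n"
proof (rule basicI[of _ _ "\<lambda>ss. - fn \<phi> ss"])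
  show "multilin (\<lambda>ss. - fn \<phi> ss)"
    using regular_fn[OF assms] multilin_comp[of "fn \<phi>" uminus] by (simp add: regular_def HM.klinear_def)
qed (simp_all add: HM.mval_minus fn_zips[OF assms] basicD(1)[OF assms])

lemma differential_add:
  assumes "\<phi> \<in> basic_cochains n" "\<psi> \<in> basic_cochains n"
  shows "differential n (\<lambda>as. \<phi> as + \<psi> as) = (\<lambda>as. differential n \<phi> as + differential n \<psi> as)"
proof (rule fn_inject[of _ "n + 1"])
  show "fn (differential n (\<lambda>as. \<phi> as + \<psi> as)) = fn (\<lambda>as. differential n \<phi> as + differential n \<psi> as)"
    using assms by (simp add: fn_differential basic_add fn_add bd_add fun_eq_iff)
qed (intro differential_basic basic_add assms)+

lemma del_shift_add:
  assumes "\<phi> \<in> basic_cochains n" "\<psi> \<in> basic_cochains n"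
  shows "del_shift n (\<lambda>as. \<phi> as + \<psi> as) = (\<lambda>as. del_shift n \<phi> as + del_shift n \<psi> as)"
  by (rule fn_inject[OF del_shift_basic basic_add])
     (use assms in \<open>simp_all add: basic_add del_shift_basic fn_del_shift fn_add shift_fn_def M.scale_right_distrib fun_eq_iff\<close>)

lemma differential_del_shift:
  assumes "\<phi> \<in> basic_cochains n"
  shows "differential n (del_shift n \<phi>) = del_shift (n + 1) (differential n \<phi>)"
  by (rule fn_inject[of _ "n + 1"])
     (use differential_basic del_shift_basic assms in \<open>simp_all add: del_shift_basic fn_differential fn_del_shift bd_shift\<close>)

lemma differential_differential:
  assumes "\<phi> \<in> basic_cochains n"
  shows "differential (n + 1) (differential n \<phi>) = (\<lambda>as. 0)"
proof (rule fn_inject[of _ "n + 1 + 1"])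
  show "fn (differential (n + 1) (differential n \<phi>)) = fn (\<lambda>as. 0)"
    by (simp only: fn_differential[OF differential_basic[OF assms]] fn_differential[OF assms] fn_zero)
       (simp add: bd_bd fun_eq_iff)
qed (simp_all only: assms differential_basic basic_zero)

text \<open>A polynomial annihilated by \<open>\<partial> + c + \<lambda>\<close> vanishes, as one sees from its leading coefficient in \<open>\<lambda>\<close>.\<close>

lemma shift_fn_eq_0:
  assumes f: "regular (Suc n) f" and z: "\<And>ss. shift_fn f ss = 0"
  shows "f ss = 0"
proof (cases "length ss = Suc n")
  case True
  obtain \<rho> where \<rho>: "ss = zips (map fst ss) \<rho>" by (rule ex_zips)
  obtain c cs where cs: "map fst ss = c # cs" using True by (metis length_Suc_conv list.simps(9))
  define w where "w x = f ((c, x) # zips cs (\<lambda>i. \<rho> (Suc i)))" for x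
  define y where "y = sum_list (map snd (zips cs (\<lambda>i. \<rho> (Suc i))))"
  have "length (c # cs) = Suc n" using True cs by (metis length_map)
  then have "HM.polyf (\<lambda>\<rho>. f (zips (c # cs) \<rho>))"
    using f by (auto simp: regular_def)
  from HM.polyf_slice[OF this, of "\<lambda>i. \<rho> (Suc i)"]
  obtain p where p: "HM.poly1 w p" unfolding w_def[abs_def] by (auto simp: zips_Cons)
  have "HM.poly1 (\<lambda>x. actM [:y, 1:] (w x) + actM [:x:] (w x)) (map_poly (actM [:y, 1:]) p + pCons 0 p)"
    by (intro HM.poly1_add HM.poly1_var HM.poly1_comp HM.klinear_act p)
  moreover have "actM [:y, 1:] (w x) + actM [:x:] (w x) = 0" for x
    using z[of "(c, x) # zips cs (\<lambda>i. \<rho> (Suc i))"]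
    by (simp add: shift_fn_def w_def y_def add.commute flip: M.scale_left_distrib)
  ultimately have "map_poly (actM [:y, 1:]) p + pCons 0 p = 0"
    using HM.poly1_unique[OF _ HM.poly1_const[of 0]] by (simp add: HM.poly1_const)
  from arg_cong[OF this, of "\<lambda>q. Polynomial.coeff q (Suc (Polynomial.degree p))"]
  have "p = 0" by (simp add: coeff_map_poly coeff_eq_0)
  then have "w (\<rho> 0) = 0" using p by (simp add: HM.poly1_def opval_def)
  then show ?thesis using \<rho> by (simp add: cs zips_Cons w_def)
qed (use f in \<open>simp add: regular_def\<close>)

section \<open>Cochain groups modulo shifts\<close>

lemma cochain_comm_group: "comm_group (cochain_group n)"
  by (rule comm_groupI)
     (auto simp: cochain_group_def basic_zero basic_add add_ac fun_eq_iff intro!: bexI[OF _ basic_minus])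

lemma carrier_cochain_group [simp]: "carrier (cochain_group n) = basic_cochains n"
  and mult_cochain_group [simp]: "monoid.mult (cochain_group n) \<phi> \<psi> = (\<lambda>as. \<phi> as + \<psi> as)"
  and one_cochain_group [simp]: "one (cochain_group n) = (\<lambda>as. 0)"
  by (simp_all add: cochain_group_def)

abbreviation shifts :: "nat \<Rightarrow> ('c list \<Rightarrow> 'm mpol) set" where
  "shifts n \<equiv> del_shift n ` basic_cochains n"

lemma group_hom_del_shift: "group_hom (cochain_group n) (cochain_group n) (del_shift n)"
  using cochain_comm_group[of n] by (intro group_hom.intro group_hom_axioms.intro)
    (auto simp: comm_group_def hom_def del_shift_basic del_shift_add)

lemma shifts_subgroup: "subgroup (shifts n) (cochain_group n)"
  using group_hom.img_is_subgroup[OF group_hom_del_shift] by simp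

lemma shifts_normal: "shifts n \<lhd> cochain_group n"
  using comm_group.normal_iff_subgroup[OF cochain_comm_group] shifts_subgroup by blast

abbreviation coset :: "nat \<Rightarrow> ('c list \<Rightarrow> 'm mpol) \<Rightarrow> ('c list \<Rightarrow> 'm mpol) set" where
  "coset n \<phi> \<equiv> shifts n #>\<^bsub>cochain_group n\<^esub> \<phi>"

lemma carrier_reduced: "carrier (reduced_group n) = coset n ` basic_cochains n"
  by (simp add: reduced_group_def carrier_FactGroup)

lemma one_reduced: "one (reduced_group n) = shifts n"
  by (simp add: reduced_group_def)

lemma coset_mult:
  assumes "\<phi> \<in> basic_cochains n" "\<psi> \<in> basic_cochains n"
  shows "monoid.mult (reduced_group n) (coset n \<phi>) (coset n \<psi>) = coset n (\<lambda>as. \<phi> as + \<psi> as)"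
  using normal.rcos_sum[OF shifts_normal, of \<phi> n \<psi>] assms by (simp add: reduced_group_def)

lemma coset_eq_shifts_iff:
  assumes "\<phi> \<in> basic_cochains n"
  shows "coset n \<phi> = shifts n \<longleftrightarrow> \<phi> \<in> shifts n"
proof -
  interpret comm_group "cochain_group n" by (rule cochain_comm_group)
  show ?thesis
    using coset_join1[OF _ _ shifts_subgroup, of \<phi>] coset_join2[OF _ shifts_subgroup, of \<phi>] assms
      subgroup.subset[OF shifts_subgroup] by auto
qed

text \<open>The differential commutes with shifts and so maps a coset into a single coset; the
  product with all shifts of degree \<open>n + 1\<close> then fills it.\<close>

lemma reduced_differential_coset:
  assumes "\<phi> \<in> basic_cochains n"
  shows "reduced_differential n (coset n \<phi>) = coset (n + 1) (differential n \<phi>)"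
proof -
  interpret comm_group "cochain_group (n + 1)" by (rule cochain_comm_group)
  have d: "differential n (\<lambda>as. del_shift n \<eta> as + \<phi> as)
      = (\<lambda>as. del_shift (n + 1) (differential n \<eta>) as + differential n \<phi> as)" if "\<eta> \<in> basic_cochains n" for \<eta>
    using that assms by (simp add: differential_add del_shift_basic differential_del_shift)
  have "(\<lambda>as. del_shift (n + 1) \<zeta> as + (del_shift (n + 1) (differential n \<eta>) as + differential n \<phi> as))
      \<in> coset (n + 1) (differential n \<phi>)"
    if "\<zeta> \<in> basic_cochains (n + 1)" "\<eta> \<in> basic_cochains n" for \<zeta> \<eta>
  proof -
    have "(\<lambda>as. del_shift (n + 1) \<zeta> as + del_shift (n + 1) (differential n \<eta>) as) \<in> shifts (n + 1)"
      unfolding del_shift_add[OF that(1) differential_basic[OF that(2)], symmetric]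
      by (intro imageI basic_add differential_basic that)
    from rcosI[OF this, of "differential n \<phi>"] show ?thesis
      using subgroup.subset[OF shifts_subgroup] differential_basic[OF assms] by (simp add: add.assoc)
  qed
  moreover have "(\<lambda>as. del_shift (n + 1) \<zeta> as + differential n \<phi> as) \<in> reduced_differential n (coset n \<phi>)"
    if "\<zeta> \<in> basic_cochains (n + 1)" for \<zeta>
  proof -
    have "\<phi> \<in> coset n \<phi>"
      using group.rcos_self[OF comm_group.axioms(2)[OF cochain_comm_group] _ shifts_subgroup] assms by simp
    then show ?thesis using that by (auto simp: reduced_differential_def set_mult_def)
  qed
  ultimately show ?thesis
    by (auto simp: reduced_differential_def set_mult_def r_coset_def d simp del: add_Suc_right)
qed

lemma group_hom_reduced_differential:
  "group_hom (reduced_group n) (reduced_group (n + 1)) (reduced_differential n)"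
proof (intro group_hom.intro group_hom_axioms.intro)
  show "group (reduced_group n)" "group (reduced_group (n + 1))"
    unfolding reduced_group_def by (rule normal.factorgroup_is_group[OF shifts_normal])+
  show "reduced_differential n \<in> hom (reduced_group n) (reduced_group (n + 1))"
  proof (rule homI)
    fix X Y assume "X \<in> carrier (reduced_group n)" "Y \<in> carrier (reduced_group n)"
    then obtain \<phi> \<psi> where \<phi>: "\<phi> \<in> basic_cochains n" "X = coset n \<phi>" and \<psi>: "\<psi> \<in> basic_cochains n" "Y = coset n \<psi>"
      by (auto simp: carrier_reduced)
    show "reduced_differential n X \<in> carrier (reduced_group (n + 1))"
      unfolding \<phi>(2) reduced_differential_coset[OF \<phi>(1)] carrier_reduced by (intro imageI differential_basic \<phi>)
    show "reduced_differential n (monoid.mult (reduced_group n) X Y)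
        = monoid.mult (reduced_group (n + 1)) (reduced_differential n X) (reduced_differential n Y)"
      unfolding \<phi>(2) \<psi>(2) coset_mult[OF \<phi>(1) \<psi>(1)] reduced_differential_coset[OF \<phi>(1)] reduced_differential_coset[OF \<psi>(1)]
        reduced_differential_coset[OF basic_add[OF \<phi>(1) \<psi>(1)]] coset_mult[OF differential_basic[OF \<phi>(1)] differential_basic[OF \<psi>(1)]]
        differential_add[OF \<phi>(1) \<psi>(1)] ..
  qed
qed

text \<open>Basic vanishing is used twice. For a reduced cocycle \<open>\<phi>\<close>,
  \<open>d\<phi>\<close> is the shift of some \<open>\<xi>\<close>. Injectivity of the shift gives
  \<open>d\<xi> = 0\<close>, so \<open>\<xi> = d\<eta>\<close> by vanishing in degree
  \<open>n + 1\<close>. Subtracting the shift of \<open>\<eta>\<close> makes \<open>\<phi>\<close> a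
  basic cocycle, to which vanishing in degree \<open>n\<close> applies.\<close>

theorem trivial_cohomology_if_basic:
  assumes "n \<ge> 2"
    and basic: "\<And>m f. m \<ge> 2 \<Longrightarrow> regular m f \<Longrightarrow> (\<And>ss. bd f ss = 0) \<Longrightarrow> \<exists>g. regular (m - 1) g \<and> (\<forall>ss. bd g ss = f ss)"
  shows "trivial_group (cohomology_group n)"
proof -
  have ex: "\<exists>\<psi>\<in>basic_cochains m. differential m \<psi> = \<phi>"
    if \<phi>: "\<phi> \<in> basic_cochains (m + 1)" "differential (m + 1) \<phi> = (\<lambda>as. 0)" "m \<ge> 1" for m \<phi>
  proof -
    have "bd (fn \<phi>) ss = 0" for ss
      using fn_differential[OF \<phi>(1)] \<phi>(2) by (metis fn_zero)
    then obtain g where g: "regular m g" "\<And>ss. bd g ss = fn \<phi> ss"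
      using basic[OF _ regular_fn[OF \<phi>(1)]] \<phi>(3) by auto
    obtain \<psi> where \<psi>: "\<psi> \<in> basic_cochains m" "fn \<psi> = g" by (rule regular_imp_fn[OF g(1)])
    have "differential m \<psi> = \<phi>"
      by (rule fn_inject[OF differential_basic[OF \<psi>(1)] \<phi>(1)]) (simp add: fn_differential[OF \<psi>(1)] \<psi>(2) g(2) fun_eq_iff)
    then show ?thesis using \<psi>(1) by blast
  qed
  obtain m where m: "n = m + 1" "m \<ge> 1" using assms(1) by (intro that[of "n - 1"]) auto
  have coc: "cocycles n = {coset n \<phi> | \<phi>. \<phi> \<in> basic_cochains n \<and> differential n \<phi> \<in> shifts (n + 1)}"
  proof -
    have "reduced_differential n (coset n \<phi>) = shifts (n + 1) \<longleftrightarrow> differential n \<phi> \<in> shifts (n + 1)"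
      if "\<phi> \<in> basic_cochains n" for \<phi>
      by (simp only: reduced_differential_coset[OF that] coset_eq_shifts_iff[OF differential_basic[OF that]])
    then show ?thesis
      unfolding cocycles_def kernel_def carrier_reduced one_reduced by blast
  qed
  have cob: "coboundaries n = {coset n (differential m \<psi>) | \<psi>. \<psi> \<in> basic_cochains m}"
    using m by (auto simp: coboundaries_def carrier_reduced reduced_differential_coset image_iff)
  have "cocycles n = coboundaries n"
  proof
    show "coboundaries n \<subseteq> cocycles n"
    proof
      fix X assume "X \<in> coboundaries n"
      then obtain \<psi> where \<psi>: "\<psi> \<in> basic_cochains m" "X = coset n (differential m \<psi>)" by (auto simp: cob)
      have "differential n (differential m \<psi>) \<in> shifts (n + 1)"
        using subgroup.one_closed[OF shifts_subgroup[of "n + 1"]] unfolding m differential_differential[OF \<psi>(1)] one_cochain_group .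
      moreover have "differential m \<psi> \<in> basic_cochains n" unfolding m by (rule differential_basic[OF \<psi>(1)])
      ultimately show "X \<in> cocycles n" unfolding coc \<psi>(2) by blast
    qed
    show "cocycles n \<subseteq> coboundaries n"
    proof
      fix X assume "X \<in> cocycles n"
      then obtain \<phi> \<xi> where \<phi>: "\<phi> \<in> basic_cochains n" "X = coset n \<phi>"
        and \<xi>: "\<xi> \<in> basic_cochains (n + 1)" "differential n \<phi> = del_shift (n + 1) \<xi>"
        by (auto simp: coc)
      \<comment> \<open>The shift of \<open>d\<xi>\<close> is \<open>d(d\<phi>) = 0\<close>.\<close>
      have "shift_fn (bd (fn \<xi>)) ss = 0" for ss
      proof -
        have "shift_fn (bd (fn \<xi>)) = bd (fn (differential n \<phi>))"
          by (simp only: bd_shift[symmetric] fn_del_shift[OF \<xi>(1), symmetric] \<xi>(2))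
        then show ?thesis by (simp add: fn_differential[OF \<phi>(1)] bd_bd)
      qed
      then have "bd (fn \<xi>) ss = 0" for ss
        using shift_fn_eq_0[of "n + 1" "bd (fn \<xi>)"] regular_bd[OF regular_fn[OF \<xi>(1)]] by simp
      then have "differential (n + 1) \<xi> = (\<lambda>as. 0)"
        by (intro fn_inject[OF differential_basic[OF \<xi>(1)] basic_zero]) (simp only: fn_differential[OF \<xi>(1)] fn_zero fun_eq_iff, simp)
      then obtain \<eta> where \<eta>: "\<eta> \<in> basic_cochains n" "differential n \<eta> = \<xi>"
        using ex[OF \<xi>(1)] assms(1) by auto
      \<comment> \<open>The correction is a shift, so the coset stays the same.\<close>
      define \<phi>' where "\<phi>' = (\<lambda>as. \<phi> as + - del_shift n \<eta> as)"
      have sh: "(\<lambda>as. - del_shift n \<eta> as) \<in> basic_cochains n"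
        by (intro basic_minus del_shift_basic \<eta>)
      have \<phi>': "\<phi>' \<in> basic_cochains n"
        unfolding \<phi>'_def by (intro basic_add \<phi> sh)
      have "fn \<phi>' = (\<lambda>ss. fn \<phi> ss - shift_fn (fn \<eta>) ss)"
        unfolding \<phi>'_def fn_add fn_minus fn_del_shift[OF \<eta>(1)] by simp
      then have "bd (fn \<phi>') ss = bd (fn \<phi>) ss - shift_fn (bd (fn \<eta>)) ss" for ss
        by (simp only: bd_diff bd_shift)
      moreover have "bd (fn \<phi>) = shift_fn (bd (fn \<eta>))"
        by (simp only: fn_differential[OF \<phi>(1), symmetric] fn_differential[OF \<eta>(1), symmetric] \<xi>(2) fn_del_shift[OF \<xi>(1)] \<eta>(2))
      ultimately have "differential n \<phi>' = (\<lambda>as. 0)"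
        by (intro fn_inject[OF differential_basic[OF \<phi>'] basic_zero]) (simp only: fn_differential[OF \<phi>'] fn_zero fun_eq_iff, simp)
      then obtain \<psi> where \<psi>: "\<psi> \<in> basic_cochains m" "differential m \<psi> = \<phi>'"
        using ex[of \<phi>' m] \<phi>' m by auto
      interpret comm_group "cochain_group n" by (rule cochain_comm_group)
      have "\<phi> \<in> coset n \<phi>'"
        using \<eta>(1) by (auto simp: r_coset_def \<phi>'_def fun_eq_iff intro!: bexI[of _ \<eta>])
      then have "coset n \<phi> = coset n \<phi>'"
        using repr_independence[of \<phi> "shifts n" \<phi>'] shifts_subgroup \<phi>' by simp
      then show "X \<in> coboundaries n" using \<phi>(2) \<psi> by (auto simp: cob)
    qed
  qed
  moreover have "group ((reduced_group n)\<lparr>carrier := cocycles n\<rparr>)"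
    unfolding cocycles_def
    using group_hom.subgroup_kernel[OF group_hom_reduced_differential[of n]] group_hom_reduced_differential[of n]
    by (metis group.subgroup_imp_group group_hom.axioms(1))
  ultimately show ?thesis
    using group.trivial_group_factor_self[of "(reduced_group n)\<lparr>carrier := cocycles n\<rparr>"]
    by (simp add: cohomology_group_def)
qed

end

section \<open>Closure properties of polynomial and regular functions\<close>

context conformal_bimodule_0
begin

text \<open>The factor \<open>a\<close> makes one statement cover the scalars
  \<open>\<lambda>\<close> and \<open>-\<lambda>\<close>; both occur below.\<close>

lemma polyf_lact:
  assumes "HM.polyf f"
  shows "HM.polyf (\<lambda>\<rho>. lact (c, a * \<rho> i) (f \<rho>))"
  using assms
proof induction
  case (polyf_const u)
  have "HM.polyf (\<lambda>\<rho>. opval (actM [:a * \<rho> i:]) p)" for p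
  proof (induction p)
    case (pCons b p)
    have "opval (actM [:a * \<rho> i:]) (pCons b p) = b + actM [:a:] (actM [:\<rho> i:] (opval (actM [:a * \<rho> i:]) p))" for \<rho>
      by (simp add: endo.opval_pCons[OF HM.endo_act] mult.commute)
    then show ?case
      by (simp only:) (intro HM.polyf_add HM.polyf_const HM.polyf_comp[OF _ HM.klinear_act] HM.polyf_var pCons.IH)
  qed (simp add: opval_def HM.polyf_const)
  then show ?case by (simp add: lact_def pl.val_def)
next
  case (polyf_add f g)
  then show ?case by (simp add: L_add HM.polyf_add)
next
  case (polyf_var f j)
  then show ?case by (simp add: HM.klinearD(2)[OF klinear_lact] HM.polyf_var)
qed

lemma regular_Cons:
  assumes "regular (Suc n) f"
  shows "regular n (\<lambda>r. f (s # r))"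
proof -
  have "HM.polyf (\<lambda>\<rho>. f (s # zips cs \<rho>))" if "length cs = n" for cs
  proof -
    have "HM.polyf (\<lambda>\<rho>. f (zips (fst s # cs) \<rho>))" using assms that by (simp add: regular_def)
    then have "HM.polyf (\<lambda>\<rho>. f (zips (fst s # cs) (case_nat (snd s) \<rho>)))"
      by (rule HM.polyf_subst) (auto split: nat.split)
    then show ?thesis by (simp add: zips_Cons)
  qed
  then show ?thesis using assms by (simp add: regular_def multilin_Cons)
qed

lemma regular_comp:
  assumes "regular n f" "HM.klinear T"
  shows "regular n (\<lambda>r. T (f r))"
  using assms by (auto simp: regular_def multilin_comp HM.klinearD intro: HM.polyf_comp)

lemma regular_diff: "regular n f \<Longrightarrow> regular n g \<Longrightarrow> regular n (\<lambda>r. f r - g r)"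
  by (simp add: regular_def multilin_diff HM.polyf_diff)

lemma regular_add: "regular n f \<Longrightarrow> regular n g \<Longrightarrow> regular n (\<lambda>r. f r + g r)"
  by (simp add: regular_def multilin_add HM.polyf_add)

text \<open>The operator commutes with the right action, and the other terms of \<open>ra\<close>
  are just values of the cochain. Polynomiality is proved along with the equation, since the rule
  for differences presupposes it.\<close>

lemma ra_subst_op:
  assumes T: "HM.klinear T" "\<And>u s. ract (T u) s = T (ract u s)"
    and "\<And>r. \<exists>p. HM.poly1 (\<lambda>y. w y r) p"
  shows "(\<exists>p. HM.poly1 (\<lambda>y. ra (w y) s r) p)
    \<and> HM.subst_op T (\<lambda>y. ra (w y) s r) = ra (\<lambda>r. HM.subst_op T (\<lambda>y. w y r)) s r"
  using assms(3)
proof (induction r arbitrary: w s)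
  case Nil
  obtain p where p: "HM.poly1 (\<lambda>y. w y []) p" using Nil by blast
  have "HM.subst_op T (\<lambda>y. ract (w y []) s) = ract (HM.subst_op T (\<lambda>y. w y [])) s"
    by (rule HM.subst_op_comp[OF T(1) klinear_ract T(2)[of _ s] Nil[of "[]"]])
  then show ?case using HM.poly1_comp[OF p klinear_ract[of s]] by auto
next
  case (Cons t ts)
  have IH: "\<exists>p. HM.poly1 (\<lambda>y. ra (\<lambda>r. w y (s # r)) t ts) p"
    "HM.subst_op T (\<lambda>y. ra (\<lambda>r. w y (s # r)) t ts) = ra (\<lambda>r. HM.subst_op T (\<lambda>y. w y (s # r))) t ts"
    using Cons.IH[of "\<lambda>y r. w y (s # r)" t] Cons.prems by blast+
  have m: "HM.klinear uminus" by (simp add: HM.klinear_def)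
  have "\<exists>p. HM.poly1 (\<lambda>y. w y (smul s t # ts) - ra (\<lambda>r. w y (s # r)) t ts) p"
  proof -
    obtain p q where "HM.poly1 (\<lambda>y. w y (smul s t # ts)) p" "HM.poly1 (\<lambda>y. ra (\<lambda>r. w y (s # r)) t ts) q"
      using Cons.prems IH(1) by blast
    from HM.poly1_add[OF this(1) HM.poly1_comp[OF this(2) m]] show ?thesis by auto
  qed
  then show ?case
    by (simp add: HM.subst_op_diff[OF T(1) Cons.prems IH(1)] IH(2))
qed

end


section \<open>Products in \<open>Cend\<^sub>k\<close>\<close>

lemma pCons_0_add: "pCons 0 (p + q) = pCons 0 p + pCons 0 q"
  by simp

definition sub2 :: "'k::field poly poly \<Rightarrow> 'k poly poly \<Rightarrow> 'k poly poly \<Rightarrow> 'k poly poly" where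
  "sub2 a b = ev (ev (\<lambda>r. [:[:r:]:]) a) b"

lemma is_ring_hom_c2: "is_ring_hom (\<lambda>r. [:[:r:]:])"
  by (rule is_ring_hom_comp[OF is_ring_hom_pconst is_ring_hom_pconst])

lemma sub2_pCons: "sub2 a b (pCons 0 f) = b * sub2 a b f"
  unfolding sub2_def using ev_pCons[OF is_ring_hom_ev[OF is_ring_hom_c2], of a b 0 f] by (simp add: ev_0)

lemma sub2_const [simp]: "sub2 a b [:[:r:]:] = [:[:r:]:]"
  unfolding sub2_def by (simp add: ev_const[OF is_ring_hom_ev[OF is_ring_hom_c2]] ev_const[OF is_ring_hom_c2])

lemma sub2_id: "sub2 [:[:0, 1:]:] [:0, 1:] f = f"
proof -
  have "ev (\<lambda>r. [:[:r:]:]) [:[:0, 1:]:] h = [:h:]" for h :: "'a poly"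
    by (rule is_ring_hom_poly_eqI[OF is_ring_hom_ev[OF is_ring_hom_c2] is_ring_hom_pconst])
       (simp_all add: ev_const[OF is_ring_hom_c2] ev_X[OF is_ring_hom_c2])
  then have "ev (\<lambda>r. [:[:r:]:]) [:[:0, 1:]:] = (\<lambda>h. [:h:] :: 'a poly poly)" by (rule ext)
  moreover have "ev (\<lambda>h. [:h:]) [:0, 1:] f = f"
  proof (rule is_ring_hom_poly_eqI[where g = "\<lambda>f. f"])
    show "is_ring_hom (ev (\<lambda>h. [:h:]) [:0, 1:] :: 'a poly poly \<Rightarrow> _)"
      by (rule is_ring_hom_ev[OF is_ring_hom_pconst])
    show "is_ring_hom (\<lambda>f. f :: 'a poly poly)" by (simp add: is_ring_hom_def)
  qed (rule ev_const[OF is_ring_hom_pconst] ev_X[OF is_ring_hom_pconst])+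
  ultimately show ?thesis by (simp only: sub2_def)
qed

lemma poly_poly_prd:
  "poly (poly_prd f g) [:[:x:]:] = sub2 [:[:- x:]:] [:0, 1:] f * sub2 [:[:x, 1:]:] [:[:x:], 1:] g"
proof -
  let ?T = "\<lambda>p. poly p [:[:x:]:]"
  have T: "is_ring_hom ?T" by (simp add: is_ring_hom_def)
  have e: "?T (eval2 h a b) = sub2 (?T a) (?T b) h" for h a b
    unfolding eval2_ev sub2_def is_ring_hom_ev_comp[OF T is_ring_hom_ev[OF is_ring_hom_c3]]
      is_ring_hom_ev_comp[OF T is_ring_hom_c3] by simp
  show ?thesis unfolding poly_prd_def Let_def by (simp add: e)
qed

section \<open>Constant matrices, multiplication by \<open>x\<close>, and matrix units\<close>

definition cend_const :: "'k::field ^ 'n ^ 'n \<Rightarrow> ('k, 'n::finite) cend" where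
  "cend_const B = (\<chi> i j. [:[:B $ i $ j:]:])"

definition cend_x :: "('k::field, 'n::finite) cend \<Rightarrow> ('k, 'n) cend" where
  "cend_x A = (\<chi> i j. pCons 0 (A $ i $ j))"

text \<open>Removes the constant term in \<open>x\<close> and divides by \<open>x\<close>: a
  nilpotent left inverse of \<open>cend_x\<close> that drives all inductions over matrices.\<close>

definition cend_shift :: "('k::field, 'n::finite) cend \<Rightarrow> ('k, 'n) cend" where
  "cend_shift A = (\<chi> i j. poly_shift 1 (A $ i $ j))"

definition mat_unit :: "'n \<Rightarrow> 'n \<Rightarrow> 'k::field ^ 'n ^ 'n::finite" where
  "mat_unit i j = (\<chi> a b. if a = i \<and> b = j then 1 else 0)"

lemma cend_shift_add: "cend_shift (A + B) = cend_shift A + cend_shift B"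
  by (simp add: cend_shift_def vec_eq_iff poly_eq_iff coeff_poly_shift)

lemma cend_shift_act: "cend_shift (cend_act h A) = cend_act h (cend_shift A)"
  by (simp add: cend_shift_def cend_act_def vec_eq_iff poly_eq_iff coeff_poly_shift)

lemma cend_shift_0 [simp]: "cend_shift 0 = 0"
  by (simp add: cend_shift_def vec_eq_iff)

lemma cend_shift_const [simp]: "cend_shift (cend_const B) = 0"
  by (simp add: cend_shift_def cend_const_def vec_eq_iff poly_eq_iff coeff_poly_shift)

lemma cend_shift_x [simp]: "cend_shift (cend_x A) = A"
  by (simp add: cend_shift_def cend_x_def vec_eq_iff poly_eq_iff coeff_poly_shift)

lemma funpow_cend_shift: "(cend_shift ^^ m) A $ i $ j = poly_shift m (A $ i $ j)"
  by (induction m) (simp_all add: cend_shift_def poly_eq_iff coeff_poly_shift)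

lemma cend_shift_nilpotent: "\<exists>m. (cend_shift ^^ m) A = 0"
proof -
  define m where "m = Suc (\<Sum>i\<in>UNIV. \<Sum>j\<in>UNIV. Polynomial.degree (A $ i $ j))"
  have "Polynomial.degree (A $ i $ j) < m" for i j
  proof -
    have "Polynomial.degree (A $ i $ j) \<le> (\<Sum>j\<in>UNIV. Polynomial.degree (A $ i $ j))"
      by (rule member_le_sum) auto
    also have "\<dots> \<le> (\<Sum>i\<in>UNIV. \<Sum>j\<in>UNIV. Polynomial.degree (A $ i $ j))"
      by (rule member_le_sum[of i UNIV "\<lambda>i. \<Sum>j\<in>UNIV. Polynomial.degree (A $ i $ j)"]) auto
    finally show ?thesis by (simp add: m_def)
  qed
  then have "(cend_shift ^^ m) A = 0"
    by (simp add: vec_eq_iff funpow_cend_shift poly_eq_iff coeff_poly_shift coeff_eq_0 trans_less_add2)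
  then show ?thesis by blast
qed

text \<open>The constant term in \<open>x\<close> still has coefficients in \<open>H\<close>, hence
  the action of \<open>H\<close> on matrix units.\<close>

lemma cend_decompose:
  "A = cend_x (cend_shift A) + (\<Sum>i\<in>UNIV. \<Sum>j\<in>UNIV. cend_act (Polynomial.coeff (A $ i $ j) 0) (cend_const (mat_unit i j)))"
proof -
  have "(\<Sum>i\<in>UNIV. \<Sum>j\<in>UNIV. cend_act (Polynomial.coeff (A $ i $ j) 0) (cend_const (mat_unit i j))) $ a $ b
      = [:Polynomial.coeff (A $ a $ b) 0:]" for a b
  proof -
    have "(\<Sum>i\<in>UNIV. \<Sum>j\<in>UNIV. cend_act (Polynomial.coeff (A $ i $ j) 0) (cend_const (mat_unit i j))) $ a $ b
        = (\<Sum>i\<in>UNIV. \<Sum>j\<in>UNIV. if j = b then (if i = a then [:Polynomial.coeff (A $ i $ j) 0:] else 0) else 0)"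
      unfolding sum_component
      by (intro sum.cong refl) (simp add: cend_act_def cend_const_def mat_unit_def)
    also have "\<dots> = [:Polynomial.coeff (A $ a $ b) 0:]" by simp
    finally show ?thesis .
  qed
  moreover have "p = pCons 0 (poly_shift 1 p) + [:Polynomial.coeff p 0:]" for p :: "'a poly poly"
    by (simp add: poly_eq_iff coeff_poly_shift coeff_pCons split: nat.split)
  ultimately show ?thesis by (simp add: vec_eq_iff cend_x_def cend_shift_def)
qed

lemma cend_const_unit_mult:
  "cend_const (mat_unit k i ** B) = (\<Sum>j\<in>UNIV. cend_act [:B $ i $ j:] (cend_const (mat_unit k j)))"
proof -
  have "[:[:\<Sum>l\<in>UNIV. mat_unit k i $ a $ l * B $ l $ b:]:] = (\<Sum>j\<in>UNIV. smult [:B $ i $ j:] [:[:mat_unit k j $ a $ b:]:])" for a b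
    by (cases "a = k") (simp_all add: mat_unit_def if_distrib if_distribR sum.delta sum.delta' cong: if_cong)
  then show ?thesis by (simp add: vec_eq_iff cend_const_def cend_act_def matrix_matrix_mult_def)
qed

lemma cend_const_mult_unit:
  "cend_const (B ** mat_unit j k) = (\<Sum>i\<in>UNIV. cend_act [:B $ i $ j:] (cend_const (mat_unit i k)))"
proof -
  have "[:[:\<Sum>l\<in>UNIV. B $ a $ l * mat_unit j k $ l $ b:]:] = (\<Sum>i\<in>UNIV. smult [:B $ i $ j:] [:[:mat_unit i k $ a $ b:]:])" for a b
    by (cases "b = k") (simp_all add: mat_unit_def if_distrib if_distribR sum.delta sum.delta' cong: if_cong)
  then show ?thesis by (simp add: vec_eq_iff cend_const_def cend_act_def matrix_matrix_mult_def)
qed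

lemma mat_unit_mult: "mat_unit i k ** mat_unit k j = mat_unit i j"
proof -
  have "(\<Sum>l\<in>UNIV. mat_unit i k $ a $ l * mat_unit k j $ l $ b) = (mat_unit i j $ a $ b :: 'a)" for a b
    by (cases "a = i"; cases "b = j") (simp_all add: mat_unit_def if_distrib if_distribR sum.delta sum.delta' cong: if_cong)
  then show ?thesis by (simp add: vec_eq_iff matrix_matrix_mult_def)
qed

lemma sum_cend_const_unit: "(\<Sum>i\<in>UNIV. cend_const (mat_unit i i)) = cend_const (mat 1)"
proof -
  have "(\<Sum>i\<in>UNIV. [:[:mat_unit i i $ a $ b:]:]) = [:[:mat 1 $ a $ b :: 'a:]:]" for a b :: 'b
  proof -
    have "(\<Sum>i\<in>UNIV. [:[:mat_unit i i $ a $ b:]:]) = (\<Sum>i\<in>UNIV. if i = a then [:[:mat 1 $ a $ b :: 'a:]:] else 0)"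
      by (rule sum.cong) (auto simp: mat_unit_def mat_def)
    then show ?thesis by simp
  qed
  then show ?thesis by (simp add: vec_eq_iff cend_const_def)
qed

section \<open>The semigroup of the matrix conformal algebra\<close>

locale cend_bimodule = conformal_bimodule_0 cend_act cend_prd actM lprd rprd
  for actM :: "'k::field_char_0 poly \<Rightarrow> 'm::ab_group_add \<Rightarrow> 'm"
    and lprd :: "('k, 'n::finite) cend \<Rightarrow> 'm \<Rightarrow> 'm poly"
    and rprd :: "'m \<Rightarrow> ('k, 'n) cend \<Rightarrow> 'm poly"
begin

lemma val_entry:
  "pc.val [:x:] A B $ i $ j
   = (\<Sum>l\<in>UNIV. sub2 [:[:- x:]:] [:0, 1:] (A $ i $ l) * sub2 [:[:x, 1:]:] [:[:x:], 1:] (B $ l $ j))"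
proof -
  let ?P = "\<Sum>l\<in>UNIV. poly_prd (A $ i $ l) (B $ l $ j)"
  have d: "Polynomial.degree ?P \<le> Polynomial.degree (cend_prd A B)"
    by (rule degree_le) (simp add: coeff_eq_0 flip: coeff_cend_prd)
  have "pc.val [:x:] A B $ i $ j
      = (\<Sum>m\<le>Polynomial.degree (cend_prd A B). Polynomial.coeff ?P m * [:[:x:]:] ^ m)"
    by (simp add: pc.val_def HC.opval_act cend_act_def coeff_cend_prd const_power mult.commute)
  also have "\<dots> = poly ?P [:[:x:]:]"
    unfolding poly_altdef by (rule sum.mono_neutral_right) (use d in \<open>auto simp: coeff_eq_0\<close>)
  finally show ?thesis by (simp add: poly_sum poly_poly_prd)
qed

abbreviation "c_one \<equiv> (cend_const (mat 1) :: ('k, 'n) cend, 0 :: 'k)"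
abbreviation "c_x \<equiv> (cend_x (cend_const (mat 1)) :: ('k, 'n) cend, 0 :: 'k)"

lemma smul_const_const: "smul (cend_const A, x) (cend_const B, y) = (cend_const (A ** B), x + y)"
proof -
  have "(\<Sum>l\<in>UNIV. [:[:a l:]:]) = [:[:\<Sum>l\<in>UNIV. a l:]:]" for a :: "'n \<Rightarrow> 'k"
    using is_ring_hom_sum[OF is_ring_hom_c2, of a UNIV] by simp
  then show ?thesis
    by (simp add: smul_def vec_eq_iff val_entry cend_const_def matrix_matrix_mult_def)
qed

lemma sum_mat_1: "(\<Sum>l\<in>UNIV. smult [:mat 1 $ i $ l:] (f l)) = f i" for f :: "'n \<Rightarrow> 'k poly poly" and i :: 'n
proof -
  have "(\<Sum>l\<in>UNIV. smult [:mat 1 $ i $ l:] (f l)) = (\<Sum>l\<in>UNIV. if l = i then f l else 0)"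
    by (rule sum.cong) (auto simp: mat_def simp flip: one_pCons)
  then show ?thesis by simp
qed

lemma smul_one: "smul c_one s = s"
proof -
  have "pc.val [:0:] (cend_const (mat 1)) (fst s) = fst s"
    unfolding vec_eq_iff val_entry by (simp add: cend_const_def sum_mat_1 sub2_id)
  then show ?thesis by (simp add: smul_def)
qed

lemma smul_x: "smul c_x (A, x) = (cend_x A, x)"
proof -
  have "(\<Sum>l\<in>UNIV. [:0, [:mat 1 $ i $ l:]:] * f l) = pCons 0 (f i)" for f :: "'n \<Rightarrow> 'k poly poly" and i :: 'n
  proof -
    have "(\<Sum>l\<in>UNIV. [:0, [:mat 1 $ i $ l:]:] * f l) = (\<Sum>l\<in>UNIV. if l = i then pCons 0 (f l) else 0)"
      by (rule sum.cong) (auto simp: mat_def simp flip: one_pCons)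
    then show ?thesis by simp
  qed
  then have "pc.val [:0:] (cend_x (cend_const (mat 1))) A = cend_x A"
    unfolding vec_eq_iff val_entry by (simp add: cend_const_def cend_x_def sub2_id sub2_pCons)
  then show ?thesis by (simp add: smul_def)
qed

text \<open>The product replaces \<open>x\<close> in its right factor by
  \<open>x + \<lambda>\<close> and does not affect a constant left factor.\<close>

lemma smul_const_x:
  "smul (cend_const B, x) (cend_x A, y)
   = (cend_x (fst (smul (cend_const B, x) (A, y))) + cend_act [:x:] (fst (smul (cend_const B, x) (A, y))), x + y)"
proof -
  have "b * (pCons 0 f + smult [:x:] f) = pCons 0 (b * f) + smult [:x:] (b * f)" for b f :: "'k poly poly"
    by (simp add: algebra_simps)
  moreover have "pCons 0 (sum f S) = (\<Sum>l\<in>S. pCons 0 (f l))" "smult c (sum f S) = (\<Sum>l\<in>S. smult c (f l))"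
    for f :: "'n \<Rightarrow> 'k poly poly" and S c
    by (induction S rule: infinite_finite_induct) (simp_all add: smult_add_right pCons_0_add del: add_pCons)
  ultimately show ?thesis
    by (simp add: smul_def vec_eq_iff val_entry cend_const_def cend_x_def cend_act_def sub2_pCons sum.distrib add.commute)
qed

text \<open>Constant matrices generate everything under multiplication by \<open>x\<close> and the
  action of \<open>H\<close>, and twisted linearity takes care of the latter. The induction runs
  over the exponent at which \<open>cend_shift\<close> annihilates \<open>A\<close>.\<close>

lemma flin_eq_0I:
  assumes f: "flin x f" and const: "\<And>B. f (cend_const B) = 0" and step: "\<And>A. f A = 0 \<Longrightarrow> f (cend_x A) = 0"
  shows "f A = 0"
proof -
  have "f A = 0" if "(cend_shift ^^ m) A = 0" for m
    using that
  proof (induction m arbitrary: A)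
    case (Suc m)
    have "f (cend_x (cend_shift A)) = 0"
      by (rule step, rule Suc.IH) (use Suc.prems in \<open>simp add: funpow_swap1\<close>)
    then show ?case
      by (subst cend_decompose) (simp add: flinD(1,2,6)[OF f] const)
  qed (simp add: flinD(3)[OF f])
  then show ?thesis using cend_shift_nilpotent by blast
qed

lemma smul_one_right_const: "smul (cend_const B, x) c_one = (cend_const B, x)"
  by (simp add: smul_const_const)

text \<open>In the semigroup \<open>c_one\<close> is only a left unit: multiplying by it on the
  right replaces \<open>\<partial>\<close> in the matrix by \<open>-\<lambda>\<close>. The action
  cannot see this, as it turns \<open>\<partial>\<close> into \<open>-\<lambda>\<close> too.\<close>

lemma lact_smul_one: "lact (smul s c_one) u = lact s u"
proof -
  obtain A x where s: "s = (A, x)" by fastforce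
  define h where "h A = lact (smul (A, x) c_one) u - lact (A, x) u" for A
  have "flin x (\<lambda>A. lact (fst (smul (A, x) c_one), x) u)"
    by (rule flin_smul_left[of x c_one "\<lambda>A. lact (A, x) u"]) (simp add: flin_lact)
  moreover have "h = (\<lambda>A. lact (fst (smul (A, x) c_one), x) u - lact (A, x) u)"
    by (rule ext) (simp add: h_def smul_def)
  ultimately have "flin x h" using flin_diff[OF _ flin_lact] by simp
  then have "h A = 0"
  proof (rule flin_eq_0I)
    fix A assume "h A = 0"
    then show "h (cend_x A) = 0"
      by (simp add: h_def smul_x[of A x, symmetric] mul_assoc L_mul)
  qed (simp add: h_def smul_one_right_const)
  then show ?thesis by (simp add: h_def s)
qed

lemma lact_one: "lact c_one (lact s u) = lact s u"
  by (simp add: smul_one flip: L_mul)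

lemma lact_one': "lact s (lact c_one u) = lact s u"
  by (simp add: lact_smul_one flip: L_mul)


section \<open>Vanishing of the basic cohomology\<close>

abbreviation "x_op \<equiv> lact c_x"

lemma lact_const_xop:
  "lact (cend_const B, x) (x_op u) = x_op (lact (cend_const B, x) u) + actM [:x:] (lact (cend_const B, x) u)"
proof -
  have "smul (cend_const B, x) c_x = (cend_x (cend_const B) + cend_act [:x:] (cend_const B), x)"
    by (simp add: smul_const_x smul_one_right_const)
  then have "lact (cend_const B, x) (x_op u) = lact (cend_x (cend_const B) + cend_act [:x:] (cend_const B), x) u"
    by (simp flip: L_mul)
  also have "\<dots> = lact (cend_x (cend_const B), x) u + actM [:x:] (lact (cend_const B, x) u)"
    using flinD(1,2)[OF flin_lact] by simp
  also have "lact (cend_x (cend_const B), x) u = x_op (lact (cend_const B, x) u)"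
    by (simp add: smul_x flip: L_mul)
  finally show ?thesis .
qed

text \<open>Moving the matrix past a factor \<open>x_op\<close> adds the scalar \<open>x\<close>,
  which is what the shifted argument \<open>y + x\<close> of \<open>w\<close> compensates.\<close>

lemma subst_xop_const:
  assumes "\<exists>p. HM.poly1 w p"
  shows "(\<exists>q. HM.poly1 (\<lambda>y. lact (cend_const B, x) (w (y + x))) q)
    \<and> HM.subst_op x_op (\<lambda>y. lact (cend_const B, x) (w (y + x))) = lact (cend_const B, x) (HM.subst_op x_op w)"
proof -
  let ?L = "lact (cend_const B, x)"
  have X: "HM.klinear x_op" by (rule klinear_lact)
  have A: "HM.klinear (actM [:x:])" by (rule HM.klinear_act)
  have c: "actM [:x:] (x_op u) = x_op (actM [:x:] u)" for u by (simp add: HM.klinearD(2)[OF X])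
  obtain p where "HM.poly1 w p" using assms by blast
  then show ?thesis
  proof (induction p arbitrary: w)
    case 0
    then have "w = (\<lambda>c. 0)" by (simp add: HM.poly1_def opval_def fun_eq_iff)
    then show ?case using HM.poly1_const[of 0] by (auto simp: L.zero)
  next
    case (pCons a p)
    define w' where "w' c = opval (actM [:c:]) p" for c
    have p: "HM.poly1 w' p" by (simp add: HM.poly1_def w'_def)
    have w: "w = (\<lambda>c. a + actM [:c:] (w' c))"
      using pCons.prems by (simp add: HM.poly1_def w'_def endo.opval_pCons[OF HM.endo_act] fun_eq_iff)
    let ?v = "\<lambda>y. ?L (w' (y + x))"
    have v: "\<exists>q. HM.poly1 ?v q" "HM.subst_op x_op ?v = ?L (HM.subst_op x_op w')"
      using pCons.IH[OF p] by blast+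
    have e: "?L (w (y + x)) = (?L a + actM [:y:] (?v y)) + actM [:x:] (?v y)" for y
    proof -
      have "[:y + x:] = [:y:] + [:x:]" by simp
      then have "actM [:y + x:] m = actM [:y:] m + actM [:x:] m" for m
        by (simp only: M.scale_left_distrib)
      then show ?thesis by (simp add: w L_add HM.klinearD(2)[OF klinear_lact] add.assoc)
    qed
    obtain q where q: "HM.poly1 ?v q" using v by blast
    have vy: "\<exists>q. HM.poly1 (\<lambda>y. actM [:y:] (?v y)) q" using HM.poly1_var[OF q] by blast
    have cst: "\<exists>q. HM.poly1 (\<lambda>y. ?L a) q" using HM.poly1_const by blast
    have s1: "\<exists>q. HM.poly1 (\<lambda>y. ?L a + actM [:y:] (?v y)) q"
      using HM.poly1_add[OF HM.poly1_const HM.poly1_var[OF q]] by blast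
    have s2: "\<exists>q. HM.poly1 (\<lambda>y. actM [:x:] (?v y)) q"
      using HM.poly1_comp[OF q A] by blast
    have "HM.subst_op x_op (\<lambda>y. ?L (w (y + x)))
        = ?L a + x_op (?L (HM.subst_op x_op w')) + actM [:x:] (?L (HM.subst_op x_op w'))"
    proof -
      have "HM.subst_op x_op (\<lambda>y. ?L a + actM [:y:] (?v y)) = ?L a + x_op (HM.subst_op x_op ?v)"
        using HM.subst_op_add[OF X cst vy] HM.subst_op_var[OF X v(1)] by simp
      moreover have "HM.subst_op x_op (\<lambda>y. actM [:x:] (?v y)) = actM [:x:] (HM.subst_op x_op ?v)"
        by (rule HM.subst_op_comp[OF X A c v(1)])
      ultimately show ?thesis
        using HM.subst_op_add[OF X s1 s2] by (simp only: e v(2))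
    qed
    moreover have "HM.subst_op x_op w = a + x_op (HM.subst_op x_op w')"
    proof -
      have "\<exists>q. HM.poly1 (\<lambda>c. actM [:c:] (w' c)) q" using HM.poly1_var[OF p] by blast
      moreover have "\<exists>q. HM.poly1 (\<lambda>c. a) q" using HM.poly1_const by blast
      moreover have "\<exists>q. HM.poly1 w' q" using p by blast
      ultimately show ?thesis
        unfolding w by (simp add: HM.subst_op_add[OF X] HM.subst_op_var[OF X])
    qed
    moreover have "\<exists>q. HM.poly1 (\<lambda>y. ?L (w (y + x))) q"
      unfolding e using HM.poly1_add[OF HM.poly1_add[OF HM.poly1_const HM.poly1_var[OF q]] HM.poly1_comp[OF q A]] by blast
    ultimately show ?case by (simp add: L_add lact_const_xop add.assoc)
  qed
qed

text \<open>For fixed \<open>y\<close> the element \<open>w y\<close> implements \<open>D\<close> up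
  to a shift: its right product with \<open>(b, \<lambda>)\<close> is
  \<open>(b, \<lambda>) w(y + \<lambda>) - D(b, \<lambda>)\<close>. Substituting \<open>x_op\<close>
  for \<open>y\<close> absorbs the shift.\<close>

lemma inner_derivation:
  assumes reg: "\<And>s. regular m (D s)"
    and lin: "\<And>x r. flin x (\<lambda>c. D (c, x) r)"
    and pol: "\<And>B cs. length cs = m \<Longrightarrow> HM.polyf (\<lambda>\<rho>. D (cend_const B, \<rho> 0) (zips cs (\<lambda>i. \<rho> (Suc i))))"
    and one: "\<And>s r. lact c_one (D s r) = D s r"
    and der: "\<And>A x B y r. D (smul (cend_const A, x) (cend_const B, y)) r
        = lact (cend_const A, x) (D (cend_const B, y) r) + ra (D (cend_const A, x)) (cend_const B, y) r"
  shows "\<exists>W. regular m W \<and> (\<forall>B x r. D (cend_const B, x) r = lact (cend_const B, x) (W r) - ra W (cend_const B, x) r)"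
proof -
  define k :: 'n where "k = undefined"
  \<comment> \<open>The separability idempotent of the matrix algebra, the sum of
    \<open>e_ik\<close> tensor \<open>e_ki\<close> over \<open>i\<close>, for an arbitrary fixed
    \<open>k\<close>. The scalars \<open>-y\<close> and \<open>y\<close> add up to 0.\<close>
  define w where "w y r = (\<Sum>i\<in>UNIV. lact (cend_const (mat_unit i k), - y) (D (cend_const (mat_unit k i), y) r))" for y r
  define W where "W r = HM.subst_op x_op (\<lambda>y. w y r)" for r
  have X: "HM.klinear x_op" by (rule klinear_lact)
  have len: "D s r = 0" if "length r \<noteq> m" for s r using reg[of s] that by (simp add: regular_def)
  have wpol: "HM.polyf (\<lambda>\<rho>. w (\<rho> 0) (zips cs (\<lambda>i. \<rho> (Suc i))))" for cs
  proof (cases "length cs = m")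
    case True
    have "HM.polyf (\<lambda>\<rho>. lact (cend_const (mat_unit i k), (- 1) * \<rho> 0) (D (cend_const (mat_unit k i), \<rho> 0) (zips cs (\<lambda>i. \<rho> (Suc i)))))" for i
      by (rule polyf_lact[OF pol[OF True]])
    then show ?thesis unfolding w_def by (intro HM.polyf_sum) simp
  next
    case False
    then show ?thesis by (simp add: w_def len L.zero HM.polyf_const)
  qed
  have w1: "\<exists>p. HM.poly1 (\<lambda>y. w y r) p" for r
  proof -
    obtain \<rho> where \<rho>: "r = zips (map fst r) \<rho>" by (rule ex_zips)
    show ?thesis using HM.polyf_slice[OF wpol[of "map fst r"], of \<rho>] \<rho> by simp
  qed
  have ra_w: "ra (w y) (cend_const B, x) r = lact (cend_const B, x) (w (y + x) r) - D (cend_const B, x) r" for y B x r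
  proof -
    let ?s = "(cend_const B, x) :: ('k, 'n) cend \<times> 'k"
    have "ra (w y) ?s r
        = (\<Sum>i\<in>UNIV. lact (cend_const (mat_unit i k), - y) (ra (D (cend_const (mat_unit k i), y)) ?s r))"
      unfolding w_def[abs_def] by (simp add: ra_sum ra_L)
    also have "\<dots> = (\<Sum>i\<in>UNIV. lact (cend_const (mat_unit i k), - y) (D (smul (cend_const (mat_unit k i), y) ?s) r))
        - (\<Sum>i\<in>UNIV. lact (cend_const (mat_unit i k), - y) (lact (cend_const (mat_unit k i), y) (D ?s r)))"
      by (simp add: der L_add flip: sum_subtractf)
    \<comment> \<open>The idempotent multiplies out to \<open>c_one\<close>, which fixes the values
      of \<open>D\<close> by assumption.\<close>
    also have "(\<Sum>i\<in>UNIV. lact (cend_const (mat_unit i k), - y) (lact (cend_const (mat_unit k i), y) (D ?s r))) = D ?s r"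
    proof -
      have "(\<Sum>i\<in>UNIV. lact (cend_const (mat_unit i k), - y) (lact (cend_const (mat_unit k i), y) (D ?s r)))
          = (\<Sum>i\<in>UNIV. lact (cend_const (mat_unit i i), 0) (D ?s r))"
        by (simp add: smul_const_const mat_unit_mult flip: L_mul)
      also have "\<dots> = lact (\<Sum>i\<in>UNIV. cend_const (mat_unit i i), 0) (D ?s r)"
        by (rule flinD(6)[OF flin_lact, symmetric])
      finally show ?thesis by (simp add: sum_cend_const_unit one)
    qed
    \<comment> \<open>\<open>B\<close> moves to the other side of the idempotent:
      \<open>e_ki B\<close> is expanded in the \<open>e_kj\<close>, and then the \<open>e_ik\<close>
      are collected into \<open>B e_jk\<close>.\<close>
    also have "(\<Sum>i\<in>UNIV. lact (cend_const (mat_unit i k), - y) (D (smul (cend_const (mat_unit k i), y) ?s) r))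
        = (\<Sum>i\<in>UNIV. \<Sum>j\<in>UNIV. actM [:B $ i $ j:] (lact (cend_const (mat_unit i k), - y) (D (cend_const (mat_unit k j), y + x) r)))"
      by (simp add: smul_const_const cend_const_unit_mult flinD(2,6)[OF lin] L.sum HM.klinearD(2)[OF klinear_lact])
    also have "\<dots> = (\<Sum>j\<in>UNIV. \<Sum>i\<in>UNIV. actM [:B $ i $ j:] (lact (cend_const (mat_unit i k), - y) (D (cend_const (mat_unit k j), y + x) r)))"
      by (rule sum.swap)
    also have "\<dots> = (\<Sum>j\<in>UNIV. lact (cend_const (B ** mat_unit j k), - y) (D (cend_const (mat_unit k j), y + x) r))"
      by (simp add: cend_const_mult_unit flinD(2,6)[OF flin_lact])
    also have "\<dots> = lact ?s (w (y + x) r)"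
    proof -
      have "(cend_const (B ** mat_unit j k), - y) = smul ?s (cend_const (mat_unit j k), - (y + x))" for j
        by (simp add: smul_const_const)
      then show ?thesis by (simp only: w_def L.sum L_mul)
    qed
    finally show ?thesis .
  qed
  have main: "D (cend_const B, x) r = lact (cend_const B, x) (W r) - ra W (cend_const B, x) r" for B x r
  proof -
    \<comment> \<open>As a left action \<open>x_op\<close> commutes with the right action, so
      \<open>ra\<close> passes through the substitution.\<close>
    have "ra W (cend_const B, x) r = HM.subst_op x_op (\<lambda>y. ra (w y) (cend_const B, x) r)"
      using ra_subst_op[OF X L_R[symmetric], of w] w1 by (simp add: W_def[abs_def])
    also have "\<dots> = lact (cend_const B, x) (W r) - D (cend_const B, x) r"
      unfolding ra_w using subst_xop_const[OF w1[of r], of B x] HM.poly1_const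
      by (subst HM.subst_op_diff[OF X]) (auto simp: W_def)
    finally show ?thesis by simp
  qed
  have "regular m W"
    unfolding regular_def
  proof (intro conjI allI impI)
    fix r :: "(('k, 'n) cend \<times> 'k) list" assume "length r \<noteq> m"
    then show "W r = 0" by (simp add: W_def w_def len L.zero)
  next
    show "multilin W"
      unfolding multilin_def
    proof (intro allI flinI)
      fix pre post :: "(('k, 'n) cend \<times> 'k) list" and x :: 'k and c c' h
      have wlin: "flin x (\<lambda>c. w y (pre @ (c, x) # post))" for y
        unfolding w_def using reg
        by (intro flin_sum flin_comp[OF _ klinear_lact] multilinD) (simp add: regular_def)
      show "W (pre @ (c + c', x) # post) = W (pre @ (c, x) # post) + W (pre @ (c', x) # post)"
        by (simp add: W_def flinD(1)[OF wlin] HM.subst_op_add[OF X w1 w1])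
      show "W (pre @ (cend_act h c, x) # post) = actM [:poly h (- x):] (W (pre @ (c, x) # post))"
      proof -
        have c: "actM [:poly h (- x):] (x_op u) = x_op (actM [:poly h (- x):] u)" for u by (simp add: HM.klinearD(2)[OF X])
        have "(\<lambda>y. w y (pre @ (cend_act h c, x) # post)) = (\<lambda>y. actM [:poly h (- x):] (w y (pre @ (c, x) # post)))"
          by (rule ext) (rule flinD(2)[OF wlin])
        then show ?thesis
          by (simp only: W_def) (rule HM.subst_op_comp[OF X HM.klinear_act[of "[:poly h (- x):]"] c w1])
      qed
    qed
  next
    fix cs :: "('k, 'n) cend list"
    show "HM.polyf (\<lambda>\<rho>. W (zips cs \<rho>))"
      unfolding W_def using HM.polyf_subst_op[OF X wpol[of cs]] by simp
  qed
  with main show ?thesis by blast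
qed


text \<open>With zero left action, the cocycle identity with first argument \<open>c_one\<close>
  reads \<open>f(s, r) = ra (f(c_one, _)) s r\<close>, because \<open>c_one\<close> is a left unit.
  This makes \<open>-f(c_one, _)\<close> a primitive.\<close>

lemma coboundary_if_lact_0:
  assumes f: "regular (Suc m) f" "\<And>ss. bd f ss = 0" and z: "\<And>s ss. lact s (f ss) = 0"
  shows "\<exists>g. regular m g \<and> (\<forall>ss. bd g ss = f ss)"
proof (intro exI conjI allI)
  have m: "HM.klinear uminus" by (simp add: HM.klinear_def)
  show "regular m (\<lambda>r. - f (c_one # r))"
    by (rule regular_comp[OF regular_Cons[OF f(1)] m])
  fix ss
  show "bd (\<lambda>r. - f (c_one # r)) ss = f ss"
  proof (cases ss)
    case Nil
    then show ?thesis using f(1) by (simp add: regular_def)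
  next
    case (Cons s r)
    have "ra (\<lambda>r. f (c_one # r)) s r = f (s # r)"
      using f(2)[of "c_one # s # r"] by (simp add: z smul_one)
    then show ?thesis by (simp add: Cons bd_minus z)
  qed
qed

lemma bd_lact_one: "bd (\<lambda>r. lact c_one (f r)) ss = lact c_one (bd f ss)"
  by (cases ss) (simp_all add: L.zero L.diff ra_L lact_one lact_one')

text \<open>As a function of its first argument a cocycle is a derivation into
  \<open>m\<close>-cochains, so \<open>inner_derivation\<close> yields a primitive over constant
  matrices.\<close>

lemma ex_primitive_on_const:
  assumes f: "regular (Suc m) f" "\<And>ss. bd f ss = 0" and one: "\<And>ss. lact c_one (f ss) = f ss"
  shows "\<exists>g. regular m g \<and> (\<forall>ss. lact c_one (bd g ss) = bd g ss) \<and> (\<forall>B x r. bd g ((cend_const B, x) # r) = f ((cend_const B, x) # r))"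
proof -
  have "\<exists>W. regular m W \<and> (\<forall>B x r. f ((cend_const B, x) # r) = lact (cend_const B, x) (W r) - ra W (cend_const B, x) r)"
  proof (rule inner_derivation[of m "\<lambda>s r. f (s # r)"])
    fix B :: "'k ^ 'n ^ 'n" and cs :: "('k, 'n) cend list" assume "length cs = m"
    then have "HM.polyf (\<lambda>\<rho>. f (zips (cend_const B # cs) \<rho>))"
      using f(1) by (simp add: regular_def)
    then show "HM.polyf (\<lambda>\<rho>. f ((cend_const B, \<rho> 0) # zips cs (\<lambda>i. \<rho> (Suc i))))"
      by (simp add: zips_Cons)
  next
    fix A B :: "'k ^ 'n ^ 'n" and x y r
    show "f (smul (cend_const A, x) (cend_const B, y) # r) = lact (cend_const A, x) (f ((cend_const B, y) # r))
        + ra (\<lambda>r. f ((cend_const A, x) # r)) (cend_const B, y) r"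
      using f(2)[of "(cend_const A, x) # (cend_const B, y) # r"] by (simp add: algebra_simps)
  next
    show "regular m (\<lambda>r. f (s # r))" for s by (rule regular_Cons[OF f(1)])
  qed (use f(1) one in \<open>simp_all add: multilin_hd regular_def\<close>)
  then obtain W where W: "regular m W" "\<And>B x r. f ((cend_const B, x) # r) = bd W ((cend_const B, x) # r)"
    by auto
  show ?thesis
  proof (intro exI conjI allI)
    \<comment> \<open>\<open>W\<close> is replaced by \<open>c_one W\<close> so that its
      differential also lies in the part fixed by \<open>c_one\<close>.\<close>
    show "regular m (\<lambda>r. lact c_one (W r))" by (rule regular_comp[OF W(1) klinear_lact])
    show "lact c_one (bd (\<lambda>r. lact c_one (W r)) ss) = bd (\<lambda>r. lact c_one (W r)) ss" for ss
      by (simp add: bd_lact_one lact_one)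
    show "bd (\<lambda>r. lact c_one (W r)) ((cend_const B, x) # r) = f ((cend_const B, x) # r)" for B x r
      unfolding bd_lact_one W(2)[symmetric] by (rule one)
  qed
qed

text \<open>The solution \<open>h\<close> of \<open>h (x A) = x h (A) + F A\<close> that vanishes on constants, for \<open>F\<close> linear in \<open>A\<close>.\<close>

definition horner :: "(('k, 'n) cend \<Rightarrow> 'm) \<Rightarrow> ('k, 'n) cend \<Rightarrow> 'm" where
  "horner F A = (\<Sum>i<(LEAST m. (cend_shift ^^ m) A = 0). (x_op ^^ i) (F ((cend_shift ^^ Suc i) A)))"

section \<open>Recursion along multiplication by \<open>x\<close>\<close>

lemma funpow_xop_0: "(x_op ^^ i) 0 = 0"
  by (induction i) (simp_all add: L.zero)

lemma funpow_cend_shift_0: "(cend_shift ^^ i) 0 = 0"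
  by (induction i) simp_all

lemma funpow_cend_shift_mono:
  assumes "(cend_shift ^^ l) A = 0" "l \<le> k"
  shows "(cend_shift ^^ k) A = 0"
proof -
  have k: "k = (k - l) + l" using assms(2) by simp
  show ?thesis by (subst k) (simp only: funpow_add comp_apply assms(1) funpow_cend_shift_0)
qed

text \<open>Any exponent that annihilates \<open>A\<close> may serve as the number of terms, so sums
  for different matrices can be brought to a common length.\<close>

lemma horner_bound:
  assumes "F 0 = 0" "(cend_shift ^^ m) A = 0"
  shows "horner F A = (\<Sum>i<m. (x_op ^^ i) (F ((cend_shift ^^ Suc i) A)))"
proof -
  define l where "l = (LEAST m. (cend_shift ^^ m) A = 0)"
  have l: "(cend_shift ^^ l) A = 0" "l \<le> m"
    unfolding l_def using assms(2) by (auto intro: LeastI Least_le)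
  have z: "(cend_shift ^^ Suc i) A = 0" if "l \<le> i" for i
    using funpow_cend_shift_mono[OF l(1), of "Suc i"] that by (simp del: funpow.simps)
  show ?thesis
    unfolding horner_def l_def[symmetric]
    by (rule sum.mono_neutral_left) (use l z assms(1) in \<open>auto simp: funpow_xop_0 simp del: funpow.simps\<close>)
qed

lemma flin_funpow_cend_shift:
  assumes "flin x F"
  shows "flin x (\<lambda>A. F ((cend_shift ^^ i) A))"
proof -
  have "(cend_shift ^^ i) (A + B) = (cend_shift ^^ i) A + (cend_shift ^^ i) B"
    "(cend_shift ^^ i) (cend_act h A) = cend_act h ((cend_shift ^^ i) A)" for A B :: "('k, 'n) cend" and h
    by (induction i) (simp_all add: cend_shift_add cend_shift_act)
  then show ?thesis using assms by (simp add: flin_def)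
qed

lemma flin_horner:
  assumes "flin x F"
  shows "flin x (horner F)"
proof -
  define G where "G m A = (\<Sum>i<m. (x_op ^^ i) (F ((cend_shift ^^ Suc i) A)))" for m A
  have G: "flin x (G m)" for m
    unfolding G_def by (intro flin_sum flin_comp[OF _ HM.klinear_funpow[OF klinear_lact]] flin_funpow_cend_shift assms)
  have b: "\<exists>m. \<forall>n\<ge>m. horner F A = G n A" for A
  proof -
    obtain m where m: "(cend_shift ^^ m) A = 0" using cend_shift_nilpotent by blast
    have "(cend_shift ^^ n) A = 0" if "n \<ge> m" for n
      using funpow_cend_shift_mono[OF m that] .
    then show ?thesis unfolding G_def using horner_bound[of F] flinD(3)[OF assms] by blast
  qed
  show ?thesis
  proof (rule flinI)
    fix A B h
    obtain a where "\<forall>n\<ge>a. horner F A = G n A" using b[of A] by blast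
    moreover obtain b where "\<forall>n\<ge>b. horner F B = G n B" using b[of B] by blast
    moreover obtain c where "\<forall>n\<ge>c. horner F (A + B) = G n (A + B)" using b[of "A + B"] by blast
    moreover obtain d where "\<forall>n\<ge>d. horner F (cend_act h A) = G n (cend_act h A)" using b[of "cend_act h A"] by blast
    \<comment> \<open>The sum of the four thresholds is a length valid for all four
      matrices.\<close>
    ultimately have "horner F A = G (a + b + c + d) A" "horner F B = G (a + b + c + d) B"
      "horner F (A + B) = G (a + b + c + d) (A + B)" "horner F (cend_act h A) = G (a + b + c + d) (cend_act h A)"
      by simp_all
    then show "horner F (A + B) = horner F A + horner F B" "horner F (cend_act h A) = actM [:poly h (- x):] (horner F A)"
      using flinD(1,2)[OF G] by simp_all
  qed
qed

lemma horner_x: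
  assumes "F 0 = 0"
  shows "horner F (cend_x A) = F A + x_op (horner F A)"
proof -
  obtain m where m: "(cend_shift ^^ m) A = 0" using cend_shift_nilpotent by blast
  have s: "(cend_shift ^^ Suc i) (cend_x A) = (cend_shift ^^ i) A" for i
    by (simp add: funpow_swap1)
  have "horner F (cend_x A) = (\<Sum>i<Suc m. (x_op ^^ i) (F ((cend_shift ^^ i) A)))"
    using horner_bound[of F "Suc m" "cend_x A"] assms m by (simp only: s)
  also have "\<dots> = F A + (\<Sum>i<m. x_op ((x_op ^^ i) (F ((cend_shift ^^ Suc i) A))))"
    by (subst sum.lessThan_Suc_shift) simp
  finally show ?thesis by (simp only: horner_bound[of F m A, OF assms m] L.sum)
qed

lemma horner_const:
  assumes "F 0 = 0"
  shows "horner F (cend_const B) = 0"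
  using horner_bound[of F 1 "cend_const B"] assms by (simp add: horner_bound[of F 0 0])

text \<open>Two leading arguments are needed: the obstruction to a recursive primitive is
  \<open>f(x, s, ...)\<close>, whose values at constant \<open>s\<close> have to be corrected by
  some \<open>W\<close> first.\<close>

lemma coboundary_if_const_0:
  assumes f: "regular (Suc (Suc m)) f" "\<And>ss. bd f ss = 0" and one: "\<And>ss. lact c_one (f ss) = f ss"
    and const: "\<And>B x r. f ((cend_const B, x) # r) = 0"
  shows "\<exists>g. regular (Suc m) g \<and> (\<forall>ss. bd g ss = f ss)"
proof -
  have ml: "multilin f" using f(1) by (simp add: regular_def)
  have f_const: "f (smul (cend_const B, x) y # r) = lact (cend_const B, x) (f (y # r))" for B x y r
    using f(2)[of "(cend_const B, x) # y # r"] by (simp add: const ra_zero)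
  \<comment> \<open>The product of the matrix with \<open>x\<close> on its right is \<open>x\<close>
    times it plus a scalar multiple of it, and \<open>f\<close> vanishes on this multiple.\<close>
  have f_x_const: "f (smul c_x (cend_const B, x) # r) = lact (cend_const B, x) (f (c_x # r))" for B x r
  proof -
    have "lact (cend_const B, x) (f (c_x # r)) = f ((cend_x (cend_const B) + cend_act [:x:] (cend_const B), x) # r)"
      unfolding f_const[symmetric] by (simp add: smul_const_x smul_one_right_const)
    also have "\<dots> = f ((cend_x (cend_const B), x) # r)"
      using flinD(1,2)[OF multilin_hd[OF ml]] by (simp add: const)
    finally show ?thesis by (simp add: smul_x)
  qed
  \<comment> \<open>The cocycle identity at \<open>x\<close>, a constant matrix and
    \<open>y\<close>. For constant \<open>y\<close> it is the derivation property needed for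
    \<open>inner_derivation\<close>.\<close>
  have f_x: "f (c_x # smul (cend_const B, x) y # r) = lact (cend_const B, x) (f (c_x # y # r)) + ra (\<lambda>r. f (c_x # (cend_const B, x) # r)) y r"
    for B x y r
    using f(2)[of "c_x # (cend_const B, x) # y # r"] by (simp add: const L.zero f_x_const algebra_simps)
  have "\<exists>W. regular m W \<and> (\<forall>B x r. f (c_x # (cend_const B, x) # r) = lact (cend_const B, x) (W r) - ra W (cend_const B, x) r)"
  proof (rule inner_derivation[of m "\<lambda>s r. f (c_x # s # r)"])
    fix B :: "'k ^ 'n ^ 'n" and cs :: "('k, 'n) cend list" assume "length cs = m"
    then have "HM.polyf (\<lambda>\<rho>. f (zips (cend_x (cend_const (mat 1)) # cend_const B # cs) \<rho>))"
      using f(1) by (simp add: regular_def)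
    then have "HM.polyf (\<lambda>\<rho>. f (zips (cend_x (cend_const (mat 1)) # cend_const B # cs) (case_nat 0 \<rho>)))"
      by (rule HM.polyf_subst) (auto split: nat.split)
    then show "HM.polyf (\<lambda>\<rho>. f (c_x # (cend_const B, \<rho> 0) # zips cs (\<lambda>i. \<rho> (Suc i))))"
      by (simp add: zips_Cons)
  next
    show "regular m (\<lambda>r. f (c_x # s # r))" for s
      using regular_Cons[OF regular_Cons[OF f(1)]] .
  qed (use one f_x ml in \<open>simp_all add: multilin_2\<close>)
  then obtain W where W: "regular m W"
    "\<And>B x. (\<lambda>r. f (c_x # (cend_const B, x) # r)) = (\<lambda>r. lact (cend_const B, x) (W r) - ra W (cend_const B, x) r)"
    by (auto simp: fun_eq_iff)
  have mlW: "multilin W" using W(1) by (simp add: regular_def)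
  \<comment> \<open>The inhomogeneous term of the recursion for the primitive; \<open>ra W y\<close>
    stands for \<open>W\<close> multiplied by \<open>y\<close> from the right.\<close>
  define F where "F y r = - (ra W y r + f (c_x # y # r))" for y r
  have m: "HM.klinear uminus" by (simp add: HM.klinear_def)
  have F_lin: "flin x (\<lambda>A. F (A, x) r)" for x r
    unfolding F_def by (intro flin_comp[OF _ m] flin_add flin_ra_hd mlW multilin_2 ml)
  have F_0: "F (0, x) r = 0" for x r using flinD(3)[OF F_lin] .
  \<comment> \<open>The correction by \<open>W\<close> is chosen for this: the two terms in which
    \<open>W\<close> is multiplied first by the matrix and then by \<open>y\<close> cancel.\<close>
  have F_const: "F (smul (cend_const B, x) y) r = lact (cend_const B, x) (F y r)" for B x y r
    unfolding F_def f_x W(2) by (simp add: ra_diff ra_L ra_ra L.minus L.add L.diff)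
  define g where "g ss = (case ss of [] \<Rightarrow> 0 | s # r \<Rightarrow> horner (\<lambda>A. F (A, snd s) r) (fst s))" for ss
  have g_Cons: "g ((A, x) # r) = horner (\<lambda>A. F (A, x) r) A" for A x r by (simp add: g_def)
  have g_const: "g ((cend_const B, x) # r) = 0" for B x r
    by (simp add: g_Cons horner_const F_0)
  have g_x: "g (smul c_x y # r) = F y r + x_op (g (y # r))" for y r
    by (cases y) (simp add: smul_x g_Cons horner_x F_0)
  have g_lin: "flin x (\<lambda>A. g ((A, x) # r))" for x r
    unfolding g_Cons by (rule flin_horner[OF F_lin])
  \<comment> \<open>Both sides satisfy the same recursion along \<open>x\<close>: the additional
    scalar from moving the matrix past \<open>x\<close> is the one in
    \<open>lact_const_xop\<close>.\<close>
  have g_smul: "g (smul (cend_const B, x) y # r) = lact (cend_const B, x) (g (y # r))" for B x y r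
  proof -
    obtain A z where y: "y = (A, z)" by fastforce
    let ?s = "(cend_const B, x) :: ('k, 'n) cend \<times> 'k"
    define h where "h A = g (smul ?s (A, z) # r) - lact ?s (g ((A, z) # r))" for A
    have "flin z (\<lambda>A. g ((fst (smul ?s (A, z)), x + z) # r))"
      by (rule flin_smul_right[of ?s z "\<lambda>A. g ((A, x + z) # r)"]) (simp add: g_lin)
    moreover have "h = (\<lambda>A. g ((fst (smul ?s (A, z)), x + z) # r) - lact ?s (g ((A, z) # r)))"
      by (rule ext) (simp add: h_def smul_def)
    ultimately have "flin z h" using flin_diff[OF _ flin_comp[OF g_lin klinear_lact]] by simp
    then have "h A = 0"
    proof (rule flin_eq_0I)
      fix A assume A: "h A = 0"
      define e where "e = fst (smul ?s (A, z))"
      have e: "smul ?s (A, z) = (e, x + z)" by (simp add: e_def smul_def)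
      have "g (smul ?s (cend_x A, z) # r) = g ((cend_x e, x + z) # r) + g ((cend_act [:x:] e, x + z) # r)"
        using flinD(1)[OF g_lin] by (simp add: smul_const_x e)
      also have "\<dots> = F (e, x + z) r + x_op (g ((e, x + z) # r)) + actM [:x:] (g ((e, x + z) # r))"
        using g_x[of "(e, x + z)" r] flinD(2)[OF g_lin] by (simp add: smul_x)
      also have "\<dots> = lact ?s (F (A, z) r) + lact ?s (x_op (g ((A, z) # r)))"
        using A F_const[of B x "(A, z)" r] by (simp add: h_def e lact_const_xop add.assoc)
      also have "\<dots> = lact ?s (g ((cend_x A, z) # r))"
        using g_x[of "(A, z)" r] by (simp add: smul_x L.add)
      finally show "h (cend_x A) = 0" by (simp add: h_def)
    qed (simp add: h_def smul_const_const g_const L.zero)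
    then show ?thesis by (simp add: h_def y)
  qed
  have bd_g_const: "bd g ((cend_const B, x) # t # r) = 0" for B x t r
    by (simp add: g_smul g_const ra_zero)
  \<comment> \<open>The case of the unit matrix in \<open>f_x\<close>, where the first two terms
    agree.\<close>
  have ra_one: "ra (\<lambda>r. f (c_x # c_one # r)) t r = 0" for t r
    using f_x[of "mat 1" 0 t r] by (simp add: smul_one one)
  \<comment> \<open>\<open>W\<close> enters \<open>F\<close> once and the value of the primitive at
    \<open>x\<close> once more; the two contributions cancel and leave \<open>f\<close>.\<close>
  have bd_g_x: "bd g (c_x # t # r) = f (c_x # t # r)" for t r
  proof -
    have "g (c_x # r) = F c_one r" for r
      using g_x[of c_one r] by (simp add: smul_x g_const L.zero)
    then have "ra (\<lambda>r. g (c_x # r)) t r = - ra W t r"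
      by (simp add: F_def ra_minus ra_add ra_diff ra_ra ra_one smul_one)
    then show ?thesis by (simp add: g_x F_def)
  qed
  have len: "F y r = 0" if "length r \<noteq> m" for y r
    using that f(1) W(1) ra_length[of m W r y] by (simp add: F_def regular_def)
  have horner_0: "horner (\<lambda>A. 0) A = 0" for A by (simp add: horner_def funpow_xop_0)
  have reg: "regular (Suc m) g"
    unfolding regular_def
  proof (intro conjI allI impI)
    fix ss :: "(('k, 'n) cend \<times> 'k) list" assume "length ss \<noteq> Suc m"
    then show "g ss = 0" by (cases ss) (simp_all add: g_def len horner_0)
  next
    show "multilin g"
      unfolding multilin_def
    proof (intro allI)
      fix pre post :: "(('k, 'n) cend \<times> 'k) list" and x :: 'k
      show "flin x (\<lambda>c. g (pre @ (c, x) # post))"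
      proof (cases pre)
        case Nil
        then show ?thesis by (simp add: g_lin)
      next
        case (Cons s pre')
        have "multilin (F y)" for y
          unfolding F_def[abs_def] by (intro multilin_comp[OF _ m] multilin_add multilin_ra mlW multilin_Cons ml)
        then show ?thesis
          \<comment> \<open>The number of terms depends only on the first matrix, hence stays fixed
            while a later slot varies.\<close>
          unfolding Cons g_def horner_def append_Cons list.case
          by (intro flin_sum flin_comp[OF _ HM.klinear_funpow[OF klinear_lact]] multilinD)
      qed
    qed
  next
    fix cs :: "('k, 'n) cend list" assume cs: "length cs = Suc m"
    then obtain c cs' where c: "cs = c # cs'" "length cs' = m" by (cases cs) auto
    have "HM.polyf (\<lambda>\<rho>. F (A, \<rho> 0) (zips cs' (\<lambda>i. \<rho> (Suc i))))" for A
    proof -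
      have "HM.polyf (\<lambda>\<rho>. W (zips cs' \<rho>))" using W(1) c(2) by (simp add: regular_def)
      then have "HM.polyf (\<lambda>\<rho>. W (zips cs' (\<lambda>i. \<rho> (Suc i))))"
        by (rule HM.polyf_subst) auto
      then have 1: "HM.polyf (\<lambda>\<rho>. lact (A, 1 * \<rho> 0) (W (zips cs' (\<lambda>i. \<rho> (Suc i)))))"
        by (rule polyf_lact)
      \<comment> \<open>\<open>ra W\<close> is the left action on \<open>W\<close> minus
        \<open>bd W\<close>, and both are known to be polynomial.\<close>
      have 2: "HM.polyf (\<lambda>\<rho>. bd W (zips (A # cs') \<rho>))"
        using regular_bd[OF W(1)] c(2) by (simp add: regular_def)
      have "HM.polyf (\<lambda>\<rho>. f (zips (cend_x (cend_const (mat 1)) # A # cs') \<rho>))"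
        using f(1) c(2) by (simp add: regular_def)
      then have 3: "HM.polyf (\<lambda>\<rho>. f (zips (cend_x (cend_const (mat 1)) # A # cs') (case_nat 0 \<rho>)))"
        by (rule HM.polyf_subst) (auto split: nat.split)
      show ?thesis
        using HM.polyf_diff[OF HM.polyf_diff[OF 2 1] 3] by (simp add: zips_Cons F_def algebra_simps)
    qed
    then show "HM.polyf (\<lambda>\<rho>. g (zips cs \<rho>))"
      unfolding c(1) zips_Cons g_def horner_def list.case fst_conv snd_conv
      by (intro HM.polyf_sum HM.polyf_comp[OF _ HM.klinear_funpow[OF klinear_lact]])
  qed
  define h where "h ss = f ss - bd g ss" for ss
  have h_reg: "regular (Suc (Suc m)) h"
    unfolding h_def[abs_def] using regular_diff[OF f(1) regular_bd[OF reg, simplified]] .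
  have h_bd: "bd h ss = 0" for ss
    unfolding h_def[abs_def] by (simp add: bd_diff f(2) bd_bd)
  have h_const: "h ((cend_const B, x) # t # r) = 0" for B x t r
    unfolding h_def by (simp only: bd_g_const const diff_self)
  have h_x: "h (c_x # r) = 0" for r
  proof (cases r)
    case Nil
    then show ?thesis using h_reg by (simp add: regular_def)
  next
    case (Cons t r')
    then show ?thesis unfolding h_def by (simp only: bd_g_x diff_self)
  qed
  have h_lin: "flin x (\<lambda>A. h ((A, x) # r))" for x r
    using h_reg by (simp add: regular_def multilin_hd)
  \<comment> \<open>\<open>h\<close> is a cocycle that vanishes when its first argument is constant
    or \<open>c_x\<close>. Its cocycle identity with first argument \<open>c_x\<close> carries
    vanishing from \<open>A\<close> to \<open>x A\<close>.\<close>
  have "h ss = 0" for ss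
  proof (cases "length ss = Suc (Suc m)")
    case True
    then obtain A x t r where ss: "ss = (A, x) # t # r" by (metis length_Suc_conv surj_pair)
    have "h ((A, x) # t # r) = 0"
    proof (rule flin_eq_0I[OF h_lin])
      fix A assume "h ((A, x) # t # r) = 0"
      then show "h ((cend_x A, x) # t # r) = 0"
        using h_bd[of "c_x # (A, x) # t # r"] by (simp add: smul_x h_x ra_zero L.zero)
    qed (rule h_const)
    then show ?thesis by (simp add: ss)
  next
    case False
    then show ?thesis using h_reg by (simp add: regular_def)
  qed
  then show ?thesis using reg by (auto simp: h_def)
qed

text \<open>With \<open>u = c_one f\<close>, the cocycle is split into \<open>f - u\<close>, which
  every left action kills, the coboundary \<open>bd g1\<close>, which agrees with \<open>u\<close>
  on constant first arguments, and the rest \<open>u - bd g1\<close>, which vanishes there.\<close>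

theorem coboundary_if_cocycle:
  assumes "n \<ge> 2" and f: "regular n f" "\<And>ss. bd f ss = 0"
  shows "\<exists>g. regular (n - 1) g \<and> (\<forall>ss. bd g ss = f ss)"
proof -
  obtain m where n: "n = Suc (Suc m)" using assms(1) by (intro that[of "n - 2"]) auto
  define u where "u ss = lact c_one (f ss)" for ss
  have bd_u: "bd u ss = 0" for ss
    using bd_lact_one[of f ss] by (simp add: u_def[abs_def] f(2) L.zero)
  have u: "regular (Suc (Suc m)) u"
    unfolding u_def[abs_def] using regular_comp[OF f(1) klinear_lact] n by simp
  have "\<exists>g. regular (Suc m) g \<and> (\<forall>ss. bd g ss = f ss - u ss)"
  proof (rule coboundary_if_lact_0)
    show "regular (Suc (Suc m)) (\<lambda>ss. f ss - u ss)" using regular_diff[OF f(1)[unfolded n] u] .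
    show "bd (\<lambda>ss. f ss - u ss) ss = 0" for ss by (simp add: bd_diff f(2) bd_u)
    show "lact s (f ss - u ss) = 0" for s ss by (simp add: L.diff u_def lact_one')
  qed
  then obtain g0 where g0: "regular (Suc m) g0" "\<And>ss. bd g0 ss = f ss - u ss" by blast
  have u1: "lact c_one (u ss) = u ss" for ss by (simp add: u_def lact_one)
  obtain g1 where g1: "regular (Suc m) g1" "\<And>ss. lact c_one (bd g1 ss) = bd g1 ss"
    "\<And>B x r. bd g1 ((cend_const B, x) # r) = u ((cend_const B, x) # r)"
    using ex_primitive_on_const[OF u bd_u u1] by blast
  have "\<exists>g. regular (Suc m) g \<and> (\<forall>ss. bd g ss = u ss - bd g1 ss)"
  proof (rule coboundary_if_const_0)
    show "regular (Suc (Suc m)) (\<lambda>ss. u ss - bd g1 ss)" using regular_diff[OF u regular_bd[OF g1(1), simplified]] .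
    show "bd (\<lambda>ss. u ss - bd g1 ss) ss = 0" for ss by (simp add: bd_diff bd_u bd_bd)
    show "lact c_one (u ss - bd g1 ss) = u ss - bd g1 ss" for ss by (simp only: L.diff u1 g1(2))
    show "u ((cend_const B, x) # r) - bd g1 ((cend_const B, x) # r) = 0" for B x r by (simp only: g1(3) diff_self)
  qed
  then obtain g2 where g2: "regular (Suc m) g2" "\<And>ss. bd g2 ss = u ss - bd g1 ss" by blast
  show ?thesis
  proof (intro exI conjI allI)
    show "regular (n - 1) (\<lambda>r. g0 r + (g1 r + g2 r))" using n g0(1) g1(1) g2(1) by (simp add: regular_add)
    show "bd (\<lambda>r. g0 r + (g1 r + g2 r)) ss = f ss" for ss by (simp add: bd_add g0(2) g2(2))
  qed
qed

end

theorem theorem4p5: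
  fixes actM :: "'k::field_char_0 poly \<Rightarrow> 'm::ab_group_add \<Rightarrow> 'm"
    and lprd :: "('k, 'n::finite) cend \<Rightarrow> 'm \<Rightarrow> 'm poly"
    and rprd :: "'m \<Rightarrow> ('k, 'n) cend \<Rightarrow> 'm poly"
    and n :: nat
  assumes "conformal_bimodule cend_act cend_prd actM lprd rprd"
    and "n \<ge> 2"
  shows "trivial_group (conformal_bimodule.cohomology_group cend_act cend_prd actM lprd rprd n)"
proof -
  interpret conformal_bimodule cend_act cend_prd actM lprd rprd by (rule assms(1))
  interpret cend_bimodule actM lprd rprd ..
  show ?thesis
    using trivial_cohomology_if_basic[OF assms(2)] coboundary_if_cocycle by blast
qed

end
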